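(* Let $T$ be a complete theory eliminating imaginaries, and let $M\models T$ be atomic and strongly $\omega$-homogeneous over a set of parameters $A\subseteq M$. Let $B$ be a normal extension of $A$ in $M$ with $B=\operatorname{dcl}(B)$, such that every elementary permutation of $B$ fixing $A$ pointwise extends to an automorphism of $M$ and such that $M$ is atomic and strongly $\omega$-homogeneous over $B$. Let $G$ be an $A$-definable group. Then there is a natural isomorphism of pointed sets $$\mathrm{P}_{\mathrm{def}}(B/A,G(B))\;\cong\;\mathrm{H}^1_{\mathrm{def}}(B/A,G(B))$$ (a basepoint-preserving bijection, natural with respect to $A$-definable group homomorphisms in $G$) between the pointed set of $A$-isomorphism classes of $A$-definable right principal homogeneous spaces for $G$ which contain a $B$-point and the pointed set of cohomology classes of definable cocycles from $\operatorname{Aut}(B/A)$ to $G(B)$.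
   Context: $M$ is atomic over $A$ if the type over $A$ of every finite tuple from $M$ is isolated. $M$ is strongly $\omega$-homogeneous over $A$ if for any two finite tuples from $M$ with the same type over $A$ there is an automorphism of $M$ fixing $A$ pointwise and taking one to the other. A set $B$ with $A\subseteq B\subseteq M$ is a normal extension of $A$ in $M$ if for every finite tuple $\bar b$ from $B$, every realization of $\operatorname{tp}(\bar b/A)$ in $M$ is contained in $B$. $\operatorname{Aut}(B/A)$ is the group of permutations of $B$ that are elementary (in the sense of $M$) and fix $A$ pointwise. For an $A$-definable set $X$, $X(B)$ is the set of elements of $X(M)$ all of whose coordinates lie in $B$ (the $B$-points of $X$); $G(B)$ is a subgroup of $G(M)$ since $B=\operatorname{dcl}(B)$. An $A$-definable right principal homogeneous space (PHS) for $G$ is a nonempty $A$-definable set $X$ with an $A$-definable right action $X\times G\to X$ such that for all $x,y\in X$ there is a unique $g\in G$ with $xg=y$. An isomorphism of PHSs is an $A$-definable bijection commuting with the actions of $G$. $\mathrm{P}_{\mathrm{def}}(B/A,G(B))$ is the set of isomorphism classes of $A$-definable PHSs for $G$ that contain a $B$-point (this property is isomorphism-invariant since $B=\operatorname{dcl}(B)$), with basepoint the class of $G$ acting on itself by right multiplication. A definable (right) cocycle from $\operatorname{Aut}(B/A)$ to $G(B)$ is a function $\varphi:\operatorname{Aut}(B/A)\to G(B)$ such that (i) $\varphi(\sigma\tau)=\varphi(\sigma)\,\sigma(\varphi(\tau))$ for all $\sigma,\tau$, and (ii) there are an $A$-definable function $h(\bar x,\bar y)$ and a finite tuple $\bar a$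 from $B$ with $\varphi(\sigma)=h(\bar a,\sigma(\bar a))$ for all $\sigma$. Cocycles $\varphi,\psi$ are cohomologous if there is $b\in G(B)$ with $\varphi(\sigma)=b^{-1}\psi(\sigma)\sigma(b)$ for all $\sigma\in\operatorname{Aut}(B/A)$. $\mathrm{H}^1_{\mathrm{def}}(B/A,G(B))$ is the set of definable cocycles modulo this equivalence relation, with basepoint the class of the cocycle constantly equal to the identity. Functoriality in $G$: an $A$-definable homomorphism $f:G\to G'$ sends the class of a cocycle $\varphi$ to the class of $f\circ\varphi$, and sends the class of a PHS $X$ for $G$ to the class of the contracted product $X\times^G G'$, i.e. the quotient of $X\times G'$ by the equivalence relation identifying $(xg,g')$ with $(x,f(g)g')$ for $g\in G$, with $G'$ acting by right multiplication on the second coordinate (an $A$-definable set by elimination of imaginaries). *)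

theory Defs
  imports "HOL-Algebra.Group" "HOL-Combinatorics.Permutations"
begin

section \<open>First-order logic\<close>

text \<open>A language is given by its function and relation symbols together with their arities
  (constants are function symbols of arity 0). Logic is one-sorted, with equality.\<close>

record ('f, 'r) language =
  funs :: "('f \<times> nat) set"
  rels :: "('r \<times> nat) set"

datatype 'f tm = Var nat | App 'f "'f tm list"

text \<open>Bound variables are de Bruijn indices.\<close>

datatype ('f, 'r) fm =
    Eq "'f tm" "'f tm"
  | Rel 'r "'f tm list"
  | Neg "('f, 'r) fm"
  | Conj "('f, 'r) fm" "('f, 'r) fm"
  | Ex "('f, 'r) fm"

fun tm_of :: "('f, 'r) language \<Rightarrow> 'f tm \<Rightarrow> bool" where
  "tm_of L (Var i) \<longleftrightarrow> True"
| "tm_of L (App f ts) \<longleftrightarrow> (f, length ts) \<in> funs L \<and> (\<forall>t\<in>set ts. tm_of L t)"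

fun fm_of :: "('f, 'r) language \<Rightarrow> ('f, 'r) fm \<Rightarrow> bool" where
  "fm_of L (Eq s t) \<longleftrightarrow> tm_of L s \<and> tm_of L t"
| "fm_of L (Rel r ts) \<longleftrightarrow> (r, length ts) \<in> rels L \<and> (\<forall>t\<in>set ts. tm_of L t)"
| "fm_of L (Neg \<phi>) \<longleftrightarrow> fm_of L \<phi>"
| "fm_of L (Conj \<phi> \<psi>) \<longleftrightarrow> fm_of L \<phi> \<and> fm_of L \<psi>"
| "fm_of L (Ex \<phi>) \<longleftrightarrow> fm_of L \<phi>"

fun fv_tm :: "'f tm \<Rightarrow> nat set" where
  "fv_tm (Var i) = {i}"
| "fv_tm (App f ts) = (\<Union>t\<in>set ts. fv_tm t)"

fun fv :: "('f, 'r) fm \<Rightarrow> nat set" where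
  "fv (Eq s t) = fv_tm s \<union> fv_tm t"
| "fv (Rel r ts) = (\<Union>t\<in>set ts. fv_tm t)"
| "fv (Neg \<phi>) = fv \<phi>"
| "fv (Conj \<phi> \<psi>) = fv \<phi> \<union> fv \<psi>"
| "fv (Ex \<phi>) = {i. Suc i \<in> fv \<phi>}"

definition formula :: "('f, 'r) language \<Rightarrow> nat \<Rightarrow> ('f, 'r) fm \<Rightarrow> bool" where
  "formula L n \<phi> \<longleftrightarrow> fm_of L \<phi> \<and> fv \<phi> \<subseteq> {..<n}"

record ('f, 'r, 'a) struct =
  universe :: "'a set"
  fun_int :: "'f \<Rightarrow> 'a list \<Rightarrow> 'a"
  rel_int :: "'r \<Rightarrow> 'a list \<Rightarrow> bool"

definition tuples :: "'a set \<Rightarrow> nat \<Rightarrow> 'a list set" where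
  "tuples U n = {xs. set xs \<subseteq> U \<and> length xs = n}"

definition struct_of :: "('f, 'r) language \<Rightarrow> ('f, 'r, 'a) struct \<Rightarrow> bool" where
  "struct_of L M \<longleftrightarrow> universe M \<noteq> {} \<and>
     (\<forall>(f, n)\<in>funs L. \<forall>xs\<in>tuples (universe M) n. fun_int M f xs \<in> universe M)"

fun eval :: "('f, 'r, 'a) struct \<Rightarrow> (nat \<Rightarrow> 'a) \<Rightarrow> 'f tm \<Rightarrow> 'a" where
  "eval M e (Var i) = e i"
| "eval M e (App f ts) = fun_int M f (map (eval M e) ts)"

fun sat :: "('f, 'r, 'a) struct \<Rightarrow> (nat \<Rightarrow> 'a) \<Rightarrow> ('f, 'r) fm \<Rightarrow> bool" where
  "sat M e (Eq s t) \<longleftrightarrow> eval M e s = eval M e t"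
| "sat M e (Rel r ts) \<longleftrightarrow> rel_int M r (map (eval M e) ts)"
| "sat M e (Neg \<phi>) \<longleftrightarrow> \<not> sat M e \<phi>"
| "sat M e (Conj \<phi> \<psi>) \<longleftrightarrow> sat M e \<phi> \<and> sat M e \<psi>"
| "sat M e (Ex \<phi>) \<longleftrightarrow> (\<exists>a\<in>universe M. sat M (case_nat a e) \<phi>)"

text \<open>\<open>holds M \<phi> xs\<close> is only used when all free variables of \<open>\<phi>\<close> are \<open>< length xs\<close>.\<close>

definition holds :: "('f, 'r, 'a) struct \<Rightarrow> ('f, 'r) fm \<Rightarrow> 'a list \<Rightarrow> bool" where
  "holds M \<phi> xs \<longleftrightarrow> sat M (\<lambda>i. xs ! i) \<phi>"


section \<open>Theories\<close>

definition models :: "('f, 'r) language \<Rightarrow> ('f, 'r) fm set \<Rightarrow> ('f, 'r, 'a) struct \<Rightarrow> bool" where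
  "models L T M \<longleftrightarrow> struct_of L M \<and> (\<forall>\<phi>\<in>T. holds M \<phi> [])"

text \<open>HOL cannot quantify over structures of all types, so in the next two notions the models are
  those whose universe is a set of elements of the given type. For completeness this is at most a
  weakening. For the type of a model \<open>M\<close> of a complete theory \<open>T\<close>, both conditions in the definition of
  elimination of imaginaries are first-order, so they hold in all models as soon as they hold in \<open>M\<close>.\<close>

definition complete_theory :: "'a itself \<Rightarrow> ('f, 'r) language \<Rightarrow> ('f, 'r) fm set \<Rightarrow> bool" where
  "complete_theory (U :: 'a itself) L T \<longleftrightarrow>
     (\<forall>\<phi>\<in>T. formula L 0 \<phi>) \<and>
     (\<exists>N :: ('f, 'r, 'a) struct. models L T N) \<and>
     (\<forall>\<phi>. formula L 0 \<phi> \<longrightarrow>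
        (\<forall>N :: ('f, 'r, 'a) struct. models L T N \<longrightarrow> holds N \<phi> []) \<or>
        (\<forall>N :: ('f, 'r, 'a) struct. models L T N \<longrightarrow> holds N (Neg \<phi>) []))"

text \<open>Elimination of imaginaries in the form that makes quotients definable sets: every
  \<open>\<emptyset>\<close>-definable equivalence relation is the kernel of a \<open>\<emptyset>\<close>-definable function.\<close>

definition eliminates_imaginaries ::
  "'a itself \<Rightarrow> ('f, 'r) language \<Rightarrow> ('f, 'r) fm set \<Rightarrow> bool" where
  "eliminates_imaginaries (U :: 'a itself) L T \<longleftrightarrow>
     (\<forall>n \<epsilon>. formula L (n + n) \<epsilon> \<and>
        (\<forall>N :: ('f, 'r, 'a) struct. models L T N \<longrightarrow>
           equiv (tuples (universe N) n)
             {(x, y). x \<in> tuples (universe N) n \<and> y \<in> tuples (universe N) n \<and> holds N \<epsilon> (x @ y)})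
      \<longrightarrow> (\<exists>k \<psi>. formula L (n + k) \<psi> \<and>
             (\<forall>N :: ('f, 'r, 'a) struct. models L T N \<longrightarrow>
               (\<exists>F. F \<in> tuples (universe N) n \<rightarrow> tuples (universe N) k \<and>
                 (\<forall>x\<in>tuples (universe N) n. \<forall>z\<in>tuples (universe N) k.
                    holds N \<psi> (x @ z) \<longleftrightarrow> F x = z) \<and>
                 (\<forall>x\<in>tuples (universe N) n. \<forall>y\<in>tuples (universe N) n.
                    holds N \<epsilon> (x @ y) \<longleftrightarrow> F x = F y)))))"


section \<open>Definability, types and automorphisms\<close>

text \<open>A formula over \<open>A\<close> in \<open>n\<close> variables is a formula of \<open>L\<close> together with a list of elements of \<open>A\<close>
  to be substituted for the variables from \<open>n\<close> on.\<close>

definition formulas_over ::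
  "('f, 'r) language \<Rightarrow> 'a set \<Rightarrow> nat \<Rightarrow> (('f, 'r) fm \<times> 'a list) set" where
  "formulas_over L A n = {(\<phi>, as). set as \<subseteq> A \<and> formula L (n + length as) \<phi>}"

definition definable :: "('f, 'r) language \<Rightarrow> ('f, 'r, 'a) struct \<Rightarrow> 'a set \<Rightarrow> 'a list set \<Rightarrow> bool" where
  "definable L M A X \<longleftrightarrow>
     (\<exists>n. \<exists>(\<phi>, as)\<in>formulas_over L A n. X = {xs \<in> tuples (universe M) n. holds M \<phi> (xs @ as)})"

definition definable_map ::
  "('f, 'r) language \<Rightarrow> ('f, 'r, 'a) struct \<Rightarrow> 'a set \<Rightarrow> 'a list set \<Rightarrow> ('a list \<Rightarrow> 'a list) \<Rightarrow> bool" where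
  "definable_map L M A X f \<longleftrightarrow>
     (\<exists>m n. X \<subseteq> tuples (universe M) m \<and> f \<in> X \<rightarrow> tuples (universe M) n) \<and>
     definable L M A {x @ f x |x. x \<in> X}"

definition definable_map2 ::
  "('f, 'r) language \<Rightarrow> ('f, 'r, 'a) struct \<Rightarrow> 'a set \<Rightarrow> 'a list set \<Rightarrow> 'a list set \<Rightarrow>
     ('a list \<Rightarrow> 'a list \<Rightarrow> 'a list) \<Rightarrow> bool" where
  "definable_map2 L M A X Y f \<longleftrightarrow>
     (\<exists>m n k. X \<subseteq> tuples (universe M) m \<and> Y \<subseteq> tuples (universe M) n \<and>
        f \<in> X \<rightarrow> Y \<rightarrow> tuples (universe M) k) \<and>
     definable L M A {x @ y @ f x y |x y. x \<in> X \<and> y \<in> Y}"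

definition dcl :: "('f, 'r) language \<Rightarrow> ('f, 'r, 'a) struct \<Rightarrow> 'a set \<Rightarrow> 'a set" where
  "dcl L M B = {c \<in> universe M. definable L M B {[c]}}"

definition tp :: "('f, 'r) language \<Rightarrow> ('f, 'r, 'a) struct \<Rightarrow> 'a set \<Rightarrow> 'a list \<Rightarrow>
    (('f, 'r) fm \<times> 'a list) set" where
  "tp L M A xs = {(\<phi>, as) \<in> formulas_over L A (length xs). holds M \<phi> (xs @ as)}"

definition isolated_type ::
  "('f, 'r) language \<Rightarrow> ('f, 'r, 'a) struct \<Rightarrow> 'a set \<Rightarrow> 'a list \<Rightarrow> bool" where
  "isolated_type L M A xs \<longleftrightarrow>
     (\<exists>(\<phi>, as)\<in>tp L M A xs. \<forall>(\<psi>, bs)\<in>tp L M A xs.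
        \<forall>ys\<in>tuples (universe M) (length xs). holds M \<phi> (ys @ as) \<longrightarrow> holds M \<psi> (ys @ bs))"

definition atomic_over :: "('f, 'r) language \<Rightarrow> ('f, 'r, 'a) struct \<Rightarrow> 'a set \<Rightarrow> bool" where
  "atomic_over L M A \<longleftrightarrow> (\<forall>xs\<in>lists (universe M). isolated_type L M A xs)"

definition automorphism :: "('f, 'r) language \<Rightarrow> ('f, 'r, 'a) struct \<Rightarrow> ('a \<Rightarrow> 'a) \<Rightarrow> bool" where
  "automorphism L M \<sigma> \<longleftrightarrow> \<sigma> permutes universe M \<and>
     (\<forall>(f, n)\<in>funs L. \<forall>xs\<in>tuples (universe M) n. \<sigma> (fun_int M f xs) = fun_int M f (map \<sigma> xs)) \<and>
     (\<forall>(r, n)\<in>rels L. \<forall>xs\<in>tuples (universe M) n. rel_int M r (map \<sigma> xs) \<longleftrightarrow> rel_int M r xs)"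

definition strongly_omega_homogeneous_over ::
  "('f, 'r) language \<Rightarrow> ('f, 'r, 'a) struct \<Rightarrow> 'a set \<Rightarrow> bool" where
  "strongly_omega_homogeneous_over L M A \<longleftrightarrow>
     (\<forall>xs\<in>lists (universe M). \<forall>ys\<in>lists (universe M). tp L M A xs = tp L M A ys \<longrightarrow>
        (\<exists>\<sigma>. automorphism L M \<sigma> \<and> (\<forall>a\<in>A. \<sigma> a = a) \<and> map \<sigma> xs = ys))"

definition normal_extension ::
  "('f, 'r) language \<Rightarrow> ('f, 'r, 'a) struct \<Rightarrow> 'a set \<Rightarrow> 'a set \<Rightarrow> bool" where
  "normal_extension L M A B \<longleftrightarrow> A \<subseteq> B \<and> B \<subseteq> universe M \<and>
     (\<forall>bs\<in>lists B. \<forall>cs\<in>lists (universe M). tp L M A cs = tp L M A bs \<longrightarrow> cs \<in> lists B)"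

text \<open>Permutations of \<open>B\<close> are represented by functions that are the identity outside \<open>B\<close>.\<close>

definition Aut :: "('f, 'r) language \<Rightarrow> ('f, 'r, 'a) struct \<Rightarrow> 'a set \<Rightarrow> 'a set \<Rightarrow> ('a \<Rightarrow> 'a) set" where
  "Aut L M B A = {\<sigma>. \<sigma> permutes B \<and> (\<forall>a\<in>A. \<sigma> a = a) \<and>
     (\<forall>bs\<in>lists B. \<forall>\<phi>. formula L (length bs) \<phi> \<longrightarrow> (holds M \<phi> (map \<sigma> bs) \<longleftrightarrow> holds M \<phi> bs))}"


section \<open>Definable groups and principal homogeneous spaces\<close>

definition definable_group ::
  "('f, 'r) language \<Rightarrow> ('f, 'r, 'a) struct \<Rightarrow> 'a set \<Rightarrow> 'a list monoid \<Rightarrow> bool" where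
  "definable_group L M A G \<longleftrightarrow> group G \<and> definable L M A (carrier G) \<and>
     definable_map2 L M A (carrier G) (carrier G) (monoid.mult G)"

definition definable_homs ::
  "('f, 'r) language \<Rightarrow> ('f, 'r, 'a) struct \<Rightarrow> 'a set \<Rightarrow> 'a list monoid \<Rightarrow> 'a list monoid \<Rightarrow>
     ('a list \<Rightarrow> 'a list) set" where
  "definable_homs L M A G G' = {f \<in> hom G G'. definable_map L M A (carrier G) f}"

text \<open>The underlying set and the action; values of the action off the set are irrelevant.\<close>

type_synonym 'a gspace = "'a list set \<times> ('a list \<Rightarrow> 'a list \<Rightarrow> 'a list)"

definition phs ::
  "('f, 'r) language \<Rightarrow> ('f, 'r, 'a) struct \<Rightarrow> 'a set \<Rightarrow> 'a list monoid \<Rightarrow> 'a gspace \<Rightarrow> bool" where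
  "phs L M A G = (\<lambda>(X, act). X \<noteq> {} \<and> definable L M A X \<and>
     act \<in> X \<rightarrow> carrier G \<rightarrow> X \<and> definable_map2 L M A X (carrier G) act \<and>
     (\<forall>x\<in>X. act x \<one>\<^bsub>G\<^esub> = x) \<and>
     (\<forall>x\<in>X. \<forall>g\<in>carrier G. \<forall>h\<in>carrier G. act (act x g) h = act x (g \<otimes>\<^bsub>G\<^esub> h)) \<and>
     (\<forall>x\<in>X. \<forall>y\<in>X. \<exists>!g. g \<in> carrier G \<and> act x g = y))"

definition phs_iso ::
  "('f, 'r) language \<Rightarrow> ('f, 'r, 'a) struct \<Rightarrow> 'a set \<Rightarrow> 'a list monoid \<Rightarrow>
     'a gspace \<Rightarrow> 'a gspace \<Rightarrow> bool" where
  "phs_iso L M A G = (\<lambda>(X, act) (Y, act'). \<exists>f. bij_betw f X Y \<and> definable_map L M A X f \<and>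
     (\<forall>x\<in>X. \<forall>g\<in>carrier G. f (act x g) = act' (f x) g))"

definition pointed_phs ::
  "('f, 'r) language \<Rightarrow> ('f, 'r, 'a) struct \<Rightarrow> 'a set \<Rightarrow> 'a set \<Rightarrow> 'a list monoid \<Rightarrow> 'a gspace set" where
  "pointed_phs L M B A G = {(X, act). phs L M A G (X, act) \<and> X \<inter> lists B \<noteq> {}}"

definition phs_rel ::
  "('f, 'r) language \<Rightarrow> ('f, 'r, 'a) struct \<Rightarrow> 'a set \<Rightarrow> 'a set \<Rightarrow> 'a list monoid \<Rightarrow>
     ('a gspace \<times> 'a gspace) set" where
  "phs_rel L M B A G = {(S, S'). S \<in> pointed_phs L M B A G \<and> S' \<in> pointed_phs L M B A G \<and>
     phs_iso L M A G S S'}"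

definition P_def ::
  "('f, 'r) language \<Rightarrow> ('f, 'r, 'a) struct \<Rightarrow> 'a set \<Rightarrow> 'a set \<Rightarrow> 'a list monoid \<Rightarrow>
     'a gspace set set" where
  "P_def L M B A G = pointed_phs L M B A G // phs_rel L M B A G"

definition P_base ::
  "('f, 'r) language \<Rightarrow> ('f, 'r, 'a) struct \<Rightarrow> 'a set \<Rightarrow> 'a set \<Rightarrow> 'a list monoid \<Rightarrow>
     'a gspace set" where
  "P_base L M B A G = phs_rel L M B A G `` {(carrier G, monoid.mult G)}"

text \<open>The definable quotient map \<open>q : X \<times> G' \<rightarrow> Z\<close> exhibits \<open>Z\<close> as the contracted product.\<close>

definition contracted_product ::
  "('f, 'r) language \<Rightarrow> ('f, 'r, 'a) struct \<Rightarrow> 'a set \<Rightarrow> 'a list monoid \<Rightarrow> 'a list monoid \<Rightarrow>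
     ('a list \<Rightarrow> 'a list) \<Rightarrow> 'a gspace \<Rightarrow> 'a gspace \<Rightarrow> bool" where
  "contracted_product L M A G G' f = (\<lambda>(X, act) (Z, act'). \<exists>q.
     definable_map2 L M A X (carrier G') q \<and>
     Z = {q x g' |x g'. x \<in> X \<and> g' \<in> carrier G'} \<and>
     (\<forall>x\<in>X. \<forall>y\<in>X. \<forall>g'\<in>carrier G'. \<forall>h'\<in>carrier G'.
        q x g' = q y h' \<longleftrightarrow> (\<exists>g\<in>carrier G. x = act y g \<and> h' = f g \<otimes>\<^bsub>G'\<^esub> g')) \<and>
     (\<forall>x\<in>X. \<forall>g'\<in>carrier G'. \<forall>h'\<in>carrier G'. act' (q x g') h' = q x (g' \<otimes>\<^bsub>G'\<^esub> h')))"

definition P_map ::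
  "('f, 'r) language \<Rightarrow> ('f, 'r, 'a) struct \<Rightarrow> 'a set \<Rightarrow> 'a set \<Rightarrow> 'a list monoid \<Rightarrow> 'a list monoid \<Rightarrow>
     ('a list \<Rightarrow> 'a list) \<Rightarrow> 'a gspace set \<Rightarrow> 'a gspace set" where
  "P_map L M B A G G' f p =
     phs_rel L M B A G' `` {S'. \<exists>S\<in>p. contracted_product L M A G G' f S S'}"


section \<open>Definable cocycles\<close>

definition definable_cocycles ::
  "('f, 'r) language \<Rightarrow> ('f, 'r, 'a) struct \<Rightarrow> 'a set \<Rightarrow> 'a set \<Rightarrow> 'a list monoid \<Rightarrow>
     (('a \<Rightarrow> 'a) \<Rightarrow> 'a list) set" where
  "definable_cocycles L M B A G =
     {\<phi> \<in> Aut L M B A \<rightarrow>\<^sub>E carrier G \<inter> lists B.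
        (\<forall>\<sigma>\<in>Aut L M B A. \<forall>\<tau>\<in>Aut L M B A. \<phi> (\<sigma> \<circ> \<tau>) = \<phi> \<sigma> \<otimes>\<^bsub>G\<^esub> map \<sigma> (\<phi> \<tau>)) \<and>
        (\<exists>D h. \<exists>as\<in>lists B. definable_map L M A D h \<and>
           (\<forall>\<sigma>\<in>Aut L M B A. as @ map \<sigma> as \<in> D \<and> \<phi> \<sigma> = h (as @ map \<sigma> as)))}"

definition cohomologous ::
  "('f, 'r) language \<Rightarrow> ('f, 'r, 'a) struct \<Rightarrow> 'a set \<Rightarrow> 'a set \<Rightarrow> 'a list monoid \<Rightarrow>
     ((('a \<Rightarrow> 'a) \<Rightarrow> 'a list) \<times> (('a \<Rightarrow> 'a) \<Rightarrow> 'a list)) set" where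
  "cohomologous L M B A G =
     {(\<phi>, \<psi>). \<phi> \<in> definable_cocycles L M B A G \<and> \<psi> \<in> definable_cocycles L M B A G \<and>
        (\<exists>b\<in>carrier G \<inter> lists B. \<forall>\<sigma>\<in>Aut L M B A.
           \<phi> \<sigma> = inv\<^bsub>G\<^esub> b \<otimes>\<^bsub>G\<^esub> \<psi> \<sigma> \<otimes>\<^bsub>G\<^esub> map \<sigma> b)}"

definition H1_def ::
  "('f, 'r) language \<Rightarrow> ('f, 'r, 'a) struct \<Rightarrow> 'a set \<Rightarrow> 'a set \<Rightarrow> 'a list monoid \<Rightarrow>
     (('a \<Rightarrow> 'a) \<Rightarrow> 'a list) set set" where
  "H1_def L M B A G = definable_cocycles L M B A G // cohomologous L M B A G"

definition H1_base ::
  "('f, 'r) language \<Rightarrow> ('f, 'r, 'a) struct \<Rightarrow> 'a set \<Rightarrow> 'a set \<Rightarrow> 'a list monoid \<Rightarrow>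
     (('a \<Rightarrow> 'a) \<Rightarrow> 'a list) set" where
  "H1_base L M B A G = cohomologous L M B A G `` {\<lambda>\<sigma>\<in>Aut L M B A. \<one>\<^bsub>G\<^esub>}"

definition H1_map ::
  "('f, 'r) language \<Rightarrow> ('f, 'r, 'a) struct \<Rightarrow> 'a set \<Rightarrow> 'a set \<Rightarrow> 'a list monoid \<Rightarrow>
     ('a list \<Rightarrow> 'a list) \<Rightarrow> (('a \<Rightarrow> 'a) \<Rightarrow> 'a list) set \<Rightarrow> (('a \<Rightarrow> 'a) \<Rightarrow> 'a list) set" where
  "H1_map L M B A G' f c =
     cohomologous L M B A G' `` {(\<lambda>\<sigma>\<in>Aut L M B A. f (\<phi> \<sigma>)) |\<phi>. \<phi> \<in> c}"


section \<open>Isomorphisms of pointed sets\<close>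

definition pointed_iso :: "('x \<Rightarrow> 'y) \<Rightarrow> 'x set \<Rightarrow> 'x \<Rightarrow> 'y set \<Rightarrow> 'y \<Rightarrow> bool" where
  "pointed_iso F X x\<^sub>0 Y y\<^sub>0 \<longleftrightarrow> x\<^sub>0 \<in> X \<and> y\<^sub>0 \<in> Y \<and> bij_betw F X Y \<and> F x\<^sub>0 = y\<^sub>0"

end

theory Submission
  imports Defs
begin

text \<open>The cocycle of a torsor measures how the automorphisms of \<open>M\<close> over \<open>A\<close> move a \<open>B\<close>-point. If \<open>x\<close> is
  a \<open>B\<close>-point of the torsor \<open>X\<close>, then \<open>\<sigma>(x) = x \<phi>(\<sigma>)\<close> for a unique \<open>\<phi>(\<sigma>) \<in> G(B)\<close>. The bijection
  \<open>g \<mapsto> x g\<close> identifies \<open>X\<close> with \<open>G\<close> on which the automorphisms act in the twisted way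
  \<open>g \<mapsto> \<phi>(\<sigma>) \<sigma>(g)\<close>, so \<open>\<phi>\<close> knows everything about \<open>X\<close>, provided that definability over \<open>A\<close> can be
  recognised from the action of the automorphisms.

  This recognition is what atomicity and homogeneity give. The orbit of a finite tuple over \<open>A\<close> is
  the set of realisations of its type, and the type is isolated, so the orbit is definable over \<open>A\<close>
  (\<open>orbit_definable\<close>). A set that is definable with some parameters of \<open>M\<close> and invariant under all
  automorphisms over \<open>A\<close> is therefore definable over \<open>A\<close>: quantify over the orbit of the parameters
  (\<open>invariant_definable\<close>). Over \<open>B\<close> the same argument shows that a tuple fixed by all automorphisms
  over \<open>B\<close> lies in \<open>dcl B = B\<close>. Automorphisms over \<open>A\<close> restrict to \<open>B\<close> by normality, and every element
  of \<open>Aut(B/A)\<close> is such a restriction, so all computations can be carried out with automorphisms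
  of \<open>M\<close>.

  A torsor and a cocycle are related (\<open>represents\<close>) if the cocycle comes from some \<open>B\<close>-point of the
  torsor. Related torsors are isomorphic exactly when the cocycles are cohomologous (\<open>phs_rel_iff\<close>):
  an isomorphism carries one \<open>B\<close>-point to another, and changing the point by \<open>b \<in> G(B)\<close> replaces
  the cocycle by a cohomologous one; conversely, after such a change the two cocycles agree, and \<open>x g \<mapsto> y g\<close> is
  invariant. Every cocycle is related to a torsor (\<open>cocycle_represented\<close>): if \<open>\<phi>(\<sigma>) = h(a, \<sigma>(a))\<close>,
  the pair \<open>(\<sigma>(a), g)\<close> stands for the point \<open>\<sigma>(x) g = x \<phi>(\<sigma>) g\<close> of the torsor to be found; two pairs
  standing for the same point is an equivalence relation that is invariant, hence definable over \<open>A\<close>,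
  and elimination of imaginaries provides the quotient. So the relation induces a bijection of classes.

  For a homomorphism \<open>f\<close> the image of \<open>(x, 1)\<close> in the contracted product has cocycle \<open>f \<circ> \<phi>\<close>, which
  is naturality. That contracted products exist follows by mapping \<open>X \<times> G'\<close> to a torsor with cocycle
  \<open>f \<circ> \<phi>\<close> and point \<open>z\<close> by \<open>(x g, g') \<mapsto> z f(g) g'\<close>.\<close>

section \<open>Substituting variables and invariance under automorphisms\<close>

fun ren_tm :: "(nat \<Rightarrow> nat) \<Rightarrow> 'f tm \<Rightarrow> 'f tm" where
  "ren_tm r (Var i) = Var (r i)"
| "ren_tm r (App f ts) = App f (map (ren_tm r) ts)"

fun ren :: "(nat \<Rightarrow> nat) \<Rightarrow> ('f, 'r) fm \<Rightarrow> ('f, 'r) fm" where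
  "ren r (Eq s t) = Eq (ren_tm r s) (ren_tm r t)"
| "ren r (Rel R ts) = Rel R (map (ren_tm r) ts)"
| "ren r (Neg \<phi>) = Neg (ren r \<phi>)"
| "ren r (Conj \<phi> \<psi>) = Conj (ren r \<phi>) (ren r \<psi>)"
| "ren r (Ex \<phi>) = Ex (ren (case_nat 0 (Suc \<circ> r)) \<phi>)"

lemma eval_ren: "eval M e (ren_tm r t) = eval M (\<lambda>i. e (r i)) t"
  by (induction t) (simp_all add: comp_def cong: map_cong)

lemma sat_ren: "sat M e (ren r \<phi>) \<longleftrightarrow> sat M (\<lambda>i. e (r i)) \<phi>"
proof (induction \<phi> arbitrary: e r)
  case (Ex \<phi>)
  have "(\<lambda>i. case_nat a e (case_nat 0 (Suc \<circ> r) i)) = case_nat a (\<lambda>i. e (r i))" for a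
    by (auto split: nat.splits)
  then show ?case unfolding ren.simps sat.simps Ex by simp
qed (simp_all add: eval_ren comp_def)

lemma tm_of_ren: "tm_of L (ren_tm r t) \<longleftrightarrow> tm_of L t"
  by (induction t) auto

lemma fm_of_ren: "fm_of L (ren r \<phi>) \<longleftrightarrow> fm_of L \<phi>"
  by (induction \<phi> arbitrary: r) (auto simp: tm_of_ren)

lemma fv_ren_tm: "fv_tm (ren_tm r t) = r ` fv_tm t"
  by (induction t) auto

lemma fv_ren: "fv (ren r \<phi>) = r ` fv \<phi>"
proof (induction \<phi> arbitrary: r)
  case (Ex \<phi>)
  have "Suc i \<in> case_nat 0 (Suc \<circ> r) ` S \<longleftrightarrow> i \<in> r ` {i. Suc i \<in> S}"
    (is "?l \<longleftrightarrow> ?r") for i S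
  proof
    assume ?l
    then obtain j where "j \<in> S" "Suc i = case_nat 0 (Suc \<circ> r) j" by blast
    then show ?r by (cases j) auto
  next
    assume ?r
    then obtain j where j: "Suc j \<in> S" "i = r j" by blast
    show ?l by (rule image_eqI[OF _ j(1)]) (simp add: j)
  qed
  then show ?case using Ex by auto
qed (auto simp: fv_ren_tm)

lemma eval_cong: "(\<And>i. i \<in> fv_tm t \<Longrightarrow> e i = e' i) \<Longrightarrow> eval M e t = eval M e' t"
proof (induction t)
  case (App f ts)
  then have "map (eval M e) ts = map (eval M e') ts" by (intro map_cong) auto
  then show ?case unfolding eval.simps by (rule arg_cong)
qed simp

lemma sat_cong: "(\<And>i. i \<in> fv \<phi> \<Longrightarrow> e i = e' i) \<Longrightarrow> sat M e \<phi> \<longleftrightarrow> sat M e' \<phi>"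
proof (induction \<phi> arbitrary: e e')
  case (Eq s t)
  then have "eval M e s = eval M e' s" "eval M e t = eval M e' t"
    by (auto intro!: eval_cong)
  then show ?case by simp
next
  case (Rel R ts)
  then have "map (eval M e) ts = map (eval M e') ts"
    by (intro map_cong eval_cong) auto
  then show ?case unfolding sat.simps by (rule arg_cong)
next
  case (Neg \<phi>)
  then show ?case by (metis fv.simps(3) sat.simps(3))
next
  case (Conj \<phi> \<psi>)
  then show ?case by (metis UnCI fv.simps(4) sat.simps(4))
next
  case (Ex \<phi>)
  have "sat M (case_nat a e) \<phi> \<longleftrightarrow> sat M (case_nat a e') \<phi>" for a
    by (rule Ex.IH) (use Ex.prems in \<open>auto split: nat.splits\<close>)
  then show ?case by simp
qed

lemma formula_ren:
  assumes "formula L (length js) \<phi>" "set js \<subseteq> {..<n}"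
  shows "formula L n (ren (\<lambda>i. js ! i) \<phi>)"
  using assms(1) nth_mem[of _ js] subsetD[OF assms(2)]
  unfolding formula_def fm_of_ren fv_ren by (auto 0 3)

lemma holds_ren:
  assumes "formula L (length js) \<phi>"
  shows "holds M (ren (\<lambda>i. js ! i) \<phi>) xs \<longleftrightarrow> holds M \<phi> (map (\<lambda>j. xs ! j) js)"
  unfolding holds_def sat_ren
  by (rule sat_cong) (use assms in \<open>auto simp: formula_def\<close>)

lemma holds_Neg [simp]: "holds M (Neg \<phi>) xs \<longleftrightarrow> \<not> holds M \<phi> xs"
  and holds_Conj [simp]: "holds M (Conj \<phi> \<psi>) xs \<longleftrightarrow> holds M \<phi> xs \<and> holds M \<psi> xs"
  by (simp_all add: holds_def)

lemma holds_Ex: "holds M (Ex \<phi>) xs \<longleftrightarrow> (\<exists>a\<in>universe M. holds M \<phi> (a # xs))"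
proof -
  have "case_nat a ((!) xs) = (!) (a # xs)" for a
    by (rule ext) (auto split: nat.splits)
  then show ?thesis by (simp add: holds_def)
qed

lemma holds_Exs: "holds M ((Ex ^^ k) \<phi>) xs \<longleftrightarrow> (\<exists>us\<in>tuples (universe M) k. holds M \<phi> (us @ xs))"
proof (induction k arbitrary: \<phi>)
  case 0
  then show ?case by (auto simp: tuples_def)
next
  case (Suc k)
  have "holds M ((Ex ^^ Suc k) \<phi>) xs \<longleftrightarrow> holds M ((Ex ^^ k) (Ex \<phi>)) xs"
    by (simp add: funpow_swap1)
  also have "\<dots> \<longleftrightarrow> (\<exists>us\<in>tuples (universe M) k. \<exists>a\<in>universe M. holds M \<phi> ((a # us) @ xs))"
    unfolding Suc.IH holds_Ex by simp
  also have "\<dots> \<longleftrightarrow> (\<exists>us\<in>tuples (universe M) (Suc k). holds M \<phi> (us @ xs))"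
    (is "?l \<longleftrightarrow> ?r")
  proof
    assume ?l
    then obtain us a where "us \<in> tuples (universe M) k" "a \<in> universe M" "holds M \<phi> ((a # us) @ xs)"
      by blast
    then show ?r by (intro bexI[where x = "a # us"]) (auto simp: tuples_def)
  next
    assume ?r
    then obtain vs where vs: "vs \<in> tuples (universe M) (Suc k)" "holds M \<phi> (vs @ xs)" by blast
    then show ?l by (cases vs) (auto simp: tuples_def)
  qed
  finally show ?case .
qed

lemma formula_Neg [simp]: "formula L n (Neg \<phi>) \<longleftrightarrow> formula L n \<phi>"
  and formula_Conj [simp]: "formula L n (Conj \<phi> \<psi>) \<longleftrightarrow> formula L n \<phi> \<and> formula L n \<psi>"
  by (auto simp: formula_def)

lemma formula_Ex: "formula L n (Ex \<phi>) \<longleftrightarrow> formula L (Suc n) \<phi>"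
proof -
  have "{i. Suc i \<in> S} \<subseteq> {..<n} \<longleftrightarrow> S \<subseteq> {..<Suc n}" for S
  proof
    assume "{i. Suc i \<in> S} \<subseteq> {..<n}"
    then have "j < Suc n" if "j \<in> S" for j
      using that by (cases j) auto
    then show "S \<subseteq> {..<Suc n}" by auto
  qed auto
  then show ?thesis unfolding formula_def fm_of.simps fv.simps by (simp only:)
qed

lemma formula_Exs: "formula L n ((Ex ^^ k) \<phi>) \<longleftrightarrow> formula L (k + n) \<phi>"
  by (induction k arbitrary: n) (auto simp: formula_Ex)

lemma tuples_append [intro]:
  "xs \<in> tuples U m \<Longrightarrow> ys \<in> tuples U n \<Longrightarrow> xs @ ys \<in> tuples U (m + n)"
  by (auto simp: tuples_def)

lemma tuples_append_eq:
  "xs \<in> tuples U m \<Longrightarrow> xs' \<in> tuples U m \<Longrightarrow> xs @ ys = xs' @ ys' \<longleftrightarrow> xs = xs' \<and> ys = ys'"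
  by (auto simp: tuples_def)

lemma tuples_lists: "xs \<in> tuples U m \<Longrightarrow> xs \<in> lists U"
  by (auto simp: tuples_def)

lemma tuples_take_drop:
  assumes "w \<in> tuples U (m + n)"
  shows "take m w \<in> tuples U m" "drop m w \<in> tuples U n"
  using assms by (auto simp: tuples_def dest: in_set_takeD in_set_dropD)

text \<open>Equations in \<open>Aut(B/A)\<close> are proved with the automorphisms of \<open>M\<close> over \<open>A\<close>: these move all
  tuples of \<open>M\<close> and preserve every set definable over \<open>A\<close>, while a permutation of \<open>B\<close> only acts on the
  tuples of \<open>B\<close>.\<close>

definition auts_over :: "('f, 'r) language \<Rightarrow> ('f, 'r, 'a) struct \<Rightarrow> 'a set \<Rightarrow> ('a \<Rightarrow> 'a) set" where
  "auts_over L M C = {\<sigma>. automorphism L M \<sigma> \<and> (\<forall>c\<in>C. \<sigma> c = c)}"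

locale fo_structure =
  fixes L :: "('f, 'r) language" and M :: "('f, 'r, 'a) struct"
  assumes struct_of: "struct_of L M"
begin

abbreviation U :: "'a set" where "U \<equiv> universe M"
abbreviation tup :: "nat \<Rightarrow> 'a list set" where "tup \<equiv> tuples U"
abbreviation Auts :: "'a set \<Rightarrow> ('a \<Rightarrow> 'a) set" where "Auts \<equiv> auts_over L M"

lemma eval_automorphism:
  assumes \<sigma>: "automorphism L M \<sigma>" and e: "\<And>i. e i \<in> U" and "tm_of L t"
  shows "eval M (\<lambda>i. \<sigma> (e i)) t = \<sigma> (eval M e t) \<and> eval M e t \<in> U"
  using assms(3)
proof (induction t)
  case (Var i)
  then show ?case using e by simp
next
  case (App f ts)
  have IH: "eval M (\<lambda>i. \<sigma> (e i)) t = \<sigma> (eval M e t) \<and> eval M e t \<in> U" if "t \<in> set ts" for t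
    using App that by auto
  have f: "(f, length ts) \<in> funs L" using App.prems by simp
  have tup: "map (eval M e) ts \<in> tup (length ts)" using IH by (auto simp: tuples_def)
  have "map (eval M (\<lambda>i. \<sigma> (e i))) ts = map \<sigma> (map (eval M e) ts)" using IH by simp
  then have "eval M (\<lambda>i. \<sigma> (e i)) (App f ts) = fun_int M f (map \<sigma> (map (eval M e) ts))"
    unfolding eval.simps by (rule arg_cong)
  also have "\<dots> = \<sigma> (fun_int M f (map (eval M e) ts))"
    using \<sigma> f tup unfolding automorphism_def by (auto simp del: map_map)
  finally show ?case using struct_of f tup unfolding struct_of_def by fastforce
qed

lemma sat_automorphism:
  assumes \<sigma>: "automorphism L M \<sigma>" and "\<And>i. e i \<in> U" and "fm_of L \<phi>"
  shows "sat M (\<lambda>i. \<sigma> (e i)) \<phi> \<longleftrightarrow> sat M e \<phi>"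
  using assms(2,3)
proof (induction \<phi> arbitrary: e)
  case (Eq s t)
  have "inj \<sigma>" using \<sigma> by (auto simp: automorphism_def permutes_inj)
  then show ?case using Eq eval_automorphism[OF \<sigma> Eq.prems(1)] by (simp add: inj_eq)
next
  case (Rel R ts)
  have ev: "eval M (\<lambda>i. \<sigma> (e i)) t = \<sigma> (eval M e t) \<and> eval M e t \<in> U" if "t \<in> set ts" for t
    using eval_automorphism[OF \<sigma> Rel.prems(1)] Rel.prems(2) that by simp
  have tup: "map (eval M e) ts \<in> tup (length ts)" using ev by (auto simp: tuples_def)
  have "map (eval M (\<lambda>i. \<sigma> (e i))) ts = map \<sigma> (map (eval M e) ts)" using ev by simp
  moreover have "rel_int M R (map \<sigma> xs) \<longleftrightarrow> rel_int M R xs" if "xs \<in> tup (length ts)" for xs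
    using \<sigma> Rel.prems(2) that unfolding automorphism_def by auto
  ultimately show ?case unfolding sat.simps using tup by (simp only:)
next
  case (Ex \<phi>)
  have perm: "\<sigma> permutes U" using \<sigma> by (simp add: automorphism_def)
  have comp: "case_nat (\<sigma> a) (\<lambda>i. \<sigma> (e i)) = (\<lambda>i. \<sigma> (case_nat a e i))" for a
    by (auto split: nat.splits)
  have IH: "sat M (case_nat (\<sigma> a) (\<lambda>i. \<sigma> (e i))) \<phi> \<longleftrightarrow> sat M (case_nat a e) \<phi>" if "a \<in> U" for a
    unfolding comp by (rule Ex.IH) (use Ex.prems that in \<open>auto split: nat.splits\<close>)
  have "sat M (\<lambda>i. \<sigma> (e i)) (Ex \<phi>) \<longleftrightarrow> (\<exists>b\<in>\<sigma> ` U. sat M (case_nat b (\<lambda>i. \<sigma> (e i))) \<phi>)"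
    using permutes_image[OF perm] by simp
  then show ?case using IH by auto
qed auto

lemma holds_automorphism:
  assumes \<sigma>: "automorphism L M \<sigma>" and xs: "xs \<in> lists U" and \<phi>: "formula L (length xs) \<phi>"
  shows "holds M \<phi> (map \<sigma> xs) \<longleftrightarrow> holds M \<phi> xs"
proof -
  obtain u where u: "u \<in> U" using struct_of by (auto simp: struct_of_def)
  let ?e = "\<lambda>i. if i < length xs then xs ! i else u"
  have "holds M \<phi> (map \<sigma> xs) \<longleftrightarrow> sat M (\<lambda>i. \<sigma> (?e i)) \<phi>"
    unfolding holds_def by (rule sat_cong) (use \<phi> in \<open>auto simp: formula_def\<close>)
  also have "\<dots> \<longleftrightarrow> sat M ?e \<phi>"
    by (rule sat_automorphism[OF \<sigma>]) (use u xs \<phi> in \<open>auto simp: formula_def\<close>)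
  also have "\<dots> \<longleftrightarrow> holds M \<phi> xs"
    unfolding holds_def by (rule sat_cong) (use \<phi> in \<open>auto simp: formula_def\<close>)
  finally show ?thesis .
qed

lemma Auts_permutes: "\<sigma> \<in> Auts C \<Longrightarrow> \<sigma> permutes U"
  by (simp add: auts_over_def automorphism_def)

lemma Auts_in_tuples:
  assumes "\<sigma> \<in> Auts C"
  shows "map \<sigma> xs \<in> tup n \<longleftrightarrow> xs \<in> tup n"
  using permutes_in_image[OF Auts_permutes[OF assms]] by (auto simp: tuples_def)

lemma Auts_in_lists:
  assumes "\<sigma> \<in> Auts C"
  shows "map \<sigma> xs \<in> lists U \<longleftrightarrow> xs \<in> lists U"
  using permutes_in_image[OF Auts_permutes[OF assms]] by auto

lemma Auts_surj_tuples:
  assumes "\<sigma> \<in> Auts C"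
  obtains xs' where "xs = map \<sigma> xs'"
  using permutes_surj[OF Auts_permutes[OF assms]] by (metis ex_map_conv surjD)

lemma Auts_fix: "\<sigma> \<in> Auts C \<Longrightarrow> set cs \<subseteq> C \<Longrightarrow> map \<sigma> cs = cs"
  by (auto simp: auts_over_def intro!: map_idI)

lemma Auts_mono: "C \<subseteq> C' \<Longrightarrow> Auts C' \<subseteq> Auts C"
  by (auto simp: auts_over_def)

lemma id_in_Auts: "id \<in> Auts C"
  by (auto simp: auts_over_def automorphism_def permutes_id)

lemma holds_Auts:
  assumes \<sigma>: "\<sigma> \<in> Auts C" and xs: "xs \<in> tup n" and \<phi>: "(\<phi>, cs) \<in> formulas_over L C n" and "C \<subseteq> U"
  shows "holds M \<phi> (map \<sigma> xs @ cs) \<longleftrightarrow> holds M \<phi> (xs @ cs)"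
proof -
  have cs: "set cs \<subseteq> C" "formula L (n + length cs) \<phi>"
    using \<phi> by (auto simp: formulas_over_def)
  have "holds M \<phi> (map \<sigma> (xs @ cs)) \<longleftrightarrow> holds M \<phi> (xs @ cs)"
    by (rule holds_automorphism) (use \<sigma> xs cs assms(4) in \<open>auto simp: auts_over_def tuples_def\<close>)
  then show ?thesis using Auts_fix[OF \<sigma> cs(1)] by simp
qed

lemma tp_Auts:
  assumes "\<sigma> \<in> Auts C" "xs \<in> lists U" "C \<subseteq> U"
  shows "tp L M C (map \<sigma> xs) = tp L M C xs"
proof -
  have "xs \<in> tup (length xs)" using assms(2) by (auto simp: tuples_def)
  then show ?thesis unfolding tp_def
    using holds_Auts[OF assms(1) _ _ assms(3)] by (intro Collect_cong) (simp add: case_prod_beta cong: conj_cong)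
qed

lemma definable_invariant:
  assumes "definable L M C X" "C \<subseteq> U" "\<sigma> \<in> Auts C"
  shows "map \<sigma> xs \<in> X \<longleftrightarrow> xs \<in> X"
proof -
  obtain n \<phi> cs where \<phi>: "(\<phi>, cs) \<in> formulas_over L C n"
    and X: "X = {xs \<in> tup n. holds M \<phi> (xs @ cs)}"
    using assms(1) unfolding definable_def by blast
  show ?thesis
    unfolding X using holds_Auts[OF assms(3) _ \<phi> assms(2)] Auts_in_tuples[OF assms(3)] by blast
qed

end

section \<open>Closure properties of definability\<close>

lemma map_nth_slice:
  assumes "a = length xs" "b = a + length ys"
  shows "map (\<lambda>j. (xs @ ys @ zs) ! j) [a..<b] = ys"
  using assms by (auto intro!: nth_equalityI simp: nth_append)

context fo_structure
begin

text \<open>Definability of a predicate on \<open>n\<close>-tuples, with the list of parameters left open: every list that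
  contains certain elements of \<open>C\<close> will do. In this form two formulas can always be given the same
  parameters, and no bookkeeping is needed when they are combined.\<close>

definition definable_pred :: "'a set \<Rightarrow> nat \<Rightarrow> ('a list \<Rightarrow> bool) \<Rightarrow> bool" where
  "definable_pred C n P \<longleftrightarrow> (\<exists>K. finite K \<and> K \<subseteq> C \<and>
     (\<forall>cs. K \<subseteq> set cs \<longrightarrow>
       (\<exists>\<phi>. formula L (n + length cs) \<phi> \<and> (\<forall>xs\<in>tup n. holds M \<phi> (xs @ cs) \<longleftrightarrow> P xs))))"

text \<open>Each entry of the value is an entry of the argument or a parameter. Closed under \<open>take\<close>, \<open>drop\<close> and
  append, these maps let a definability proof use the blocks of a tuple without mentioning indices.\<close>

definition coordinate_map :: "'a set \<Rightarrow> nat \<Rightarrow> ('a list \<Rightarrow> 'a list) \<Rightarrow> bool" where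
  "coordinate_map C n f \<longleftrightarrow>
     (\<exists>ts. (\<forall>t\<in>set ts. (\<exists>i<n. t = (\<lambda>xs. xs ! i)) \<or> (\<exists>c\<in>C. t = (\<lambda>xs. c))) \<and>
        (\<forall>xs\<in>tup n. f xs = map (\<lambda>t. t xs) ts))"

lemma coordinate_map_id: "coordinate_map C n (\<lambda>xs. xs)"
  unfolding coordinate_map_def
  by (rule exI[where x = "map (\<lambda>i xs. xs ! i) [0..<n]"])
    (auto simp: tuples_def comp_def map_nth)

lemma coordinate_map_const: "set cs \<subseteq> C \<Longrightarrow> coordinate_map C n (\<lambda>xs. cs)"
  unfolding coordinate_map_def
  by (rule exI[where x = "map (\<lambda>c xs. c) cs"]) (auto simp: comp_def)

lemma coordinate_map_append:
  assumes "coordinate_map C n f" "coordinate_map C n g"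
  shows "coordinate_map C n (\<lambda>xs. f xs @ g xs)"
proof -
  obtain ts us where
    "\<forall>t\<in>set ts. (\<exists>i<n. t = (\<lambda>xs. xs ! i)) \<or> (\<exists>c\<in>C. t = (\<lambda>xs. c))"
    "\<forall>xs\<in>tup n. f xs = map (\<lambda>t. t xs) ts"
    "\<forall>t\<in>set us. (\<exists>i<n. t = (\<lambda>xs. xs ! i)) \<or> (\<exists>c\<in>C. t = (\<lambda>xs. c))"
    "\<forall>xs\<in>tup n. g xs = map (\<lambda>t. t xs) us"
    using assms unfolding coordinate_map_def by blast
  then show ?thesis unfolding coordinate_map_def by (intro exI[where x = "ts @ us"]) auto
qed

lemma coordinate_map_take:
  assumes "coordinate_map C n f"
  shows "coordinate_map C n (\<lambda>xs. take m (f xs))"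
proof -
  obtain ts where
    "\<forall>t\<in>set ts. (\<exists>i<n. t = (\<lambda>xs. xs ! i)) \<or> (\<exists>c\<in>C. t = (\<lambda>xs. c))"
    "\<forall>xs\<in>tup n. f xs = map (\<lambda>t. t xs) ts"
    using assms unfolding coordinate_map_def by blast
  then show ?thesis unfolding coordinate_map_def
    by (intro exI[where x = "take m ts"]) (auto simp: take_map dest: in_set_takeD)
qed

lemma coordinate_map_drop:
  assumes "coordinate_map C n f"
  shows "coordinate_map C n (\<lambda>xs. drop m (f xs))"
proof -
  obtain ts where
    "\<forall>t\<in>set ts. (\<exists>i<n. t = (\<lambda>xs. xs ! i)) \<or> (\<exists>c\<in>C. t = (\<lambda>xs. c))"
    "\<forall>xs\<in>tup n. f xs = map (\<lambda>t. t xs) ts"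
    using assms unfolding coordinate_map_def by blast
  then show ?thesis unfolding coordinate_map_def
    by (intro exI[where x = "drop m ts"]) (auto simp: drop_map dest: in_set_dropD)
qed

lemma definable_pred_formula:
  assumes "(\<phi>, as) \<in> formulas_over L C n"
  shows "definable_pred C n (\<lambda>xs. holds M \<phi> (xs @ as))"
  unfolding definable_pred_def
proof (intro exI[where x = "set as"] conjI allI impI)
  have as: "set as \<subseteq> C" and \<phi>: "formula L (n + length as) \<phi>"
    using assms by (auto simp: formulas_over_def)
  show "finite (set as)" "set as \<subseteq> C" using as by auto
  fix cs assume cs: "set as \<subseteq> set cs"
  then have "\<forall>a\<in>set as. \<exists>k. k < length cs \<and> cs ! k = a" by (metis in_set_conv_nth subset_iff)
  then obtain k where k: "\<forall>a\<in>set as. k a < length cs \<and> cs ! k a = a" by metis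
  let ?js = "[0..<n] @ map (\<lambda>a. n + k a) as"
  have "formula L (n + length cs) (ren (\<lambda>i. ?js ! i) \<phi>)"
    by (rule formula_ren) (use \<phi> k in auto)
  moreover have "holds M (ren (\<lambda>i. ?js ! i) \<phi>) (xs @ cs) \<longleftrightarrow> holds M \<phi> (xs @ as)"
    if "xs \<in> tup n" for xs
  proof -
    have [simp]: "length xs = n" using that by (simp add: tuples_def)
    have "map (\<lambda>j. (xs @ cs) ! j) ?js = xs @ as"
      using k map_nth_slice[of 0 "[]" n xs cs] by (auto simp: nth_append intro!: map_idI)
    then show ?thesis using holds_ren[of L ?js \<phi> M "xs @ cs"] \<phi> by simp
  qed
  ultimately show "\<exists>\<phi>'. formula L (n + length cs) \<phi>' \<and>
    (\<forall>xs\<in>tup n. holds M \<phi>' (xs @ cs) \<longleftrightarrow> holds M \<phi> (xs @ as))" by blast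
qed

lemma definableI:
  assumes "definable_pred C n P"
  shows "definable L M C {xs \<in> tup n. P xs}"
proof -
  obtain K where K: "finite K" "K \<subseteq> C" and
    *: "\<And>cs. K \<subseteq> set cs \<Longrightarrow>
       \<exists>\<phi>. formula L (n + length cs) \<phi> \<and> (\<forall>xs\<in>tup n. holds M \<phi> (xs @ cs) \<longleftrightarrow> P xs)"
    using assms unfolding definable_pred_def by blast
  obtain cs where cs: "set cs = K" using finite_list[OF K(1)] by blast
  then obtain \<phi> where \<phi>: "formula L (n + length cs) \<phi>"
    and "\<forall>xs\<in>tup n. holds M \<phi> (xs @ cs) \<longleftrightarrow> P xs" using *[of cs] by auto
  then have "{xs \<in> tup n. P xs} = {xs \<in> tup n. holds M \<phi> (xs @ cs)}" by auto
  moreover have "(\<phi>, cs) \<in> formulas_over L C n" using \<phi> cs K by (simp add: formulas_over_def)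
  ultimately show ?thesis unfolding definable_def by blast
qed

lemma definableE:
  assumes "definable L M C X"
  obtains n where "X \<subseteq> tup n" "definable_pred C n (\<lambda>xs. xs \<in> X)"
proof -
  obtain n \<phi> as where \<phi>: "(\<phi>, as) \<in> formulas_over L C n"
    and X: "X = {xs \<in> tup n. holds M \<phi> (xs @ as)}"
    using assms unfolding definable_def by blast
  have "definable_pred C n (\<lambda>xs. xs \<in> X)"
    using definable_pred_formula[OF \<phi>] unfolding X definable_pred_def by auto
  then show ?thesis using that X by blast
qed

lemma definable_pred_cong:
  assumes "definable_pred C n P" "\<And>xs. xs \<in> tup n \<Longrightarrow> P xs \<longleftrightarrow> Q xs"
  shows "definable_pred C n Q"
  using assms unfolding definable_pred_def by simp

lemma definable_pred_False: "definable_pred C n (\<lambda>xs. False)"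
  unfolding definable_pred_def
proof (intro exI[where x = "{}"] conjI allI impI)
  let ?\<phi> = "Ex (Eq (Var 0) (Var 0))"
  fix cs
  show "\<exists>\<phi>. formula L (n + length cs) \<phi> \<and> (\<forall>xs\<in>tup n. holds M \<phi> (xs @ cs) \<longleftrightarrow> False)"
    by (rule exI[where x = "Conj ?\<phi> (Neg ?\<phi>)"]) (simp add: formula_def)
qed auto

lemma definable_pred_conj:
  assumes "definable_pred C n P" "definable_pred C n Q"
  shows "definable_pred C n (\<lambda>xs. P xs \<and> Q xs)"
proof -
  obtain K K' where "finite K" "K \<subseteq> C" "finite K'" "K' \<subseteq> C" and
    1: "\<And>cs. K \<subseteq> set cs \<Longrightarrow>
       \<exists>\<phi>. formula L (n + length cs) \<phi> \<and> (\<forall>xs\<in>tup n. holds M \<phi> (xs @ cs) \<longleftrightarrow> P xs)" and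
    2: "\<And>cs. K' \<subseteq> set cs \<Longrightarrow>
       \<exists>\<phi>. formula L (n + length cs) \<phi> \<and> (\<forall>xs\<in>tup n. holds M \<phi> (xs @ cs) \<longleftrightarrow> Q xs)"
    using assms unfolding definable_pred_def by blast
  show ?thesis unfolding definable_pred_def
  proof (intro exI[where x = "K \<union> K'"] conjI allI impI)
    fix cs assume "K \<union> K' \<subseteq> set cs"
    then obtain \<phi> \<psi> where "formula L (n + length cs) \<phi>" "formula L (n + length cs) \<psi>"
      "\<forall>xs\<in>tup n. holds M \<phi> (xs @ cs) \<longleftrightarrow> P xs" "\<forall>xs\<in>tup n. holds M \<psi> (xs @ cs) \<longleftrightarrow> Q xs"
      using 1[of cs] 2[of cs] by auto
    then show "\<exists>\<phi>. formula L (n + length cs) \<phi> \<and> (\<forall>xs\<in>tup n. holds M \<phi> (xs @ cs) \<longleftrightarrow> P xs \<and> Q xs)"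
      by (intro exI[where x = "Conj \<phi> \<psi>"]) simp
  qed (use \<open>finite K\<close> \<open>finite K'\<close> \<open>K \<subseteq> C\<close> \<open>K' \<subseteq> C\<close> in auto)
qed

text \<open>Quantifiers bind the variables at the front, so the quantified block is moved there first.\<close>

lemma definable_pred_ex:
  assumes "definable_pred C (n + k) (\<lambda>w. P (take n w) (drop n w))"
  shows "definable_pred C n (\<lambda>xs. \<exists>u\<in>tup k. P xs u)"
proof -
  obtain K where "finite K" "K \<subseteq> C" and
    *: "\<And>cs. K \<subseteq> set cs \<Longrightarrow> \<exists>\<phi>. formula L (n + k + length cs) \<phi> \<and>
       (\<forall>w\<in>tup (n + k). holds M \<phi> (w @ cs) \<longleftrightarrow> P (take n w) (drop n w))"
    using assms unfolding definable_pred_def by blast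
  show ?thesis unfolding definable_pred_def
  proof (intro exI[where x = K] conjI allI impI)
    fix cs assume "K \<subseteq> set cs"
    then obtain \<phi> where \<phi>: "formula L (n + k + length cs) \<phi>"
      and \<phi>P: "\<And>w. w \<in> tup (n + k) \<Longrightarrow> holds M \<phi> (w @ cs) \<longleftrightarrow> P (take n w) (drop n w)"
      using * by blast
    let ?js = "[k..<k + n] @ [0..<k] @ [k + n..<k + n + length cs]"
    let ?\<psi> = "ren (\<lambda>i. ?js ! i) \<phi>"
    have "formula L (k + (n + length cs)) ?\<psi>"
      by (rule formula_ren) (use \<phi> in \<open>auto simp: algebra_simps\<close>)
    moreover have "holds M ?\<psi> (u @ xs @ cs) \<longleftrightarrow> P xs u" if "xs \<in> tup n" "u \<in> tup k" for xs u
    proof -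
      have [simp]: "length xs = n" "length u = k" using that by (auto simp: tuples_def)
      have "map (\<lambda>j. (u @ xs @ cs) ! j) ?js = xs @ u @ cs"
        using map_nth_slice[of k u "k + n" xs cs] map_nth_slice[of 0 "[]" k u "xs @ cs"]
          map_nth_slice[of "k + n" "u @ xs" "k + n + length cs" cs "[]"] by simp
      then have "holds M ?\<psi> (u @ xs @ cs) \<longleftrightarrow> holds M \<phi> ((xs @ u) @ cs)"
        using holds_ren[of L ?js \<phi> M "u @ xs @ cs"] \<phi> by (simp add: add.assoc)
      also have "\<dots> \<longleftrightarrow> P (take n (xs @ u)) (drop n (xs @ u))"
        using that by (intro \<phi>P) auto
      finally show ?thesis by simp
    qed
    ultimately show "\<exists>\<phi>. formula L (n + length cs) \<phi> \<and>
      (\<forall>xs\<in>tup n. holds M \<phi> (xs @ cs) \<longleftrightarrow> (\<exists>u\<in>tup k. P xs u))"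
      by (intro exI[where x = "(Ex ^^ k) ?\<psi>"]) (simp add: formula_Exs holds_Exs)
  qed fact+
qed

text \<open>Substitution of variables and parameters into a formula for \<open>X\<close>. If the map never produces tuples
  of the right length, or produces constants outside the structure, the predicate is constantly
  false.\<close>

lemma definable_pred_in:
  assumes "definable L M C X" and f: "coordinate_map C n f"
  shows "definable_pred C n (\<lambda>xs. f xs \<in> X)"
proof -
  obtain p where X: "X \<subseteq> tup p" and "definable_pred C p (\<lambda>xs. xs \<in> X)"
    using assms(1) by (rule definableE)
  then obtain K where K: "finite K" "K \<subseteq> C" and
    *: "\<And>cs. K \<subseteq> set cs \<Longrightarrow>
       \<exists>\<phi>. formula L (p + length cs) \<phi> \<and> (\<forall>xs\<in>tup p. holds M \<phi> (xs @ cs) \<longleftrightarrow> xs \<in> X)"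
    unfolding definable_pred_def by blast
  obtain ts where
    ts: "\<And>t. t \<in> set ts \<Longrightarrow> (\<exists>i<n. t = (\<lambda>xs. xs ! i)) \<or> (\<exists>c\<in>C. t = (\<lambda>xs. c))"
    and f_ts: "\<And>xs. xs \<in> tup n \<Longrightarrow> f xs = map (\<lambda>t. t xs) ts"
    using f unfolding coordinate_map_def by blast
  show ?thesis
  proof (cases "length ts = p")
    case False
    then have "f xs \<notin> X" if "xs \<in> tup n" for xs using X f_ts[OF that] by (auto simp: tuples_def)
    then show ?thesis by (intro definable_pred_cong[OF definable_pred_False]) auto
  next
    case True
    \<comment> \<open>The constants occurring in the map become parameters.\<close>
    define K' where "K' = {c \<in> C \<inter> U. (\<lambda>xs. c) \<in> set ts}"
    have "finite ((\<lambda>c (xs :: 'a list). c) -` set ts)"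
      by (rule finite_vimageI) (auto simp: inj_def dest: fun_cong)
    then have K': "finite K'" by (rule finite_subset[rotated]) (auto simp: K'_def)
    show ?thesis
    proof (cases "\<forall>xs\<in>tup n. f xs \<notin> tup p")
      case True
      then show ?thesis using X by (intro definable_pred_cong[OF definable_pred_False]) auto
    next
      case False
      then obtain xs0 where xs0: "xs0 \<in> tup n" "f xs0 \<in> tup p" by blast
      have ts': "(\<exists>i<n. t = (\<lambda>xs. xs ! i)) \<or> (\<exists>c\<in>K'. t = (\<lambda>xs. c))" if "t \<in> set ts" for t
      proof -
        have "t xs0 \<in> U" using xs0 f_ts[OF xs0(1)] that by (auto simp: tuples_def)
        then show ?thesis using ts[OF that] that by (auto simp: K'_def)
      qed
      have f_tup: "f xs \<in> tup p" if "xs \<in> tup n" for xs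
        using \<open>length ts = p\<close> that ts' by (force simp: f_ts[OF that] tuples_def K'_def)
      show ?thesis unfolding definable_pred_def
      proof (intro exI[where x = "K \<union> K'"] conjI allI impI)
        fix cs assume cs: "K \<union> K' \<subseteq> set cs"
        then obtain \<phi> where \<phi>: "formula L (p + length cs) \<phi>"
          and \<phi>X: "\<And>xs. xs \<in> tup p \<Longrightarrow> holds M \<phi> (xs @ cs) \<longleftrightarrow> xs \<in> X"
          using *[of cs] by auto
        have "\<exists>j<n + length cs. \<forall>xs\<in>tup n. t xs = (xs @ cs) ! j" if t: "t \<in> set ts" for t
          using ts'[OF t]
        proof
          assume "\<exists>i<n. t = (\<lambda>xs. xs ! i)"
          then obtain i where "i < n" "t = (\<lambda>xs. xs ! i)" by blast
          then show ?thesis by (intro exI[where x = i]) (auto simp: tuples_def nth_append)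
        next
          assume "\<exists>c\<in>K'. t = (\<lambda>xs. c)"
          then obtain k where "k < length cs" "t = (\<lambda>xs. cs ! k)"
            using cs by (metis Un_subset_iff in_set_conv_nth subset_iff)
          then show ?thesis by (intro exI[where x = "n + k"]) (auto simp: tuples_def nth_append)
        qed
        then obtain J where J: "\<And>t. t \<in> set ts \<Longrightarrow> J t < n + length cs"
          "\<And>t xs. t \<in> set ts \<Longrightarrow> xs \<in> tup n \<Longrightarrow> t xs = (xs @ cs) ! J t" by metis
        let ?js = "map J ts @ [n..<n + length cs]"
        have "formula L (n + length cs) (ren (\<lambda>i. ?js ! i) \<phi>)"
          by (rule formula_ren) (use \<phi> J(1) \<open>length ts = p\<close> in auto)
        moreover have "holds M (ren (\<lambda>i. ?js ! i) \<phi>) (xs @ cs) \<longleftrightarrow> f xs \<in> X"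
          if xs: "xs \<in> tup n" for xs
        proof -
          have [simp]: "length xs = n" using xs by (auto simp: tuples_def)
          have "map (\<lambda>j. (xs @ cs) ! j) ?js = f xs @ cs"
            using map_nth_slice[of n xs "n + length cs" cs "[]"] by (simp add: f_ts xs J(2))
          then show ?thesis
            using holds_ren[of L ?js \<phi> M "xs @ cs"] \<phi> \<phi>X[OF f_tup[OF xs]] \<open>length ts = p\<close> by simp
        qed
        ultimately show "\<exists>\<phi>. formula L (n + length cs) \<phi> \<and>
          (\<forall>xs\<in>tup n. holds M \<phi> (xs @ cs) \<longleftrightarrow> f xs \<in> X)" by blast
      qed (use K K' in \<open>auto simp: K'_def\<close>)
    qed
  qed
qed

text \<open>Applied backwards, these rules reduce the definability of a predicate built from
  conjunction, existential quantification and membership in definable sets to that of the sets.\<close>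

lemmas definable_intros =
  definable_pred_ex definable_pred_conj definable_pred_in
  coordinate_map_append coordinate_map_take coordinate_map_drop coordinate_map_id

lemma definable_mono: "C \<subseteq> C' \<Longrightarrow> definable L M C X \<Longrightarrow> definable L M C' X"
  unfolding definable_def formulas_over_def by fastforce

lemma definable_singleton:
  assumes "c \<in> U"
  shows "definable L M U {[c]}"
proof -
  have "(Eq (Var 0) (Var 1), [c]) \<in> formulas_over L U 1"
    using assms by (auto simp: formulas_over_def formula_def)
  moreover have "{[c]} = {xs \<in> tup 1. holds M (Eq (Var 0) (Var 1)) (xs @ [c])}"
    using assms by (auto simp: tuples_def holds_def length_Suc_conv)
  ultimately show ?thesis unfolding definable_def by blast
qed

text \<open>A predicate that agrees with the graph on tuples of the right lengths is easier to write down than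
  the graph, because it can refer to the blocks of a concatenation as separate arguments.\<close>

lemma definable_mapI:
  assumes "X \<subseteq> tup m" "f \<in> X \<rightarrow> tup n"
    and R: "\<And>x z. x \<in> tup m \<Longrightarrow> z \<in> tup n \<Longrightarrow> R x z \<longleftrightarrow> x \<in> X \<and> z = f x"
    and "definable_pred C (m + n) (\<lambda>w. R (take m w) (drop m w))"
  shows "definable_map L M C X f"
proof -
  have "{x @ f x |x. x \<in> X} = {w \<in> tup (m + n). R (take m w) (drop m w)}" (is "?l = ?r")
  proof
    show "?l \<subseteq> ?r"
    proof
      fix w assume "w \<in> ?l"
      then obtain x where x: "x \<in> X" "w = x @ f x" by blast
      then have "x \<in> tup m" "f x \<in> tup n" using assms by auto
      moreover then have "length x = m" by (simp add: tuples_def)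
      ultimately show "w \<in> ?r" using x R by auto
    qed
    show "?r \<subseteq> ?l"
    proof
      fix w assume w: "w \<in> ?r"
      then have "take m w \<in> X" "drop m w = f (take m w)"
        using R[OF tuples_take_drop[of w U m n]] by auto
      moreover have "w = take m w @ drop m w" by simp
      ultimately show "w \<in> ?l" unfolding mem_Collect_eq by (intro exI[where x = "take m w"]) simp
    qed
  qed
  then have "definable L M C {x @ f x |x. x \<in> X}" using definableI[OF assms(4)] by simp
  then show ?thesis using assms(1,2) unfolding definable_map_def by blast
qed

lemma definable_map2I:
  assumes "X \<subseteq> tup m" "Y \<subseteq> tup n" "f \<in> X \<rightarrow> Y \<rightarrow> tup k"
    and R: "\<And>x y z. x \<in> tup m \<Longrightarrow> y \<in> tup n \<Longrightarrow> z \<in> tup k \<Longrightarrow>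
      R x y z \<longleftrightarrow> x \<in> X \<and> y \<in> Y \<and> z = f x y"
    and "definable_pred C (m + (n + k)) (\<lambda>w. R (take m w) (take n (drop m w)) (drop n (drop m w)))"
  shows "definable_map2 L M C X Y f"
proof -
  have "{x @ y @ f x y |x y. x \<in> X \<and> y \<in> Y} =
    {w \<in> tup (m + (n + k)). R (take m w) (take n (drop m w)) (drop n (drop m w))}" (is "?l = ?r")
  proof
    show "?l \<subseteq> ?r"
    proof
      fix w assume "w \<in> ?l"
      then obtain x y where x: "x \<in> X" "y \<in> Y" "w = x @ y @ f x y" by blast
      then have "x \<in> tup m" "y \<in> tup n" "f x y \<in> tup k" using assms by auto
      moreover then have "length x = m" "length y = n" by (auto simp: tuples_def)
      ultimately show "w \<in> ?r" using x R by auto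
    qed
    show "?r \<subseteq> ?l"
    proof
      fix w assume w: "w \<in> ?r"
      then have "take m w \<in> X" "take n (drop m w) \<in> Y"
        "drop n (drop m w) = f (take m w) (take n (drop m w))"
        using R[OF tuples_take_drop(1)[of w U m "n + k"] tuples_take_drop[of "drop m w" U n k]]
          tuples_take_drop(2)[of w U m "n + k"] by auto
      moreover have "w = take m w @ take n (drop m w) @ drop n (drop m w)"
        by (metis append_take_drop_id)
      ultimately show "w \<in> ?l" unfolding mem_Collect_eq
        by (intro exI[where x = "take m w"] exI[where x = "take n (drop m w)"]) simp
    qed
  qed
  then have "definable L M C {x @ y @ f x y |x y. x \<in> X \<and> y \<in> Y}"
    using definableI[OF assms(5)] by simp
  then show ?thesis using assms(1-3) unfolding definable_map2_def by blast
qed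

text \<open>The lengths of the arguments determine how a concatenation splits, so membership in the graph can
  be read off block by block.\<close>

lemma definable_mapE:
  assumes "definable_map L M C X f"
  obtains m n \<Gamma> where "X \<subseteq> tup m" "f \<in> X \<rightarrow> tup n" "definable L M C \<Gamma>"
    "\<forall>x z. length x = m \<longrightarrow> (x @ z \<in> \<Gamma> \<longleftrightarrow> x \<in> X \<and> z = f x)"
proof -
  obtain m n where mn: "X \<subseteq> tup m" "f \<in> X \<rightarrow> tup n"
    and D: "definable L M C {x @ f x |x. x \<in> X}"
    using assms unfolding definable_map_def by blast
  have "x @ z \<in> {x @ f x |x. x \<in> X} \<longleftrightarrow> x \<in> X \<and> z = f x" if "length x = m" for x z
  proof
    assume "x @ z \<in> {x @ f x |x. x \<in> X}"
    then obtain x' where *: "x' \<in> X" "x @ z = x' @ f x'" by blast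
    then have "length x' = m" using mn by (auto simp: tuples_def)
    then show "x \<in> X \<and> z = f x" using * that by simp
  qed auto
  then show ?thesis using that[OF mn D] by blast
qed

lemma definable_map2E:
  assumes "definable_map2 L M C X Y f"
  obtains m n k \<Gamma> where "X \<subseteq> tup m" "Y \<subseteq> tup n" "f \<in> X \<rightarrow> Y \<rightarrow> tup k" "definable L M C \<Gamma>"
    "\<forall>x y z. length x = m \<longrightarrow> length y = n \<longrightarrow>
      (x @ y @ z \<in> \<Gamma> \<longleftrightarrow> x \<in> X \<and> y \<in> Y \<and> z = f x y)"
proof -
  obtain m n k where mn: "X \<subseteq> tup m" "Y \<subseteq> tup n" "f \<in> X \<rightarrow> Y \<rightarrow> tup k"
    and D: "definable L M C {x @ y @ f x y |x y. x \<in> X \<and> y \<in> Y}"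
    using assms unfolding definable_map2_def by blast
  have "x @ y @ z \<in> {x @ y @ f x y |x y. x \<in> X \<and> y \<in> Y} \<longleftrightarrow> x \<in> X \<and> y \<in> Y \<and> z = f x y"
    if "length x = m" "length y = n" for x y z
  proof
    assume "x @ y @ z \<in> {x @ y @ f x y |x y. x \<in> X \<and> y \<in> Y}"
    then obtain x' y' where *: "x' \<in> X" "y' \<in> Y" "x @ y @ z = x' @ y' @ f x' y'" by blast
    then have "length x' = m" "length y' = n" using mn by (auto simp: tuples_def)
    then show "x \<in> X \<and> y \<in> Y \<and> z = f x y" using * that by simp
  qed auto
  then show ?thesis using that[OF mn D] by blast
qed

lemma definable_map_equivariant:
  assumes "definable_map L M C X f" "C \<subseteq> U" "\<sigma> \<in> Auts C" "x \<in> X"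
  shows "map \<sigma> x \<in> X" "map \<sigma> (f x) = f (map \<sigma> x)"
proof -
  obtain m n \<Gamma> where "X \<subseteq> tup m" "f \<in> X \<rightarrow> tup n" "definable L M C \<Gamma>"
    "\<forall>x z. length x = m \<longrightarrow> (x @ z \<in> \<Gamma> \<longleftrightarrow> x \<in> X \<and> z = f x)"
    using assms(1) by (rule definable_mapE)
  moreover then have "length x = m" using assms(4) by (auto simp: tuples_def)
  moreover have "map \<sigma> (x @ f x) \<in> \<Gamma>"
    using definable_invariant[OF \<open>definable L M C \<Gamma>\<close> assms(2,3)] calculation assms(4) by blast
  ultimately show "map \<sigma> x \<in> X" "map \<sigma> (f x) = f (map \<sigma> x)" by auto
qed

lemma definable_map2_equivariant:
  assumes "definable_map2 L M C X Y f" "C \<subseteq> U" "\<sigma> \<in> Auts C" "x \<in> X" "y \<in> Y"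
  shows "map \<sigma> x \<in> X" "map \<sigma> y \<in> Y" "map \<sigma> (f x y) = f (map \<sigma> x) (map \<sigma> y)"
proof -
  obtain m n k \<Gamma> where "X \<subseteq> tup m" "Y \<subseteq> tup n" "f \<in> X \<rightarrow> Y \<rightarrow> tup k" "definable L M C \<Gamma>" and
    \<Gamma>: "\<forall>x y z. length x = m \<longrightarrow> length y = n \<longrightarrow>
      (x @ y @ z \<in> \<Gamma> \<longleftrightarrow> x \<in> X \<and> y \<in> Y \<and> z = f x y)"
    using assms(1) by (rule definable_map2E)
  moreover then have len: "length x = m" "length y = n" using assms(4,5) by (auto simp: tuples_def)
  moreover have "map \<sigma> (x @ y @ f x y) \<in> \<Gamma>"
    using definable_invariant[OF \<open>definable L M C \<Gamma>\<close> assms(2,3)] \<Gamma> len assms(4,5) by blast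
  ultimately show "map \<sigma> x \<in> X" "map \<sigma> y \<in> Y" "map \<sigma> (f x y) = f (map \<sigma> x) (map \<sigma> y)"
    by auto
qed

lemma definable_map_mono: "C \<subseteq> C' \<Longrightarrow> definable_map L M C X f \<Longrightarrow> definable_map L M C' X f"
  unfolding definable_map_def using definable_mono by blast

lemma definable_map2_mono: "C \<subseteq> C' \<Longrightarrow> definable_map2 L M C X Y f \<Longrightarrow> definable_map2 L M C' X Y f"
  unfolding definable_map2_def using definable_mono by blast

end

section \<open>Invariant sets are definable\<close>

locale atomic_homogeneous = fo_structure L M
  for L :: "('f, 'r) language" and M :: "('f, 'r, 'a) struct" +
  fixes C :: "'a set"
  assumes params: "C \<subseteq> U"
    and atomic: "atomic_over L M C"
    and homogeneous: "strongly_omega_homogeneous_over L M C"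
begin

lemma conjugateI:
  assumes "xs \<in> lists U" "ys \<in> lists U" "tp L M C xs = tp L M C ys"
  obtains \<sigma> where "\<sigma> \<in> Auts C" "map \<sigma> xs = ys"
  using homogeneous assms unfolding strongly_omega_homogeneous_over_def auts_over_def by blast

text \<open>By homogeneity the orbit of a tuple is the set of realisations of its type, and a formula that
  isolates the type defines this set.\<close>

lemma orbit_definable:
  assumes bs: "bs \<in> lists U"
  shows "definable L M C {map \<sigma> bs |\<sigma>. \<sigma> \<in> Auts C}"
proof -
  let ?n = "length bs"
  obtain \<phi> as where \<phi>: "(\<phi>, as) \<in> tp L M C bs"
    and iso: "\<And>\<psi> cs ys. (\<psi>, cs) \<in> tp L M C bs \<Longrightarrow> ys \<in> tup ?n \<Longrightarrow> holds M \<phi> (ys @ as) \<Longrightarrow>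
      holds M \<psi> (ys @ cs)"
    using atomic bs unfolding atomic_over_def isolated_type_def by blast
  have \<phi>_over: "(\<phi>, as) \<in> formulas_over L C ?n" and \<phi>_bs: "holds M \<phi> (bs @ as)"
    using \<phi> by (auto simp: tp_def)
  have bs_tup: "bs \<in> tup ?n" using bs by (auto simp: tuples_def)
  have "ys \<in> {map \<sigma> bs |\<sigma>. \<sigma> \<in> Auts C}" if ys: "ys \<in> tup ?n" "holds M \<phi> (ys @ as)" for ys
  proof -
    have len: "length ys = ?n" using ys by (simp add: tuples_def)
    have "(\<psi>, cs) \<in> tp L M C bs \<longleftrightarrow> (\<psi>, cs) \<in> tp L M C ys" for \<psi> cs
    proof (cases "(\<psi>, cs) \<in> formulas_over L C ?n")
      case True
      \<comment> \<open>Types are maximal: the inclusion of the type of \<open>bs\<close> in that of \<open>ys\<close>, applied to negations,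
        gives the converse.\<close>
      then have "(Neg \<psi>, cs) \<in> formulas_over L C ?n" by (simp add: formulas_over_def)
      then show ?thesis
        using iso[OF _ ys, of \<psi> cs] iso[OF _ ys, of "Neg \<psi>" cs] True len by (auto simp: tp_def)
    next
      case False
      then show ?thesis using len by (simp add: tp_def)
    qed
    then have "tp L M C bs = tp L M C ys" by auto
    then obtain \<sigma> where "\<sigma> \<in> Auts C" "map \<sigma> bs = ys"
      by (rule conjugateI[OF bs tuples_lists[OF ys(1)]])
    then show ?thesis by blast
  qed
  moreover have "map \<sigma> bs \<in> tup ?n \<and> holds M \<phi> (map \<sigma> bs @ as)" if "\<sigma> \<in> Auts C" for \<sigma>
    using holds_Auts[OF that bs_tup \<phi>_over params] \<phi>_bs Auts_in_tuples[OF that] bs_tup by blast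
  ultimately have "{map \<sigma> bs |\<sigma>. \<sigma> \<in> Auts C} = {ys \<in> tup ?n. holds M \<phi> (ys @ as)}" by blast
  then show ?thesis using definableI[OF definable_pred_formula[OF \<phi>_over]] by simp
qed

text \<open>A formula with parameters \<open>bs\<close> that defines \<open>X\<close> defines \<open>\<sigma>(X) = X\<close> when \<open>bs\<close> is replaced by
  \<open>\<sigma>(bs)\<close>. So \<open>X\<close> is also defined by quantifying the parameters over the orbit of \<open>bs\<close>, which is
  definable over \<open>C\<close>.\<close>

theorem invariant_definable:
  assumes "definable L M U X" and inv: "\<And>\<sigma> xs. \<sigma> \<in> Auts C \<Longrightarrow> xs \<in> X \<Longrightarrow> map \<sigma> xs \<in> X"
  shows "definable L M C X"
proof -
  obtain n \<phi> bs where \<phi>: "(\<phi>, bs) \<in> formulas_over L U n"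
    and X: "X = {xs \<in> tup n. holds M \<phi> (xs @ bs)}"
    using assms(1) unfolding definable_def by blast
  have bs: "bs \<in> lists U" and \<phi>': "formula L (n + length bs) \<phi>"
    using \<phi> by (auto simp: formulas_over_def)
  let ?S = "{w \<in> tup (n + length bs). holds M \<phi> (w @ [])}"
  let ?O = "{map \<sigma> bs |\<sigma>. \<sigma> \<in> Auts C}"
  have S: "definable L M C ?S"
    by (rule definableI[OF definable_pred_formula]) (use \<phi>' in \<open>auto simp: formulas_over_def\<close>)
  have "X = {xs \<in> tup n. \<exists>u\<in>tup (length bs). u \<in> ?O \<and> xs @ u \<in> ?S}" (is "_ = ?r")
  proof
    have "bs \<in> tup (length bs)" "bs \<in> ?O"
      using bs id_in_Auts by (force simp: tuples_def)+
    then show "X \<subseteq> ?r" unfolding X by (auto intro!: bexI[where x = bs])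
    show "?r \<subseteq> X"
    proof
      fix xs assume "xs \<in> ?r"
      then obtain \<sigma> where xs: "xs \<in> tup n" and \<sigma>: "\<sigma> \<in> Auts C" and h: "holds M \<phi> (xs @ map \<sigma> bs)"
        by auto
      obtain xs' where xs': "xs = map \<sigma> xs'" using Auts_surj_tuples[OF \<sigma>] by blast
      then have tup: "xs' \<in> tup n" using xs Auts_in_tuples[OF \<sigma>] by simp
      have "holds M \<phi> (map \<sigma> (xs' @ bs)) \<longleftrightarrow> holds M \<phi> (xs' @ bs)"
        by (rule holds_automorphism)
          (use \<sigma> tup bs \<phi>' in \<open>auto simp: auts_over_def tuples_def\<close>)
      then have "xs' \<in> X" using h xs' tup X by simp
      then show "xs \<in> X" using inv[OF \<sigma>] xs' by simp
    qed
  qed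
  moreover have "definable L M C ?r"
    by (intro definableI definable_intros orbit_definable bs S)
  ultimately show ?thesis by simp
qed

lemma invariant_definable_map:
  assumes "definable_map L M U X f"
    and "\<And>\<sigma> x. \<sigma> \<in> Auts C \<Longrightarrow> x \<in> X \<Longrightarrow> map \<sigma> x \<in> X \<and> map \<sigma> (f x) = f (map \<sigma> x)"
  shows "definable_map L M C X f"
  using assms(1) unfolding definable_map_def
  by (elim conjE, intro conjI invariant_definable) (use assms(2) in fastforce)+

lemma invariant_definable_map2:
  assumes "definable_map2 L M U X Y f"
    and "\<And>\<sigma> x y. \<sigma> \<in> Auts C \<Longrightarrow> x \<in> X \<Longrightarrow> y \<in> Y \<Longrightarrow>
      map \<sigma> x \<in> X \<and> map \<sigma> y \<in> Y \<and> map \<sigma> (f x y) = f (map \<sigma> x) (map \<sigma> y)"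
  shows "definable_map2 L M C X Y f"
  using assms(1) unfolding definable_map2_def
  by (elim conjE, intro conjI invariant_definable) (use assms(2) in fastforce)+

text \<open>The singleton of a fixed element is an invariant set.\<close>

lemma fixed_in_dcl:
  assumes "xs \<in> lists U" "\<And>\<sigma>. \<sigma> \<in> Auts C \<Longrightarrow> map \<sigma> xs = xs"
  shows "xs \<in> lists (dcl L M C)"
  unfolding in_lists_conv_set
proof
  fix c assume c: "c \<in> set xs"
  then have "c \<in> U" using assms(1) by auto
  moreover have "\<sigma> c = c" if "\<sigma> \<in> Auts C" for \<sigma>
    using assms(2)[OF that] c by (metis map_eq_conv map_idI map_ident)
  then have "definable L M C {[c]}"
    by (intro invariant_definable[OF definable_singleton[OF \<open>c \<in> U\<close>]]) auto
  ultimately show "c \<in> dcl L M C" by (simp add: dcl_def)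
qed

end

section \<open>Definable quotients\<close>

context fo_structure
begin

text \<open>Elimination of imaginaries concerns equivalence relations without parameters that are
  equivalence relations in every model. If \<open>\<theta>(x, u, z)\<close> defines a relation \<open>E\<close> for \<open>z = as\<close>, then
  \<open>\<forall>u. \<theta>(x, u, z) \<longleftrightarrow> \<theta>(y, u, w)\<close> is an equivalence relation between the tuples \<open>(x, z)\<close> and \<open>(y, w)\<close>
  in every structure, whatever \<open>\<theta>\<close> is, and for \<open>z = w = as\<close> it says that \<open>x\<close> and \<open>y\<close> have the same
  class.\<close>

lemma definable_quotient:
  assumes EI: "eliminates_imaginaries TYPE('a) L T" and M: "models L T M" and "C \<subseteq> U"
    and X: "definable L M C X" "X \<subseteq> tup n" "X \<noteq> {}"
    and E: "equiv X E" "definable L M C {x @ y |x y. (x, y) \<in> E}"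
  obtains k F where "definable_map L M C X F" "F \<in> X \<rightarrow> tup k"
    "\<forall>x\<in>X. \<forall>y\<in>X. F x = F y \<longleftrightarrow> (x, y) \<in> E"
proof -
  obtain p \<theta> as where \<theta>: "(\<theta>, as) \<in> formulas_over L C p"
    and E_\<theta>: "{x @ y |x y. (x, y) \<in> E} = {w \<in> tup p. holds M \<theta> (w @ as)}"
    using E(2) unfolding definable_def by blast
  have E_sub: "E \<subseteq> X \<times> X" and E_refl: "\<And>x. x \<in> X \<Longrightarrow> (x, x) \<in> E"
    using E(1) by (auto simp: equiv_def refl_on_def)
  obtain x0 where x0: "x0 \<in> X" using X(3) by blast
  then have "x0 @ x0 \<in> tup p" using E_refl[OF x0] E_\<theta> by blast
  then have p: "p = n + n" using x0 X(2) by (auto simp: tuples_def)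
  define l where "l = length as"
  have as: "as \<in> tup l" "set as \<subseteq> C" and \<theta>': "formula L (n + n + l) \<theta>"
    using \<theta> \<open>C \<subseteq> U\<close> by (auto simp: formulas_over_def l_def p tuples_def)
  let ?js1 = "[n..<n+n] @ [0..<n] @ [n+n..<n+n+l]"
  let ?js2 = "[n+n+l..<n+n+l+n] @ [0..<n] @ [n+n+l+n..<n+n+l+n+l]"
  let ?\<theta>1 = "ren (\<lambda>i. ?js1 ! i) \<theta>" and ?\<theta>2 = "ren (\<lambda>i. ?js2 ! i) \<theta>"
  let ?iff = "Conj (Neg (Conj ?\<theta>1 (Neg ?\<theta>2))) (Neg (Conj (Neg ?\<theta>1) ?\<theta>2))"
  define \<epsilon> where "\<epsilon> = Neg ((Ex ^^ n) (Neg ?iff))"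
  have "formula L (n + ((n + l) + (n + l))) ?\<theta>1" "formula L (n + ((n + l) + (n + l))) ?\<theta>2"
    using \<theta>' by (auto intro!: formula_ren simp: algebra_simps)
  then have \<epsilon>_formula: "formula L ((n + l) + (n + l)) \<epsilon>"
    unfolding \<epsilon>_def formula_Neg formula_Exs formula_Conj by blast
  have \<epsilon>_holds: "holds N \<epsilon> (x @ y) \<longleftrightarrow> (\<forall>u\<in>tuples (universe N) n.
      holds N \<theta> (take n x @ u @ drop n x) \<longleftrightarrow> holds N \<theta> (take n y @ u @ drop n y))"
    if "length x = n + l" "length y = n + l" for N :: "('f, 'r, 'a) struct" and x y
  proof -
    have "holds N ?\<theta>1 (u @ x @ y) \<longleftrightarrow> holds N \<theta> (take n x @ u @ drop n x)"
      and "holds N ?\<theta>2 (u @ x @ y) \<longleftrightarrow> holds N \<theta> (take n y @ u @ drop n y)"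
      if "u \<in> tuples (universe N) n" for u
    proof -
      obtain x1 x2 where x: "x = x1 @ x2" "length x1 = n" "length x2 = l"
        using \<open>length x = n + l\<close> by (metis append_take_drop_id diff_add_inverse le_add1 length_drop length_take min.absorb2)
      obtain y1 y2 where y: "y = y1 @ y2" "length y1 = n" "length y2 = l"
        using \<open>length y = n + l\<close> by (metis append_take_drop_id diff_add_inverse le_add1 length_drop length_take min.absorb2)
      have [simp]: "length u = n" using that by (simp add: tuples_def)
      let ?w = "u @ x1 @ x2 @ y1 @ y2"
      have u: "map (\<lambda>j. ?w ! j) [0..<n] = u" using map_nth_slice[of 0 "[]" n u] by simp
      have "map (\<lambda>j. ?w ! j) [n..<n+n] = x1" "map (\<lambda>j. ?w ! j) [n+n..<n+n+l] = x2"
        using x y map_nth_slice[of n u "n+n" x1] map_nth_slice[of "n+n" "u @ x1" "n+n+l" x2]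
        by simp_all
      then show "holds N ?\<theta>1 (u @ x @ y) \<longleftrightarrow> holds N \<theta> (take n x @ u @ drop n x)"
        using holds_ren[of L ?js1 \<theta> N ?w] \<theta>' x y u by (simp add: add.assoc)
      have "map (\<lambda>j. ?w ! j) [n+n+l..<n+n+l+n] = y1" "map (\<lambda>j. ?w ! j) [n+n+l+n..<n+n+l+n+l] = y2"
        using x y map_nth_slice[of "n+n+l" "u @ x1 @ x2" "n+n+l+n" y1]
          map_nth_slice[of "n+n+l+n" "u @ x1 @ x2 @ y1" "n+n+l+n+l" y2 "[]"]
        by (simp_all add: add.assoc)
      then show "holds N ?\<theta>2 (u @ x @ y) \<longleftrightarrow> holds N \<theta> (take n y @ u @ drop n y)"
        using holds_ren[of L ?js2 \<theta> N ?w] \<theta>' x y u by (simp add: add.assoc)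
    qed
    then show ?thesis unfolding \<epsilon>_def holds_Neg holds_Exs holds_Conj by blast
  qed
  let ?E = "\<lambda>N :: ('f, 'r, 'a) struct. {(x, y). x \<in> tuples (universe N) (n + l) \<and>
    y \<in> tuples (universe N) (n + l) \<and> holds N \<epsilon> (x @ y)}"
  have \<epsilon>_equiv: "equiv (tuples (universe N) (n + l)) (?E N)" for N :: "('f, 'r, 'a) struct"
  proof -
    have len: "length x = n + l" if "x \<in> tuples (universe N) (n + l)" for x
      using that by (simp add: tuples_def)
    show ?thesis
      by (intro equivI refl_onI symI transI) (auto simp: \<epsilon>_holds len)
  qed
  then have \<epsilon>_equiv': "\<forall>N. models L T N \<longrightarrow> equiv (tuples (universe N) (n + l)) (?E N)" by blast
  obtain k \<psi> where \<psi>: "formula L ((n + l) + k) \<psi>" and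
    "\<forall>N :: ('f, 'r, 'a) struct. models L T N \<longrightarrow>
       (\<exists>F. F \<in> tuples (universe N) (n + l) \<rightarrow> tuples (universe N) k \<and>
          (\<forall>x\<in>tuples (universe N) (n + l). \<forall>z\<in>tuples (universe N) k. holds N \<psi> (x @ z) \<longleftrightarrow> F x = z) \<and>
          (\<forall>x\<in>tuples (universe N) (n + l). \<forall>y\<in>tuples (universe N) (n + l).
             holds N \<epsilon> (x @ y) \<longleftrightarrow> F x = F y))"
    using EI[unfolded eliminates_imaginaries_def, THEN spec[of _ "n + l"], THEN spec[of _ \<epsilon>],
      THEN mp, OF conjI[OF \<epsilon>_formula \<epsilon>_equiv']] by (elim exE conjE) (rule that)
  from this(2)[rule_format, OF M] obtain F where F: "F \<in> tup (n + l) \<rightarrow> tup k" and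
    F_graph: "\<forall>x\<in>tup (n + l). \<forall>z\<in>tup k. holds M \<psi> (x @ z) \<longleftrightarrow> F x = z" and
    F_ker: "\<forall>x\<in>tup (n + l). \<forall>y\<in>tup (n + l). holds M \<epsilon> (x @ y) \<longleftrightarrow> F x = F y"
    by (elim exE conjE) (rule that)
  have X_as: "x @ as \<in> tup (n + l)" if "x \<in> X" for x using that X(2) as by auto
  let ?F = "\<lambda>x. F (x @ as)"
  have F_tup: "?F \<in> X \<rightarrow> tup k" using F X_as by auto
  have "?F x = ?F y \<longleftrightarrow> (x, y) \<in> E" if xy: "x \<in> X" "y \<in> X" for x y
  proof -
    have tup: "x \<in> tup n" "y \<in> tup n" using xy X(2) by auto
    have \<theta>_E: "holds M \<theta> (v @ u @ as) \<longleftrightarrow> (v, u) \<in> E" if "v \<in> tup n" "u \<in> tup n" for v u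
    proof -
      have "holds M \<theta> ((v @ u) @ as) \<longleftrightarrow> v @ u \<in> {w \<in> tup p. holds M \<theta> (w @ as)}"
        using that by (auto simp: p)
      also have "\<dots> \<longleftrightarrow> (v, u) \<in> E"
        unfolding E_\<theta>[symmetric]
      proof
        assume "v @ u \<in> {x @ y |x y. (x, y) \<in> E}"
        then obtain v' u' where *: "v @ u = v' @ u'" "(v', u') \<in> E" by blast
        then have "v' \<in> tup n" using E_sub X(2) by auto
        then show "(v, u) \<in> E" using * that tuples_append_eq by metis
      qed auto
      finally show ?thesis by simp
    qed
    have "?F x = ?F y \<longleftrightarrow> holds M \<epsilon> ((x @ as) @ (y @ as))" using F_ker X_as xy by blast
    also have "\<dots> \<longleftrightarrow> (\<forall>u\<in>tup n. holds M \<theta> (x @ u @ as) \<longleftrightarrow> holds M \<theta> (y @ u @ as))"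
      using tup by (subst \<epsilon>_holds) (auto simp: tuples_def l_def)
    also have "\<dots> \<longleftrightarrow> (\<forall>u\<in>tup n. (x, u) \<in> E \<longleftrightarrow> (y, u) \<in> E)" using \<theta>_E tup by simp
    also have "\<dots> \<longleftrightarrow> E `` {x} = E `` {y}" using E_sub X(2) by blast
    also have "\<dots> \<longleftrightarrow> (x, y) \<in> E" using eq_equiv_class_iff[OF E(1) xy] .
    finally show ?thesis .
  qed
  moreover have "definable_map L M C X ?F"
  proof -
    let ?\<Psi> = "{v \<in> tup (n + l + k). holds M \<psi> (v @ [])}"
    have \<Psi>: "definable L M C ?\<Psi>"
      by (rule definableI[OF definable_pred_formula]) (use \<psi> in \<open>auto simp: formulas_over_def\<close>)
    show ?thesis
    proof (rule definable_mapI[OF X(2) F_tup])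
      fix x z assume xz: "x \<in> tup n" "z \<in> tup k"
      then have "x @ as \<in> tup (n + l)" using as by auto
      then show "x \<in> X \<and> (x @ as) @ z \<in> ?\<Psi> \<longleftrightarrow> x \<in> X \<and> z = ?F x"
        using F_graph xz tuples_append[of "x @ as" U "n + l" z k] by auto
    next
      show "definable_pred C (n + k) (\<lambda>w. take n w \<in> X \<and> (take n w @ as) @ drop n w \<in> ?\<Psi>)"
        by (intro definable_intros \<Psi> X(1) coordinate_map_const as(2))
    qed
  qed
  ultimately show ?thesis using that F_tup by blast
qed

end

section \<open>The Galois group of a normal extension\<close>

text \<open>The restriction from \<open>Aut(M/A)\<close> to \<open>Aut(B/A)\<close> exists by normality and is onto by the lifting
  assumption, so equations can be moved between the two groups in both directions.\<close>

locale normal_ext = fo_structure L M + A: atomic_homogeneous L M A + B: atomic_homogeneous L M B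
  for L :: "('f, 'r) language" and M :: "('f, 'r, 'a) struct" and A B :: "'a set" +
  assumes normal: "normal_extension L M A B"
    and dcl_closed: "B = dcl L M B"
    and lifting: "\<forall>\<sigma>\<in>Aut L M B A. \<exists>\<tau>. automorphism L M \<tau> \<and> (\<forall>b\<in>B. \<tau> b = \<sigma> b)"
begin

abbreviation Gal :: "('a \<Rightarrow> 'a) set" where "Gal \<equiv> Aut L M B A"

lemma A_sub_B: "A \<subseteq> B"
  using normal by (simp add: normal_extension_def)

lemma Auts_B_A: "\<sigma> \<in> Auts B \<Longrightarrow> \<sigma> \<in> Auts A"
  using Auts_mono[OF A_sub_B] by blast

lemma Auts_lists_B:
  assumes \<tau>: "\<tau> \<in> Auts A" and xs: "xs \<in> lists U"
  shows "map \<tau> xs \<in> lists B \<longleftrightarrow> xs \<in> lists B"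
  using normal tp_Auts[OF \<tau> xs A.params] xs Auts_in_lists[OF \<tau>, of xs]
  unfolding normal_extension_def by metis

lemma Auts_B_iff: "\<tau> \<in> Auts A \<Longrightarrow> x \<in> U \<Longrightarrow> \<tau> x \<in> B \<longleftrightarrow> x \<in> B"
  using Auts_lists_B[of \<tau> "[x]"] by simp

lemma Gal_lift:
  assumes "\<sigma> \<in> Gal"
  obtains \<tau> where "\<tau> \<in> Auts A" "\<forall>xs\<in>lists B. map \<tau> xs = map \<sigma> xs"
proof -
  obtain \<tau> where \<tau>: "automorphism L M \<tau>" "\<forall>b\<in>B. \<tau> b = \<sigma> b" using lifting assms by blast
  then have "\<tau> \<in> Auts A" using assms A_sub_B by (auto simp: auts_over_def Aut_def)
  then show ?thesis using that \<tau>(2) by (auto simp: in_lists_conv_set)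
qed

lemma Gal_restrict:
  assumes \<tau>: "\<tau> \<in> Auts A"
  obtains \<sigma> where "\<sigma> \<in> Gal" "\<forall>xs\<in>lists B. map \<tau> xs = map \<sigma> xs"
proof -
  let ?\<sigma> = "\<lambda>x. if x \<in> B then \<tau> x else x"
  have perm: "\<tau> permutes U" by (rule Auts_permutes[OF \<tau>])
  have B_iff: "\<tau> x \<in> B \<longleftrightarrow> x \<in> B" if "x \<in> U" for x using Auts_B_iff[OF \<tau> that] .
  have "bij_betw \<tau> B B"
    unfolding bij_betw_def
  proof
    show "inj_on \<tau> B" using permutes_inj[OF perm] by (rule inj_on_subset) simp
    show "\<tau> ` B = B"
    proof
      show "\<tau> ` B \<subseteq> B" using B_iff B.params by auto
      show "B \<subseteq> \<tau> ` B"
      proof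
        fix b assume b: "b \<in> B"
        then obtain u where "u \<in> U" "b = \<tau> u" using B.params permutes_image[OF perm] by blast
        then show "b \<in> \<tau> ` B" using B_iff b by auto
      qed
    qed
  qed
  then have "?\<sigma> permutes B"
    by (intro bij_imp_permutes) (auto cong: bij_betw_cong)
  moreover have map_eq: "map \<tau> xs = map ?\<sigma> xs" if "xs \<in> lists B" for xs
    using that by (auto simp: in_lists_conv_set)
  moreover have "holds M \<phi> (map ?\<sigma> bs) \<longleftrightarrow> holds M \<phi> bs"
    if "bs \<in> lists B" "formula L (length bs) \<phi>" for bs \<phi>
    using holds_automorphism[of \<tau> bs \<phi>] \<tau> that B.params map_eq[OF that(1)]
    unfolding auts_over_def by auto
  ultimately have "?\<sigma> \<in> Gal"
    using \<tau> by (auto simp: Aut_def auts_over_def)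
  then show ?thesis using that map_eq by blast
qed

lemma fixed_in_B:
  assumes "xs \<in> lists U" "\<And>\<sigma>. \<sigma> \<in> Auts B \<Longrightarrow> map \<sigma> xs = xs"
  shows "xs \<in> lists B"
  using B.fixed_in_dcl[OF assms] dcl_closed by simp

lemma Auts_B_fix: "\<sigma> \<in> Auts B \<Longrightarrow> xs \<in> lists B \<Longrightarrow> map \<sigma> xs = xs"
  using Auts_fix[of \<sigma> B xs] by (auto simp: in_lists_conv_set)

lemma definable_map_in_B:
  assumes f: "definable_map L M A X f" and x: "x \<in> X" "x \<in> lists B"
  shows "f x \<in> lists B"
proof (rule fixed_in_B)
  show "f x \<in> lists U" using f x unfolding definable_map_def by (meson PiE tuples_lists)
  show "map \<sigma> (f x) = f x" if "\<sigma> \<in> Auts B" for \<sigma>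
    using definable_map_equivariant(2)[OF f A.params Auts_B_A[OF that] x(1)]
      Auts_B_fix[OF that x(2)] by simp
qed

lemma definable_map2_in_B:
  assumes f: "definable_map2 L M A X Y f" and x: "x \<in> X" "x \<in> lists B" "y \<in> Y" "y \<in> lists B"
  shows "f x y \<in> lists B"
proof (rule fixed_in_B)
  show "f x y \<in> lists U" using f x unfolding definable_map2_def by (meson PiE tuples_lists)
  show "map \<sigma> (f x y) = f x y" if "\<sigma> \<in> Auts B" for \<sigma>
    using definable_map2_equivariant(3)[OF f A.params Auts_B_A[OF that] x(1,3)]
      Auts_B_fix[OF that x(2)] Auts_B_fix[OF that x(4)] by simp
qed

lemma Gal_comp:
  assumes "\<sigma> \<in> Gal" "\<tau> \<in> Gal"
  shows "\<sigma> \<circ> \<tau> \<in> Gal"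
proof -
  have "map \<tau> bs \<in> lists B" if "bs \<in> lists B" for bs
    using assms(2) that by (auto simp: Aut_def permutes_in_image)
  then show ?thesis
    using assms unfolding Aut_def
    by (auto simp: permutes_compose simp flip: map_map)
qed

lemma Gal_id: "id \<in> Gal"
  by (auto simp: Aut_def permutes_id)

lemma Gal_lists_B: "\<sigma> \<in> Gal \<Longrightarrow> xs \<in> lists B \<Longrightarrow> map \<sigma> xs \<in> lists B"
  by (auto simp: Aut_def permutes_in_image)

end

section \<open>Cohomology of a definable group\<close>

locale galois_group = normal_ext L M A B
  for L :: "('f, 'r) language" and M :: "('f, 'r, 'a) struct" and A B :: "'a set" +
  fixes G :: "'a list monoid"
  assumes definable_group: "definable_group L M A G"
begin

sublocale group G
  using definable_group by (simp add: definable_group_def)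

abbreviation GB :: "'a list set" where "GB \<equiv> carrier G \<inter> lists B"

lemma mult_definable: "definable_map2 L M A (carrier G) (carrier G) (monoid.mult G)"
  and carrier_definable: "definable L M A (carrier G)"
  using definable_group by (simp_all add: definable_group_def)

lemma carrier_lists: "g \<in> carrier G \<Longrightarrow> g \<in> lists U"
  using carrier_definable by (auto elim!: definableE dest: tuples_lists)

lemma Auts_carrier: "\<tau> \<in> Auts A \<Longrightarrow> map \<tau> g \<in> carrier G \<longleftrightarrow> g \<in> carrier G"
  using definable_invariant[OF carrier_definable A.params] .

lemma Auts_mult:
  "\<tau> \<in> Auts A \<Longrightarrow> g \<in> carrier G \<Longrightarrow> h \<in> carrier G \<Longrightarrow>
    map \<tau> (g \<otimes>\<^bsub>G\<^esub> h) = map \<tau> g \<otimes>\<^bsub>G\<^esub> map \<tau> h"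
  using definable_map2_equivariant(3)[OF mult_definable A.params] .

lemma Auts_one: "\<tau> \<in> Auts A \<Longrightarrow> map \<tau> \<one>\<^bsub>G\<^esub> = \<one>\<^bsub>G\<^esub>"
  using Auts_mult[of \<tau> "\<one>\<^bsub>G\<^esub>" "\<one>\<^bsub>G\<^esub>"] Auts_carrier[of \<tau> "\<one>\<^bsub>G\<^esub>"] by simp

lemma Auts_inv:
  assumes "\<tau> \<in> Auts A" "g \<in> carrier G"
  shows "map \<tau> (inv\<^bsub>G\<^esub> g) = inv\<^bsub>G\<^esub> (map \<tau> g)"
  using Auts_mult[OF assms(1), of "inv\<^bsub>G\<^esub> g" g] assms Auts_one Auts_carrier
  by (intro inv_equality[symmetric]) simp_all

lemma one_GB: "\<one>\<^bsub>G\<^esub> \<in> GB"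
  using fixed_in_B[OF carrier_lists[OF one_closed]] Auts_one Auts_B_A by auto

lemma mult_GB: "g \<in> GB \<Longrightarrow> h \<in> GB \<Longrightarrow> g \<otimes>\<^bsub>G\<^esub> h \<in> GB"
  using definable_map2_in_B[OF mult_definable] by auto

lemma inv_GB: "g \<in> GB \<Longrightarrow> inv\<^bsub>G\<^esub> g \<in> GB"
  using fixed_in_B[OF carrier_lists[OF inv_closed]] Auts_inv[OF Auts_B_A] Auts_B_fix by auto

lemma Gal_GB:
  assumes "\<sigma> \<in> Gal"
  shows "g \<in> GB \<Longrightarrow> map \<sigma> g \<in> GB"
    and "g \<in> GB \<Longrightarrow> h \<in> GB \<Longrightarrow> map \<sigma> (g \<otimes>\<^bsub>G\<^esub> h) = map \<sigma> g \<otimes>\<^bsub>G\<^esub> map \<sigma> h"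
    and "map \<sigma> \<one>\<^bsub>G\<^esub> = \<one>\<^bsub>G\<^esub>"
    and "g \<in> GB \<Longrightarrow> map \<sigma> (inv\<^bsub>G\<^esub> g) = inv\<^bsub>G\<^esub> (map \<sigma> g)"
proof -
  obtain \<tau> where \<tau>: "\<tau> \<in> Auts A" and eq: "\<forall>xs\<in>lists B. map \<tau> xs = map \<sigma> xs"
    by (rule Gal_lift[OF assms])
  show "map \<sigma> g \<in> GB" if "g \<in> GB"
    using that Auts_carrier[OF \<tau>, of g] eq Gal_lists_B[OF assms, of g] by auto
  show "map \<sigma> (g \<otimes>\<^bsub>G\<^esub> h) = map \<sigma> g \<otimes>\<^bsub>G\<^esub> map \<sigma> h" if "g \<in> GB" "h \<in> GB"
    using that Auts_mult[OF \<tau>, of g h] eq mult_GB[OF that] by (metis IntD1 IntD2)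
  show "map \<sigma> \<one>\<^bsub>G\<^esub> = \<one>\<^bsub>G\<^esub>" using Auts_one[OF \<tau>] eq one_GB by (metis IntD2)
  show "map \<sigma> (inv\<^bsub>G\<^esub> g) = inv\<^bsub>G\<^esub> (map \<sigma> g)" if "g \<in> GB"
    using that Auts_inv[OF \<tau>, of g] eq inv_GB[OF that] by (metis IntD1 IntD2)
qed

abbreviation cocycles where "cocycles \<equiv> definable_cocycles L M B A G"

lemma cocycle_GB: "\<phi> \<in> cocycles \<Longrightarrow> \<sigma> \<in> Gal \<Longrightarrow> \<phi> \<sigma> \<in> GB"
  unfolding definable_cocycles_def by (blast dest: PiE_mem)

lemma cocycle_comp: "\<phi> \<in> cocycles \<Longrightarrow> \<sigma> \<in> Gal \<Longrightarrow> \<tau> \<in> Gal \<Longrightarrow>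
    \<phi> (\<sigma> \<circ> \<tau>) = \<phi> \<sigma> \<otimes>\<^bsub>G\<^esub> map \<sigma> (\<phi> \<tau>)"
  unfolding definable_cocycles_def by blast

lemma cocycle_id:
  assumes "\<phi> \<in> cocycles"
  shows "\<phi> id = \<one>\<^bsub>G\<^esub>"
  using cocycle_comp[OF assms Gal_id Gal_id] cocycle_GB[OF assms Gal_id] by simp

text \<open>Without the inverse the relation is symmetric in form and easier to compute with.\<close>

lemma cohomologous_iff:
  "(\<phi>, \<psi>) \<in> cohomologous L M B A G \<longleftrightarrow> \<phi> \<in> cocycles \<and> \<psi> \<in> cocycles \<and>
     (\<exists>b\<in>GB. \<forall>\<sigma>\<in>Gal. b \<otimes>\<^bsub>G\<^esub> \<phi> \<sigma> = \<psi> \<sigma> \<otimes>\<^bsub>G\<^esub> map \<sigma> b)"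
proof -
  have "\<phi> \<sigma> = inv\<^bsub>G\<^esub> b \<otimes>\<^bsub>G\<^esub> \<psi> \<sigma> \<otimes>\<^bsub>G\<^esub> map \<sigma> b \<longleftrightarrow> b \<otimes>\<^bsub>G\<^esub> \<phi> \<sigma> = \<psi> \<sigma> \<otimes>\<^bsub>G\<^esub> map \<sigma> b"
    if "\<phi> \<in> cocycles" "\<psi> \<in> cocycles" "b \<in> GB" "\<sigma> \<in> Gal" for b \<sigma>
    using cocycle_GB[OF that(1,4)] cocycle_GB[OF that(2,4)] that(3) Gal_GB(1)[OF that(4,3)]
    by (auto simp: inv_solve_left m_assoc)
  then show ?thesis unfolding cohomologous_def by auto
qed

lemma equiv_cohomologous: "equiv cocycles (cohomologous L M B A G)"
proof (intro equivI refl_onI symI transI)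
  show "cohomologous L M B A G \<subseteq> cocycles \<times> cocycles"
    by (auto simp: cohomologous_iff)
  show "(\<phi>, \<phi>) \<in> cohomologous L M B A G" if "\<phi> \<in> cocycles" for \<phi>
    using that one_GB cocycle_GB[OF that] Gal_GB(3)
    by (auto simp: cohomologous_iff intro!: bexI[where x = "\<one>\<^bsub>G\<^esub>"])
next
  fix \<phi> \<psi> assume "(\<phi>, \<psi>) \<in> cohomologous L M B A G"
  then obtain b where \<phi>: "\<phi> \<in> cocycles" and \<psi>: "\<psi> \<in> cocycles" and b: "b \<in> GB"
    and eq: "\<And>\<sigma>. \<sigma> \<in> Gal \<Longrightarrow> b \<otimes>\<^bsub>G\<^esub> \<phi> \<sigma> = \<psi> \<sigma> \<otimes>\<^bsub>G\<^esub> map \<sigma> b"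
    unfolding cohomologous_iff by blast
  have "inv\<^bsub>G\<^esub> b \<otimes>\<^bsub>G\<^esub> \<psi> \<sigma> = \<phi> \<sigma> \<otimes>\<^bsub>G\<^esub> map \<sigma> (inv\<^bsub>G\<^esub> b)" if \<sigma>: "\<sigma> \<in> Gal" for \<sigma>
  proof -
    have c: "b \<in> carrier G" "\<phi> \<sigma> \<in> carrier G" "\<psi> \<sigma> \<in> carrier G" "map \<sigma> b \<in> carrier G"
      using b cocycle_GB[OF \<phi> \<sigma>] cocycle_GB[OF \<psi> \<sigma>] Gal_GB(1)[OF \<sigma> b] by auto
    have "\<psi> \<sigma> = b \<otimes>\<^bsub>G\<^esub> \<phi> \<sigma> \<otimes>\<^bsub>G\<^esub> inv\<^bsub>G\<^esub> (map \<sigma> b)"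
      using c eq[OF \<sigma>] by (simp add: inv_solve_right)
    then show ?thesis using c Gal_GB(4)[OF \<sigma> b] by (simp add: inv_solve_left' m_assoc)
  qed
  then show "(\<psi>, \<phi>) \<in> cohomologous L M B A G"
    unfolding cohomologous_iff using \<phi> \<psi> inv_GB[OF b] by blast
next
  fix \<phi> \<psi> \<chi>
  assume "(\<phi>, \<psi>) \<in> cohomologous L M B A G" "(\<psi>, \<chi>) \<in> cohomologous L M B A G"
  then obtain b c where \<phi>: "\<phi> \<in> cocycles" and \<psi>: "\<psi> \<in> cocycles" and \<chi>: "\<chi> \<in> cocycles"
    and b: "b \<in> GB" and c: "c \<in> GB"
    and eqb: "\<And>\<sigma>. \<sigma> \<in> Gal \<Longrightarrow> b \<otimes>\<^bsub>G\<^esub> \<phi> \<sigma> = \<psi> \<sigma> \<otimes>\<^bsub>G\<^esub> map \<sigma> b"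
    and eqc: "\<And>\<sigma>. \<sigma> \<in> Gal \<Longrightarrow> c \<otimes>\<^bsub>G\<^esub> \<psi> \<sigma> = \<chi> \<sigma> \<otimes>\<^bsub>G\<^esub> map \<sigma> c"
    unfolding cohomologous_iff by blast
  have "(c \<otimes>\<^bsub>G\<^esub> b) \<otimes>\<^bsub>G\<^esub> \<phi> \<sigma> = \<chi> \<sigma> \<otimes>\<^bsub>G\<^esub> map \<sigma> (c \<otimes>\<^bsub>G\<^esub> b)" if \<sigma>: "\<sigma> \<in> Gal" for \<sigma>
  proof -
    have car: "b \<in> carrier G" "c \<in> carrier G" "\<phi> \<sigma> \<in> carrier G" "\<psi> \<sigma> \<in> carrier G"
      "\<chi> \<sigma> \<in> carrier G" "map \<sigma> b \<in> carrier G" "map \<sigma> c \<in> carrier G"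
      using b c cocycle_GB[OF \<phi> \<sigma>] cocycle_GB[OF \<psi> \<sigma>] cocycle_GB[OF \<chi> \<sigma>]
        Gal_GB(1)[OF \<sigma> b] Gal_GB(1)[OF \<sigma> c] by auto
    have "(c \<otimes>\<^bsub>G\<^esub> b) \<otimes>\<^bsub>G\<^esub> \<phi> \<sigma> = (c \<otimes>\<^bsub>G\<^esub> \<psi> \<sigma>) \<otimes>\<^bsub>G\<^esub> map \<sigma> b"
      using car eqb[OF \<sigma>] by (simp add: m_assoc)
    also have "\<dots> = \<chi> \<sigma> \<otimes>\<^bsub>G\<^esub> map \<sigma> (c \<otimes>\<^bsub>G\<^esub> b)"
      using car eqc[OF \<sigma>] Gal_GB(2)[OF \<sigma> c b] by (simp add: m_assoc)
    finally show ?thesis .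
  qed
  then show "(\<phi>, \<chi>) \<in> cohomologous L M B A G"
    unfolding cohomologous_iff using \<phi> \<chi> mult_GB[OF c b] by blast
qed

end

section \<open>Torsors and their cocycles\<close>

context normal_ext
begin

text \<open>The \<open>B\<close>-point is existentially quantified, so a torsor represents all cocycles in one class, and
  the correspondence of classes needs no choice of a point.\<close>

definition represents :: "'a list monoid \<Rightarrow> 'a gspace \<Rightarrow> (('a \<Rightarrow> 'a) \<Rightarrow> 'a list) \<Rightarrow> bool" where
  "represents G S \<phi> \<longleftrightarrow> S \<in> pointed_phs L M B A G \<and> \<phi> \<in> definable_cocycles L M B A G \<and>
     (\<exists>x\<in>fst S \<inter> lists B. \<forall>\<sigma>\<in>Gal. snd S x (\<phi> \<sigma>) = map \<sigma> x)"

end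

locale torsor = galois_group L M A B G
  for L :: "('f, 'r) language" and M :: "('f, 'r, 'a) struct" and A B :: "'a set"
    and G :: "'a list monoid" +
  fixes X :: "'a list set" and act :: "'a list \<Rightarrow> 'a list \<Rightarrow> 'a list"
  assumes phs: "phs L M A G (X, act)"
begin

lemma X_definable: "definable L M A X"
  and act_definable: "definable_map2 L M A X (carrier G) act"
  and act_closed: "x \<in> X \<Longrightarrow> g \<in> carrier G \<Longrightarrow> act x g \<in> X"
  and act_one: "x \<in> X \<Longrightarrow> act x \<one>\<^bsub>G\<^esub> = x"
  and act_mult: "x \<in> X \<Longrightarrow> g \<in> carrier G \<Longrightarrow> h \<in> carrier G \<Longrightarrow>
    act (act x g) h = act x (g \<otimes>\<^bsub>G\<^esub> h)"
  and act_ex1: "x \<in> X \<Longrightarrow> y \<in> X \<Longrightarrow> \<exists>!g. g \<in> carrier G \<and> act x g = y"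
  using phs by (auto simp: phs_def)

lemma X_lists: "x \<in> X \<Longrightarrow> x \<in> lists U"
  using X_definable by (auto elim!: definableE dest: tuples_lists)

lemma Auts_X: "\<tau> \<in> Auts A \<Longrightarrow> map \<tau> x \<in> X \<longleftrightarrow> x \<in> X"
  using definable_invariant[OF X_definable A.params] .

lemma Auts_act: "\<tau> \<in> Auts A \<Longrightarrow> x \<in> X \<Longrightarrow> g \<in> carrier G \<Longrightarrow>
    map \<tau> (act x g) = act (map \<tau> x) (map \<tau> g)"
  using definable_map2_equivariant(3)[OF act_definable A.params] .

definition diff :: "'a list \<Rightarrow> 'a list \<Rightarrow> 'a list" where
  "diff x y = (THE g. g \<in> carrier G \<and> act x g = y)"

lemma diff_closed: "x \<in> X \<Longrightarrow> y \<in> X \<Longrightarrow> diff x y \<in> carrier G"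
  and act_diff: "x \<in> X \<Longrightarrow> y \<in> X \<Longrightarrow> act x (diff x y) = y"
  using theI'[OF act_ex1] unfolding diff_def by blast+

lemma act_cancel:
  "x \<in> X \<Longrightarrow> g \<in> carrier G \<Longrightarrow> h \<in> carrier G \<Longrightarrow> act x g = act x h \<Longrightarrow> g = h"
  using act_ex1 act_closed by metis

lemma diff_act: "x \<in> X \<Longrightarrow> g \<in> carrier G \<Longrightarrow> diff x (act x g) = g"
  using act_cancel act_diff diff_closed act_closed by metis

text \<open>By uniqueness, whatever fixes \<open>x\<close> and \<open>y\<close> fixes the group element between them.\<close>

lemma diff_in_B:
  assumes "x \<in> X \<inter> lists B" "y \<in> X \<inter> lists B"
  shows "diff x y \<in> GB"
proof -
  have "map \<sigma> (diff x y) = diff x y" if \<sigma>: "\<sigma> \<in> Auts B" for \<sigma>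
  proof (rule act_cancel)
    show "act x (map \<sigma> (diff x y)) = act x (diff x y)"
      using Auts_act[OF Auts_B_A[OF \<sigma>], of x "diff x y"] Auts_B_fix[OF \<sigma>] assms
        diff_closed act_diff by simp
  qed (use assms diff_closed Auts_carrier[OF Auts_B_A[OF \<sigma>]] in auto)
  then show ?thesis using fixed_in_B[OF carrier_lists] diff_closed assms by blast
qed

lemma act_in_B: "x \<in> X \<inter> lists B \<Longrightarrow> g \<in> GB \<Longrightarrow> act x g \<in> X \<inter> lists B"
  using definable_map2_in_B[OF act_definable] act_closed by auto

text \<open>The graph of the division map is that of the action with its blocks permuted.\<close>

lemma diff_definable:
  assumes X: "X \<subseteq> tup m"
  shows "definable_map L M A {x @ y |x y. x \<in> X \<and> y \<in> X} (\<lambda>w. diff (take m w) (drop m w))"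
proof -
  obtain m' n k \<Gamma> where X': "X \<subseteq> tup m'" and n: "carrier G \<subseteq> tup n" and "act \<in> X \<rightarrow> carrier G \<rightarrow> tup k"
    and \<Gamma>: "definable L M A \<Gamma>" "\<forall>x g y. length x = m' \<longrightarrow> length g = n \<longrightarrow>
      (x @ g @ y \<in> \<Gamma> \<longleftrightarrow> x \<in> X \<and> g \<in> carrier G \<and> y = act x g)"
    using act_definable by (rule definable_map2E)
  have "X \<noteq> {}" using phs by (simp add: phs_def)
  then have "m' = m" using X X' by (auto simp: tuples_def)
  note \<Gamma> = \<Gamma>[unfolded \<open>m' = m\<close>]
  have len: "length x = m" if "x \<in> X" for x using that X by (auto simp: tuples_def)
  show ?thesis
  proof (rule definable_mapI)
    show "{x @ y |x y. x \<in> X \<and> y \<in> X} \<subseteq> tup (m + m)" using X by auto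
    show "(\<lambda>w. diff (take m w) (drop m w)) \<in> {x @ y |x y. x \<in> X \<and> y \<in> X} \<rightarrow> tup n"
      using len diff_closed n by auto
    show "definable_pred A (m + m + n)
      (\<lambda>w. take m (take (m + m) w) @ drop (m + m) w @ drop m (take (m + m) w) \<in> \<Gamma>)"
      by (intro definable_intros \<Gamma>(1))
    fix w g assume w: "w \<in> tup (m + m)" and g: "g \<in> tup n"
    define x y where "x = take m w" and "y = drop m w"
    have xy: "w = x @ y" "length x = m" "length g = n" using w g by (auto simp: x_def y_def tuples_def)
    have "x @ g @ y \<in> \<Gamma> \<longleftrightarrow> x \<in> X \<and> g \<in> carrier G \<and> y = act x g"
      using \<Gamma>(2) xy by blast
    also have "\<dots> \<longleftrightarrow> x \<in> X \<and> y \<in> X \<and> g = diff x y"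
      using act_closed diff_act act_diff diff_closed by metis
    finally have eq: "x @ g @ y \<in> \<Gamma> \<longleftrightarrow> x \<in> X \<and> y \<in> X \<and> g = diff x y" .
    have "w \<in> {x @ y |x y. x \<in> X \<and> y \<in> X} \<longleftrightarrow> x \<in> X \<and> y \<in> X"
    proof
      assume "w \<in> {x @ y |x y. x \<in> X \<and> y \<in> X}"
      then obtain x' y' where *: "w = x' @ y'" "x' \<in> X" "y' \<in> X" by blast
      then show "x \<in> X \<and> y \<in> X" using xy len[OF *(2)] by simp
    qed (use xy(1) in auto)
    then show "take m w @ g @ drop m w \<in> \<Gamma> \<longleftrightarrow>
      w \<in> {x @ y |x y. x \<in> X \<and> y \<in> X} \<and> g = diff (take m w) (drop m w)"
      unfolding x_def[symmetric] y_def[symmetric] eq by (simp only: conj_assoc)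
  qed
qed

text \<open>The cocycle law is the computation
  \<open>x \<phi>(\<sigma>\<tau>) = \<sigma>(\<tau>(x)) = \<sigma>(x \<phi>(\<tau>)) = x \<phi>(\<sigma>) \<sigma>(\<phi>(\<tau>))\<close>, and the division map is the definable function
  that a definable cocycle requires.\<close>

lemma point_cocycle:
  assumes x: "x \<in> X \<inter> lists B"
  shows "represents G (X, act) (\<lambda>\<sigma>\<in>Gal. diff x (map \<sigma> x))"
proof -
  let ?\<phi> = "\<lambda>\<sigma>\<in>Gal. diff x (map \<sigma> x)"
  have Gal_x: "map \<sigma> x \<in> X \<inter> lists B" if \<sigma>: "\<sigma> \<in> Gal" for \<sigma>
  proof -
    obtain \<tau> where "\<tau> \<in> Auts A" "\<forall>xs\<in>lists B. map \<tau> xs = map \<sigma> xs" by (rule Gal_lift[OF \<sigma>])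
    then show ?thesis using Auts_X[of \<tau> x] x Gal_lists_B[OF \<sigma>, of x] by (metis IntD1 IntD2 IntI)
  qed
  have \<phi>: "?\<phi> \<sigma> \<in> GB" "act x (?\<phi> \<sigma>) = map \<sigma> x" if "\<sigma> \<in> Gal" for \<sigma>
    using that diff_in_B[OF x Gal_x[OF that]] act_diff[of x "map \<sigma> x"] x Gal_x[OF that] by auto
  have comp: "?\<phi> (\<sigma> \<circ> \<tau>) = ?\<phi> \<sigma> \<otimes>\<^bsub>G\<^esub> map \<sigma> (?\<phi> \<tau>)" if \<sigma>: "\<sigma> \<in> Gal" and \<tau>: "\<tau> \<in> Gal" for \<sigma> \<tau>
  proof (rule act_cancel[of x])
    obtain \<sigma>' where \<sigma>': "\<sigma>' \<in> Auts A" "\<forall>xs\<in>lists B. map \<sigma>' xs = map \<sigma> xs" by (rule Gal_lift[OF \<sigma>])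
    have "act x (?\<phi> (\<sigma> \<circ> \<tau>)) = map \<sigma> (map \<tau> x)" using \<phi>(2)[OF Gal_comp[OF \<sigma> \<tau>]] by simp
    also have "\<dots> = map \<sigma>' (act x (?\<phi> \<tau>))" using \<sigma>'(2) Gal_x[OF \<tau>] \<phi>(2)[OF \<tau>] by (metis IntD2)
    also have "\<dots> = act (map \<sigma>' x) (map \<sigma>' (?\<phi> \<tau>))" using Auts_act[OF \<sigma>'(1)] x \<phi>(1)[OF \<tau>] by blast
    also have "\<dots> = act (map \<sigma> x) (map \<sigma> (?\<phi> \<tau>))" using \<sigma>'(2) x \<phi>(1)[OF \<tau>] by (metis IntD2)
    also have "\<dots> = act (act x (?\<phi> \<sigma>)) (map \<sigma> (?\<phi> \<tau>))" using \<phi>(2)[OF \<sigma>] by simp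
    also have "\<dots> = act x (?\<phi> \<sigma> \<otimes>\<^bsub>G\<^esub> map \<sigma> (?\<phi> \<tau>))"
      using act_mult x \<phi>(1)[OF \<sigma>] Gal_GB(1)[OF \<sigma> \<phi>(1)[OF \<tau>]] by blast
    finally show "act x (?\<phi> (\<sigma> \<circ> \<tau>)) = act x (?\<phi> \<sigma> \<otimes>\<^bsub>G\<^esub> map \<sigma> (?\<phi> \<tau>))" .
    show "x \<in> X" using x by blast
    show "?\<phi> (\<sigma> \<circ> \<tau>) \<in> carrier G" using \<phi>(1)[OF Gal_comp[OF \<sigma> \<tau>]] by blast
    show "?\<phi> \<sigma> \<otimes>\<^bsub>G\<^esub> map \<sigma> (?\<phi> \<tau>) \<in> carrier G"
      using mult_GB[OF \<phi>(1)[OF \<sigma>] Gal_GB(1)[OF \<sigma> \<phi>(1)[OF \<tau>]]] by blast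
  qed
  obtain m where m: "X \<subseteq> tup m" using X_definable by (rule definableE)
  then have len: "length x = m" using x by (auto simp: tuples_def)
  have "\<forall>\<sigma>\<in>Gal. x @ map \<sigma> x \<in> {x @ y |x y. x \<in> X \<and> y \<in> X} \<and>
      ?\<phi> \<sigma> = diff (take m (x @ map \<sigma> x)) (drop m (x @ map \<sigma> x))"
    using x Gal_x len by auto
  then have "?\<phi> \<in> cocycles"
    unfolding definable_cocycles_def mem_Collect_eq
    using \<phi>(1) comp diff_definable[OF m] x
    by (intro conjI ballI restrict_PiE_iff[THEN iffD2] exI bexI[where x = x]) (assumption | simp)+
  moreover have "(X, act) \<in> pointed_phs L M B A G" using phs x by (auto simp: pointed_phs_def)
  ultimately show ?thesis unfolding represents_def using x \<phi>(2) by auto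
qed

text \<open>In the coordinate \<open>g \<mapsto> x g\<close> an automorphism acts as \<open>g \<mapsto> \<phi>(\<sigma>) \<sigma>(g)\<close>.\<close>

lemma Auts_act_point:
  assumes "x \<in> X \<inter> lists B" "\<phi> \<in> cocycles" "\<forall>\<sigma>\<in>Gal. act x (\<phi> \<sigma>) = map \<sigma> x"
    and "\<tau> \<in> Auts A" "\<sigma> \<in> Gal" "\<forall>xs\<in>lists B. map \<tau> xs = map \<sigma> xs" "g \<in> carrier G"
  shows "map \<tau> (act x g) = act x (\<phi> \<sigma> \<otimes>\<^bsub>G\<^esub> map \<tau> g)"
proof -
  have "map \<tau> (act x g) = act (map \<tau> x) (map \<tau> g)" using Auts_act assms by blast
  also have "map \<tau> x = act x (\<phi> \<sigma>)" using assms by (metis IntD2)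
  finally show ?thesis
    using act_mult[of x "\<phi> \<sigma>" "map \<tau> g"] assms cocycle_GB[OF assms(2,5)] Auts_carrier[OF assms(4)]
    by auto
qed

end

context galois_group
begin

lemma pointed_phs_torsor:
  "(X, act) \<in> pointed_phs L M B A G \<Longrightarrow> torsor L M A B G X act"
  by unfold_locales (simp add: pointed_phs_def)

lemma represents_total:
  assumes "S \<in> pointed_phs L M B A G"
  shows "\<exists>\<phi>. represents G S \<phi>"
proof -
  obtain X act where S: "S = (X, act)" by (cases S)
  interpret torsor L M A B G X act using pointed_phs_torsor assms S by simp
  have "X \<inter> lists B \<noteq> {}" using assms S by (simp add: pointed_phs_def)
  then show ?thesis using point_cocycle S by blast
qed

text \<open>An isomorphism commutes with automorphisms, so the image of \<open>x\<close> has the same cocycle as \<open>x\<close>. The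
  element \<open>b\<close> of \<open>G(B)\<close> with \<open>y b\<close> equal to this image makes the two cocycles cohomologous.\<close>

lemma iso_imp_cohomologous:
  assumes \<phi>: "represents G (X, act) \<phi>" and \<psi>: "represents G (Y, act') \<psi>"
    and iso: "phs_iso L M A G (X, act) (Y, act')"
  shows "(\<phi>, \<psi>) \<in> cohomologous L M B A G"
proof -
  interpret X: torsor L M A B G X act using \<phi> by (simp add: represents_def pointed_phs_torsor)
  interpret Y: torsor L M A B G Y act' using \<psi> by (simp add: represents_def pointed_phs_torsor)
  obtain x where x: "x \<in> X \<inter> lists B" "\<forall>\<sigma>\<in>Gal. act x (\<phi> \<sigma>) = map \<sigma> x"
    using \<phi> by (auto simp: represents_def)
  obtain y where y: "y \<in> Y \<inter> lists B" "\<forall>\<sigma>\<in>Gal. act' y (\<psi> \<sigma>) = map \<sigma> y"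
    using \<psi> by (auto simp: represents_def)
  have coc: "\<phi> \<in> cocycles" "\<psi> \<in> cocycles" using \<phi> \<psi> by (simp_all add: represents_def)
  obtain f where f: "bij_betw f X Y" "definable_map L M A X f"
    "\<forall>x\<in>X. \<forall>g\<in>carrier G. f (act x g) = act' (f x) g"
    using iso by (auto simp: phs_iso_def)
  have fx: "f x \<in> Y \<inter> lists B"
    using x f(1) definable_map_in_B[OF f(2)] by (auto dest: bij_betwE)
  define b where "b = Y.diff y (f x)"
  have b: "b \<in> GB" and yb: "act' y b = f x"
    using Y.diff_in_B[OF y(1) fx] Y.act_diff y fx by (auto simp: b_def)
  have "b \<otimes>\<^bsub>G\<^esub> \<phi> \<sigma> = \<psi> \<sigma> \<otimes>\<^bsub>G\<^esub> map \<sigma> b" if \<sigma>: "\<sigma> \<in> Gal" for \<sigma>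
  proof (rule Y.act_cancel)
    obtain \<tau> where \<tau>: "\<tau> \<in> Auts A" "\<forall>xs\<in>lists B. map \<tau> xs = map \<sigma> xs" by (rule Gal_lift[OF \<sigma>])
    have c: "b \<in> carrier G" "\<phi> \<sigma> \<in> carrier G" "\<psi> \<sigma> \<in> carrier G" "map \<sigma> b \<in> carrier G"
      using b cocycle_GB[OF coc(1) \<sigma>] cocycle_GB[OF coc(2) \<sigma>] Gal_GB(1)[OF \<sigma> b] by auto
    show "y \<in> Y" using y by blast
    then have "act' y (b \<otimes>\<^bsub>G\<^esub> \<phi> \<sigma>) = f (act x (\<phi> \<sigma>))"
      using Y.act_mult[of y b "\<phi> \<sigma>"] c yb f(3) x by auto
    also have "\<dots> = f (map \<tau> x)" using x \<sigma> \<tau>(2) by (metis IntD2)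
    also have "\<dots> = map \<tau> (act' y b)"
      using definable_map_equivariant(2)[OF f(2) A.params \<tau>(1)] x yb by auto
    also have "\<dots> = act' y (\<psi> \<sigma> \<otimes>\<^bsub>G\<^esub> map \<tau> b)"
      using Y.Auts_act_point[OF y(1) coc(2) y(2) \<tau>(1) \<sigma> \<tau>(2)] c by blast
    also have "map \<tau> b = map \<sigma> b" using \<tau>(2) b by (metis IntD2)
    finally show "act' y (b \<otimes>\<^bsub>G\<^esub> \<phi> \<sigma>) = act' y (\<psi> \<sigma> \<otimes>\<^bsub>G\<^esub> map \<sigma> b)" .
    show "b \<otimes>\<^bsub>G\<^esub> \<phi> \<sigma> \<in> carrier G" "\<psi> \<sigma> \<otimes>\<^bsub>G\<^esub> map \<sigma> b \<in> carrier G" using c by simp_all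
  qed
  then show ?thesis unfolding cohomologous_iff using coc b by blast
qed

text \<open>Moving \<open>y\<close> by the given element of \<open>G(B)\<close> produces a point \<open>z\<close> with the same cocycle as \<open>x\<close>. Then \<open>x g \<mapsto> z g\<close> is
  definable from \<open>x\<close> and \<open>z\<close>, and it commutes with the automorphisms because they act on both sides
  by the same twisted formula.\<close>

lemma cohomologous_imp_iso:
  assumes \<phi>: "represents G (X, act) \<phi>" and \<psi>: "represents G (Y, act') \<psi>"
    and coh: "(\<phi>, \<psi>) \<in> cohomologous L M B A G"
  shows "phs_iso L M A G (X, act) (Y, act')"
proof -
  interpret X: torsor L M A B G X act using \<phi> by (simp add: represents_def pointed_phs_torsor)
  interpret Y: torsor L M A B G Y act' using \<psi> by (simp add: represents_def pointed_phs_torsor)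
  obtain x where x: "x \<in> X \<inter> lists B" "\<forall>\<sigma>\<in>Gal. act x (\<phi> \<sigma>) = map \<sigma> x"
    using \<phi> by (auto simp: represents_def)
  obtain y where y: "y \<in> Y \<inter> lists B" "\<forall>\<sigma>\<in>Gal. act' y (\<psi> \<sigma>) = map \<sigma> y"
    using \<psi> by (auto simp: represents_def)
  obtain b where coc: "\<phi> \<in> cocycles" "\<psi> \<in> cocycles" and b: "b \<in> GB"
    and eq: "\<forall>\<sigma>\<in>Gal. b \<otimes>\<^bsub>G\<^esub> \<phi> \<sigma> = \<psi> \<sigma> \<otimes>\<^bsub>G\<^esub> map \<sigma> b"
    using coh unfolding cohomologous_iff by blast
  define z where "z = act' y b"
  have z: "z \<in> Y \<inter> lists B" unfolding z_def by (rule Y.act_in_B[OF y(1) b])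
  have z_\<phi>: "\<forall>\<sigma>\<in>Gal. act' z (\<phi> \<sigma>) = map \<sigma> z"
  proof
    fix \<sigma> assume \<sigma>: "\<sigma> \<in> Gal"
    obtain \<tau> where \<tau>: "\<tau> \<in> Auts A" "\<forall>xs\<in>lists B. map \<tau> xs = map \<sigma> xs" by (rule Gal_lift[OF \<sigma>])
    have "act' z (\<phi> \<sigma>) = act' y (\<psi> \<sigma> \<otimes>\<^bsub>G\<^esub> map \<sigma> b)"
      unfolding z_def using Y.act_mult[of y b "\<phi> \<sigma>"] eq \<sigma> y b cocycle_GB[OF coc(1) \<sigma>] by auto
    also have "map \<sigma> b = map \<tau> b" using \<tau>(2) b by (metis IntD2)
    also have "act' y (\<psi> \<sigma> \<otimes>\<^bsub>G\<^esub> map \<tau> b) = map \<tau> z"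
      unfolding z_def using Y.Auts_act_point[OF y(1) coc(2) y(2) \<tau>(1) \<sigma> \<tau>(2)] b by auto
    also have "\<dots> = map \<sigma> z" using \<tau>(2) z by (metis IntD2)
    finally show "act' z (\<phi> \<sigma>) = map \<sigma> z" .
  qed
  define f where "f = (\<lambda>w. act' z (X.diff x w))"
  have f_act: "f (act x g) = act' z g" if "g \<in> carrier G" for g
    using that x X.diff_act by (simp add: f_def)
  have X_cases: "\<exists>g\<in>carrier G. w = act x g" if "w \<in> X" for w
    using that x X.act_diff X.diff_closed by (metis IntD1)
  have "bij_betw f X Y"
    unfolding bij_betw_def
  proof
    show "inj_on f X"
    proof (rule inj_onI)
      fix v w assume vw: "v \<in> X" "w \<in> X" "f v = f w"
      obtain g h where gh: "g \<in> carrier G" "v = act x g" "h \<in> carrier G" "w = act x h"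
        using X_cases vw by blast
      then show "v = w" using vw(3) f_act Y.act_cancel[of z g h] z by auto
    qed
    show "f ` X = Y"
    proof
      show "f ` X \<subseteq> Y" using X_cases f_act Y.act_closed z by fastforce
      show "Y \<subseteq> f ` X"
      proof
        fix v assume v: "v \<in> Y"
        then have "v = f (act x (Y.diff z v))" using f_act Y.act_diff Y.diff_closed z by auto
        then show "v \<in> f ` X" using X.act_closed x Y.diff_closed v z by auto
      qed
    qed
  qed
  moreover have "\<forall>w\<in>X. \<forall>g\<in>carrier G. f (act w g) = act' (f w) g"
  proof (intro ballI)
    fix w g assume w: "w \<in> X" and g: "g \<in> carrier G"
    obtain h where "h \<in> carrier G" "w = act x h" using X_cases w by blast
    then show "f (act w g) = act' (f w) g"
      using g x z X.act_mult[of x h g] Y.act_mult[of z h g] f_act by auto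
  qed
  moreover have "definable_map L M A X f"
  proof (rule A.invariant_definable_map)
    obtain m n k \<Gamma> where \<Gamma>: "X \<subseteq> tup m" "carrier G \<subseteq> tup n" "act \<in> X \<rightarrow> carrier G \<rightarrow> tup k"
      "definable L M U \<Gamma>" "\<forall>x g y. length x = m \<longrightarrow> length g = n \<longrightarrow>
        (x @ g @ y \<in> \<Gamma> \<longleftrightarrow> x \<in> X \<and> g \<in> carrier G \<and> y = act x g)"
      by (rule definable_map2E[OF definable_map2_mono[OF A.params X.act_definable]])
    obtain m' n' k' \<Gamma>' where \<Gamma>': "Y \<subseteq> tup m'" "carrier G \<subseteq> tup n'" "act' \<in> Y \<rightarrow> carrier G \<rightarrow> tup k'"
      "definable L M U \<Gamma>'" "\<forall>x g y. length x = m' \<longrightarrow> length g = n' \<longrightarrow>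
        (x @ g @ y \<in> \<Gamma>' \<longleftrightarrow> x \<in> Y \<and> g \<in> carrier G \<and> y = act' x g)"
      by (rule definable_map2E[OF definable_map2_mono[OF A.params Y.act_definable]])
    have [simp]: "n' = n" using subsetD[OF \<Gamma>(2) one_closed] subsetD[OF \<Gamma>'(2) one_closed] by (auto simp: tuples_def)
    show "definable_map L M U X f"
    proof (rule definable_mapI[OF \<Gamma>(1)])
      show "f \<in> X \<rightarrow> tup m'" using X_cases f_act Y.act_closed z \<Gamma>'(1) by fastforce
      show "definable_pred U (m + m') (\<lambda>w. \<exists>g\<in>tup n. x @ g @ take m w \<in> \<Gamma> \<and> z @ g @ drop m w \<in> \<Gamma>')"
        by (intro definable_intros coordinate_map_const \<Gamma>(4) \<Gamma>'(4))
          (use X.X_lists[of x] Y.X_lists[of z] x z in auto)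
      fix v w
      have "length x = m" "length z = m'" using x z \<Gamma>(1) \<Gamma>'(1) by (auto simp: tuples_def)
      then have "x @ g @ v \<in> \<Gamma> \<longleftrightarrow> g \<in> carrier G \<and> v = act x g"
        "z @ g @ w \<in> \<Gamma>' \<longleftrightarrow> g \<in> carrier G \<and> w = act' z g" if "g \<in> tup n" for g
        using \<Gamma>(5) \<Gamma>'(5) x z that by (auto simp: tuples_def)
      then have "(\<exists>g\<in>tup n. x @ g @ v \<in> \<Gamma> \<and> z @ g @ w \<in> \<Gamma>') \<longleftrightarrow>
          (\<exists>g\<in>carrier G. v = act x g \<and> w = act' z g)"
        using \<Gamma>(2) by blast
      also have "\<dots> \<longleftrightarrow> v \<in> X \<and> w = f v"
      proof
        assume "\<exists>g\<in>carrier G. v = act x g \<and> w = act' z g"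
        then obtain g where "g \<in> carrier G" "v = act x g" "w = act' z g" by blast
        then show "v \<in> X \<and> w = f v" using X.act_closed x f_act by simp
      next
        assume v: "v \<in> X \<and> w = f v"
        then obtain g where "g \<in> carrier G" "v = act x g" using X_cases by blast
        then show "\<exists>g\<in>carrier G. v = act x g \<and> w = act' z g"
          using v f_act by (intro bexI[where x = g]) simp_all
      qed
      finally show "(\<exists>g\<in>tup n. x @ g @ v \<in> \<Gamma> \<and> z @ g @ w \<in> \<Gamma>') \<longleftrightarrow> v \<in> X \<and> w = f v" .
    qed
    fix \<tau> w assume \<tau>: "\<tau> \<in> Auts A" and w: "w \<in> X"
    obtain \<sigma> where \<sigma>: "\<sigma> \<in> Gal" "\<forall>xs\<in>lists B. map \<tau> xs = map \<sigma> xs" by (rule Gal_restrict[OF \<tau>])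
    obtain g where g: "g \<in> carrier G" "w = act x g" using X_cases w by blast
    then have "map \<tau> g \<in> carrier G" using Auts_carrier[OF \<tau>] by simp
    moreover have "\<phi> \<sigma> \<in> carrier G" using cocycle_GB[OF coc(1) \<sigma>(1)] by blast
    ultimately show "map \<tau> w \<in> X \<and> map \<tau> (f w) = f (map \<tau> w)"
      using X.Auts_act_point[OF x(1) coc(1) x(2) \<tau> \<sigma> g(1)]
        Y.Auts_act_point[OF z coc(1) z_\<phi> \<tau> \<sigma> g(1)] g f_act X.Auts_X[OF \<tau>, of w] w by simp
  qed
  ultimately show ?thesis unfolding phs_iso_def by auto
qed

lemma phs_rel_iff:
  assumes "represents G S \<phi>" "represents G S' \<psi>"
  shows "(S, S') \<in> phs_rel L M B A G \<longleftrightarrow> (\<phi>, \<psi>) \<in> cohomologous L M B A G"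
proof -
  obtain X act Y act' where S: "S = (X, act)" "S' = (Y, act')" by (cases S, cases S')
  have "S \<in> pointed_phs L M B A G" "S' \<in> pointed_phs L M B A G"
    using assms by (simp_all add: represents_def)
  then show ?thesis
    using iso_imp_cohomologous[OF assms[unfolded S]] cohomologous_imp_iso[OF assms[unfolded S]]
    unfolding phs_rel_def S by blast
qed

end

section \<open>Twisted forms of the group\<close>

context galois_group
begin

text \<open>An embedding \<open>e\<close> of the group as a set of tuples on which the automorphisms act by the twisted
  formula makes its image a torsor over \<open>A\<close>: the image and the action are definable from the
  parameters of \<open>e\<close> and invariant, because the twist is a left translation and the action is right
  multiplication. The point \<open>e 1\<close> is fixed over \<open>B\<close>, where the twist is trivial. Both the torsor of a
  cocycle and the contracted product are recognised in this way.\<close>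

lemma twisted_form_represents:
  assumes \<phi>: "\<phi> \<in> cocycles"
    and e: "e \<in> carrier G \<rightarrow> tup k" "inj_on e (carrier G)" "definable_map L M U (carrier G) e"
    and twist: "\<And>\<tau> \<sigma> g. \<tau> \<in> Auts A \<Longrightarrow> \<sigma> \<in> Gal \<Longrightarrow> \<forall>xs\<in>lists B. map \<tau> xs = map \<sigma> xs \<Longrightarrow>
      g \<in> carrier G \<Longrightarrow> map \<tau> (e g) = e (\<phi> \<sigma> \<otimes>\<^bsub>G\<^esub> map \<tau> g)"
    and act: "\<And>g h. g \<in> carrier G \<Longrightarrow> h \<in> carrier G \<Longrightarrow> act (e g) h = e (g \<otimes>\<^bsub>G\<^esub> h)"
  shows "represents G (e ` carrier G, act) \<phi>"
proof -
  let ?X = "e ` carrier G"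
  obtain n k' \<Gamma> where \<Gamma>: "carrier G \<subseteq> tup n" "e \<in> carrier G \<rightarrow> tup k'" "definable L M U \<Gamma>"
    "\<forall>g x. length g = n \<longrightarrow> (g @ x \<in> \<Gamma> \<longleftrightarrow> g \<in> carrier G \<and> x = e g)"
    using e(3) by (rule definable_mapE)
  have "e \<one>\<^bsub>G\<^esub> \<in> tup k" "e \<one>\<^bsub>G\<^esub> \<in> tup k'" using e(1) \<Gamma>(2) one_closed by blast+
  then have [simp]: "k' = k" by (simp add: tuples_def)
  have len: "length g = n" if "g \<in> carrier G" for g using that \<Gamma>(1) by (auto simp: tuples_def)
  have equivariant: "\<exists>c\<in>carrier G. \<forall>g\<in>carrier G. map \<tau> (e g) = e (c \<otimes>\<^bsub>G\<^esub> map \<tau> g)"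
    if \<tau>: "\<tau> \<in> Auts A" for \<tau>
  proof -
    obtain \<sigma> where \<sigma>: "\<sigma> \<in> Gal" "\<forall>xs\<in>lists B. map \<tau> xs = map \<sigma> xs" by (rule Gal_restrict[OF \<tau>])
    then show ?thesis using twist[OF \<tau> \<sigma>] cocycle_GB[OF \<phi> \<sigma>(1)] by blast
  qed
  have X_definable: "definable L M A ?X"
  proof (rule A.invariant_definable)
    have "?X = {x \<in> tup k. \<exists>g\<in>tup n. g @ x \<in> \<Gamma>}"
    proof
      show "?X \<subseteq> {x \<in> tup k. \<exists>g\<in>tup n. g @ x \<in> \<Gamma>}" using \<Gamma>(1,4) e(1) len by blast
      show "{x \<in> tup k. \<exists>g\<in>tup n. g @ x \<in> \<Gamma>} \<subseteq> ?X" using \<Gamma>(4) by (auto simp: tuples_def)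
    qed
    moreover have "definable L M U {x \<in> tup k. \<exists>g\<in>tup n. g @ x \<in> \<Gamma>}"
      by (intro definableI definable_intros \<Gamma>(3))
    ultimately show "definable L M U ?X" by simp
    fix \<tau> x assume \<tau>: "\<tau> \<in> Auts A" and "x \<in> ?X"
    then obtain g where g: "g \<in> carrier G" "x = e g" by blast
    obtain c where "c \<in> carrier G" "\<forall>g\<in>carrier G. map \<tau> (e g) = e (c \<otimes>\<^bsub>G\<^esub> map \<tau> g)"
      using equivariant[OF \<tau>] by blast
    then show "map \<tau> x \<in> ?X" using g Auts_carrier[OF \<tau>, of g] by simp
  qed
  have act_definable: "definable_map2 L M A ?X (carrier G) act"
  proof (rule A.invariant_definable_map2)
    obtain n1 n2 n3 \<mu> where \<mu>: "carrier G \<subseteq> tup n1" "carrier G \<subseteq> tup n2"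
      "monoid.mult G \<in> carrier G \<rightarrow> carrier G \<rightarrow> tup n3" "definable L M U \<mu>"
      "\<forall>g h v. length g = n1 \<longrightarrow> length h = n2 \<longrightarrow>
        (g @ h @ v \<in> \<mu> \<longleftrightarrow> g \<in> carrier G \<and> h \<in> carrier G \<and> v = g \<otimes>\<^bsub>G\<^esub> h)"
      by (rule definable_map2E[OF definable_map2_mono[OF A.params mult_definable]])
    have n12: "n1 = n" "n2 = n"
      using subsetD[OF \<mu>(1) one_closed] subsetD[OF \<mu>(2) one_closed] len[OF one_closed]
      by (simp_all add: tuples_def)
    show "definable_map2 L M U ?X (carrier G) act"
    proof (rule definable_map2I)
      show "?X \<subseteq> tup k" using e(1) by blast
      show "carrier G \<subseteq> tup n" by (rule \<Gamma>(1))
      show "act \<in> ?X \<rightarrow> carrier G \<rightarrow> tup k" using act e(1) by auto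
      show "definable_pred U (k + (n + k)) (\<lambda>w. \<exists>g\<in>tup n. \<exists>v\<in>tup n. g @ take k w \<in> \<Gamma> \<and>
          g @ take n (drop k w) @ v \<in> \<mu> \<and> v @ drop n (drop k w) \<in> \<Gamma>)"
        by (intro definable_intros \<Gamma>(3) \<mu>(4))
      fix x h z assume h: "h \<in> tup n"
      have 1: "g @ x \<in> \<Gamma> \<longleftrightarrow> g \<in> carrier G \<and> x = e g"
        and 2: "g @ h @ v \<in> \<mu> \<longleftrightarrow> g \<in> carrier G \<and> h \<in> carrier G \<and> v = g \<otimes>\<^bsub>G\<^esub> h"
        and 3: "g @ z \<in> \<Gamma> \<longleftrightarrow> g \<in> carrier G \<and> z = e g" if "g \<in> tup n" for g v
        using \<Gamma>(4) \<mu>(5) n12 h that by (auto simp: tuples_def)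
      have "(\<exists>g\<in>tup n. \<exists>v\<in>tup n. g @ x \<in> \<Gamma> \<and> g @ h @ v \<in> \<mu> \<and> v @ z \<in> \<Gamma>) \<longleftrightarrow>
          (\<exists>g\<in>carrier G. x = e g \<and> h \<in> carrier G \<and> z = e (g \<otimes>\<^bsub>G\<^esub> h))"
      proof
        assume "\<exists>g\<in>tup n. \<exists>v\<in>tup n. g @ x \<in> \<Gamma> \<and> g @ h @ v \<in> \<mu> \<and> v @ z \<in> \<Gamma>"
        then obtain g v where "g \<in> tup n" "v \<in> tup n" "g @ x \<in> \<Gamma>" "g @ h @ v \<in> \<mu>" "v @ z \<in> \<Gamma>"
          by blast
        then show "\<exists>g\<in>carrier G. x = e g \<and> h \<in> carrier G \<and> z = e (g \<otimes>\<^bsub>G\<^esub> h)"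
          using 1[of g] 2[of g v] 3[of v] by (intro bexI[where x = g]) simp_all
      next
        assume "\<exists>g\<in>carrier G. x = e g \<and> h \<in> carrier G \<and> z = e (g \<otimes>\<^bsub>G\<^esub> h)"
        then obtain g where g: "g \<in> carrier G" "x = e g" "h \<in> carrier G" "z = e (g \<otimes>\<^bsub>G\<^esub> h)" by blast
        then have "g \<in> tup n" "g \<otimes>\<^bsub>G\<^esub> h \<in> tup n" using \<Gamma>(1) by auto
        then show "\<exists>g\<in>tup n. \<exists>v\<in>tup n. g @ x \<in> \<Gamma> \<and> g @ h @ v \<in> \<mu> \<and> v @ z \<in> \<Gamma>"
          using g 1[of g] 2[of g "g \<otimes>\<^bsub>G\<^esub> h"] 3[of "g \<otimes>\<^bsub>G\<^esub> h"]
          by (intro bexI[where x = g] bexI[where x = "g \<otimes>\<^bsub>G\<^esub> h"]) simp_all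
      qed
      also have "\<dots> \<longleftrightarrow> x \<in> ?X \<and> h \<in> carrier G \<and> z = act x h"
      proof
        assume "\<exists>g\<in>carrier G. x = e g \<and> h \<in> carrier G \<and> z = e (g \<otimes>\<^bsub>G\<^esub> h)"
        then show "x \<in> ?X \<and> h \<in> carrier G \<and> z = act x h" by (auto simp: act)
      next
        assume *: "x \<in> ?X \<and> h \<in> carrier G \<and> z = act x h"
        then obtain g where "g \<in> carrier G" "x = e g" by blast
        then show "\<exists>g\<in>carrier G. x = e g \<and> h \<in> carrier G \<and> z = e (g \<otimes>\<^bsub>G\<^esub> h)"
          using * act by (intro bexI[where x = g]) simp_all
      qed
      finally show "(\<exists>g\<in>tup n. \<exists>v\<in>tup n. g @ x \<in> \<Gamma> \<and> g @ h @ v \<in> \<mu> \<and> v @ z \<in> \<Gamma>) \<longleftrightarrow>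
          x \<in> ?X \<and> h \<in> carrier G \<and> z = act x h" .
    qed
    fix \<tau> x h assume \<tau>: "\<tau> \<in> Auts A" and x: "x \<in> ?X" and h: "h \<in> carrier G"
    obtain g where g: "g \<in> carrier G" "x = e g" using x by blast
    obtain c where c: "c \<in> carrier G" "\<forall>g\<in>carrier G. map \<tau> (e g) = e (c \<otimes>\<^bsub>G\<^esub> map \<tau> g)"
      using equivariant[OF \<tau>] by blast
    have car: "map \<tau> g \<in> carrier G" "map \<tau> h \<in> carrier G" using Auts_carrier[OF \<tau>] g h by auto
    then show "map \<tau> x \<in> ?X \<and> map \<tau> h \<in> carrier G \<and> map \<tau> (act x h) = act (map \<tau> x) (map \<tau> h)"
      using c g h act Auts_mult[OF \<tau> g(1) h] by (simp add: m_assoc)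
  qed
  have "phs L M A G (?X, act)"
    unfolding phs_def prod.case
  proof (intro conjI ballI X_definable act_definable)
    show "?X \<noteq> {}" using one_closed by blast
    show "act \<in> ?X \<rightarrow> carrier G \<rightarrow> ?X" using act by auto
    show "act x \<one>\<^bsub>G\<^esub> = x" if "x \<in> ?X" for x using that act by auto
    show "act (act x g) h = act x (g \<otimes>\<^bsub>G\<^esub> h)"
      if "x \<in> ?X" "g \<in> carrier G" "h \<in> carrier G" for x g h using that act by (auto simp: m_assoc)
    show "\<exists>!g. g \<in> carrier G \<and> act x g = y" if "x \<in> ?X" "y \<in> ?X" for x y
    proof -
      obtain a b where ab: "a \<in> carrier G" "x = e a" "b \<in> carrier G" "y = e b" using \<open>x \<in> ?X\<close> \<open>y \<in> ?X\<close> by blast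
      have "act x g = y \<longleftrightarrow> a \<otimes>\<^bsub>G\<^esub> g = b" if "g \<in> carrier G" for g
        using inj_onD[OF e(2)] that ab act by auto
      then show ?thesis
        using ab by (intro ex1I[where a = "inv\<^bsub>G\<^esub> a \<otimes>\<^bsub>G\<^esub> b"]) (auto simp: m_assoc[symmetric])
    qed
  qed
  moreover have e1: "e \<one>\<^bsub>G\<^esub> \<in> lists B"
  proof (rule fixed_in_B)
    show "e \<one>\<^bsub>G\<^esub> \<in> lists U" using e(1) one_closed tuples_lists by blast
    fix \<tau> assume \<tau>: "\<tau> \<in> Auts B"
    then have "\<forall>xs\<in>lists B. map \<tau> xs = map id xs" using Auts_B_fix[OF \<tau>] by simp
    then show "map \<tau> (e \<one>\<^bsub>G\<^esub>) = e \<one>\<^bsub>G\<^esub>"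
      using twist[OF Auts_B_A[OF \<tau>] Gal_id _ one_closed] Auts_one[OF Auts_B_A[OF \<tau>]] cocycle_id[OF \<phi>]
      by simp
  qed
  moreover have "act (e \<one>\<^bsub>G\<^esub>) (\<phi> \<sigma>) = map \<sigma> (e \<one>\<^bsub>G\<^esub>)" if \<sigma>: "\<sigma> \<in> Gal" for \<sigma>
  proof -
    obtain \<tau> where \<tau>: "\<tau> \<in> Auts A" "\<forall>xs\<in>lists B. map \<tau> xs = map \<sigma> xs" by (rule Gal_lift[OF \<sigma>])
    have "\<phi> \<sigma> \<in> carrier G" using cocycle_GB[OF \<phi> \<sigma>] by blast
    then have "act (e \<one>\<^bsub>G\<^esub>) (\<phi> \<sigma>) = map \<tau> (e \<one>\<^bsub>G\<^esub>)"
      using twist[OF \<tau>(1) \<sigma> \<tau>(2) one_closed] Auts_one[OF \<tau>(1)] act by simp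
    then show ?thesis using \<tau>(2) e1 by metis
  qed
  moreover have "e \<one>\<^bsub>G\<^esub> \<in> ?X \<inter> lists B" using e1 one_closed by blast
  ultimately show ?thesis
    unfolding represents_def pointed_phs_def fst_conv snd_conv mem_Collect_eq prod.case
    using \<phi> by blast
qed

lemma Auts_restrict_comp:
  assumes "\<tau> \<in> Auts A" "\<sigma> \<in> Gal" "\<forall>xs\<in>lists B. map \<tau> xs = map \<sigma> xs" "\<rho> \<in> Gal" "xs \<in> lists B"
  shows "map \<tau> (map \<rho> xs) = map (\<sigma> \<circ> \<rho>) xs"
  using assms(3) Gal_lists_B[OF assms(4,5)] by (metis map_map)

lemma orbit_Gal:
  assumes "as \<in> lists B"
  shows "{map \<tau> as |\<tau>. \<tau> \<in> Auts A} = {map \<sigma> as |\<sigma>. \<sigma> \<in> Gal}"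
proof (intro equalityI subsetI)
  fix c assume "c \<in> {map \<tau> as |\<tau>. \<tau> \<in> Auts A}"
  then obtain \<tau> where \<tau>: "\<tau> \<in> Auts A" "c = map \<tau> as" by blast
  obtain \<sigma> where "\<sigma> \<in> Gal" "\<forall>xs\<in>lists B. map \<tau> xs = map \<sigma> xs" by (rule Gal_restrict[OF \<tau>(1)])
  then show "c \<in> {map \<sigma> as |\<sigma>. \<sigma> \<in> Gal}" using assms \<tau>(2) by blast
next
  fix c assume "c \<in> {map \<sigma> as |\<sigma>. \<sigma> \<in> Gal}"
  then obtain \<sigma> where \<sigma>: "\<sigma> \<in> Gal" "c = map \<sigma> as" by blast
  obtain \<tau> where "\<tau> \<in> Auts A" "\<forall>xs\<in>lists B. map \<tau> xs = map \<sigma> xs" by (rule Gal_lift[OF \<sigma>(1)])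
  then show "c \<in> {map \<tau> as |\<tau>. \<tau> \<in> Auts A}" using assms \<sigma>(2) by (metis (mono_tags, lifting) mem_Collect_eq)
qed

text \<open>The map \<open>\<pi>\<close> sends \<open>(\<rho>(as), g)\<close> to \<open>\<phi>(\<rho>) g\<close>, the coordinate with respect to the future \<open>B\<close>-point \<open>x\<close> of
  the point \<open>\<rho>(x) g\<close>. It is defined with the parameters \<open>as\<close> and not invariant: by the cocycle law an
  automorphism changes its values by a left translation. But this leaves its kernel \<open>E\<close> invariant,
  so the quotient by \<open>E\<close> is defined over \<open>A\<close>.\<close>

lemma cocycle_represented:
  assumes EI: "eliminates_imaginaries TYPE('a) L T" and M: "models L T M" and \<phi>: "\<phi> \<in> cocycles"
  shows "\<exists>S. represents G S \<phi>"
proof -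
  obtain D h as where as: "as \<in> lists B" and h: "definable_map L M A D h"
    and \<phi>h: "\<forall>\<sigma>\<in>Gal. as @ map \<sigma> as \<in> D \<and> \<phi> \<sigma> = h (as @ map \<sigma> as)"
    using \<phi> unfolding definable_cocycles_def by blast
  define m where "m = length as"
  have as_U: "as \<in> lists U" "set as \<subseteq> U" using as B.params by auto
  define P where "P = {map \<sigma> as |\<sigma>. \<sigma> \<in> Gal}"
  have P_definable: "definable L M A P"
    using A.orbit_definable[OF as_U(1)] unfolding orbit_Gal[OF as] P_def .
  have P_lists: "c \<in> lists B" and P_len: "length c = m" if "c \<in> P" for c
    using that Gal_lists_B[OF _ as] by (auto simp: P_def m_def)
  have P_tup: "P \<subseteq> tup m" using P_lists P_len B.params by (fastforce simp: tuples_def)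
  have as_P: "as \<in> P" unfolding P_def using Gal_id by (intro CollectI exI[where x = id]) simp
  obtain n1 n2 n3 \<mu> where \<mu>: "carrier G \<subseteq> tup n1" "carrier G \<subseteq> tup n2"
    "monoid.mult G \<in> carrier G \<rightarrow> carrier G \<rightarrow> tup n3" "definable L M U \<mu>"
    "\<forall>g h v. length g = n1 \<longrightarrow> length h = n2 \<longrightarrow>
      (g @ h @ v \<in> \<mu> \<longleftrightarrow> g \<in> carrier G \<and> h \<in> carrier G \<and> v = g \<otimes>\<^bsub>G\<^esub> h)"
    by (rule definable_map2E[OF definable_map2_mono[OF A.params mult_definable]])
  define n where "n = length \<one>\<^bsub>G\<^esub>"
  have n12: "n1 = n" "n2 = n"
    using subsetD[OF \<mu>(1) one_closed] subsetD[OF \<mu>(2) one_closed] by (auto simp: tuples_def n_def)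
  have G_tup: "carrier G \<subseteq> tup n" using \<mu>(1) n12 by simp
  define Q where "Q = {w \<in> tup (m + n). take m w \<in> P \<and> drop m w \<in> carrier G}"
  have Q_definable: "definable L M A Q"
    unfolding Q_def by (intro definableI definable_intros P_definable carrier_definable)
  have Q_sub: "Q \<subseteq> tup (m + n)" by (auto simp: Q_def)
  have Q_append: "c @ g \<in> Q" if "c \<in> P" "g \<in> carrier G" for c g
    using that P_tup G_tup P_len by (auto simp: Q_def)
  have Q_cases: "\<exists>\<rho>\<in>Gal. \<exists>g\<in>carrier G. w = map \<rho> as @ g" if w: "w \<in> Q" for w
  proof -
    obtain \<rho> where "\<rho> \<in> Gal" "take m w = map \<rho> as" using w by (auto simp: Q_def P_def)
    moreover have "drop m w \<in> carrier G" using w by (simp add: Q_def)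
    ultimately show ?thesis using append_take_drop_id[of m w] by metis
  qed
  have P_Gal: "map \<rho> as \<in> P" if "\<rho> \<in> Gal" for \<rho> using that by (auto simp: P_def)
  define \<pi> where "\<pi> = (\<lambda>w. h (as @ take m w) \<otimes>\<^bsub>G\<^esub> drop m w)"
  have \<pi>: "\<pi> (map \<rho> as @ g) = \<phi> \<rho> \<otimes>\<^bsub>G\<^esub> g" if "\<rho> \<in> Gal" for \<rho> g
    using \<phi>h that P_len[OF P_Gal[OF that]] by (simp add: \<pi>_def)
  have \<phi>_car: "\<phi> \<rho> \<in> carrier G" if "\<rho> \<in> Gal" for \<rho> using cocycle_GB[OF \<phi> that] by blast
  have \<pi>_closed: "\<pi> w \<in> carrier G" if "w \<in> Q" for w
    using Q_cases[OF that] \<pi> \<phi>_car by auto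
  have \<pi>_Auts: "map \<tau> w \<in> Q \<and> \<pi> (map \<tau> w) = \<phi> \<sigma> \<otimes>\<^bsub>G\<^esub> map \<tau> (\<pi> w)"
    if w: "w \<in> Q" and \<tau>: "\<tau> \<in> Auts A" and \<sigma>: "\<sigma> \<in> Gal" "\<forall>xs\<in>lists B. map \<tau> xs = map \<sigma> xs" for w \<tau> \<sigma>
  proof -
    obtain \<rho> g where \<rho>: "\<rho> \<in> Gal" and g: "g \<in> carrier G" and w: "w = map \<rho> as @ g"
      using Q_cases[OF w] by blast
    have \<tau>w: "map \<tau> w = map (\<sigma> \<circ> \<rho>) as @ map \<tau> g"
      using Auts_restrict_comp[OF \<tau> \<sigma> \<rho> as] w by simp
    have g': "map \<tau> g \<in> carrier G" using Auts_carrier[OF \<tau>] g by simp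
    have "\<pi> (map \<tau> w) = \<phi> (\<sigma> \<circ> \<rho>) \<otimes>\<^bsub>G\<^esub> map \<tau> g" unfolding \<tau>w by (rule \<pi>[OF Gal_comp[OF \<sigma>(1) \<rho>]])
    also have "\<dots> = \<phi> \<sigma> \<otimes>\<^bsub>G\<^esub> map \<tau> (\<phi> \<rho>) \<otimes>\<^bsub>G\<^esub> map \<tau> g"
      using cocycle_comp[OF \<phi> \<sigma>(1) \<rho>] \<sigma>(2) cocycle_GB[OF \<phi> \<rho>] by (metis IntD2)
    also have "\<dots> = \<phi> \<sigma> \<otimes>\<^bsub>G\<^esub> map \<tau> (\<pi> w)"
      using \<pi>[OF \<rho>] w Auts_mult[OF \<tau> \<phi>_car[OF \<rho>] g] g' \<phi>_car[OF \<rho>] \<phi>_car[OF \<sigma>(1)]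
        Auts_carrier[OF \<tau>, of "\<phi> \<rho>"] by (simp add: m_assoc)
    finally show ?thesis
      using Q_append[OF P_Gal[OF Gal_comp[OF \<sigma>(1) \<rho>]] g'] \<tau>w by simp
  qed
  have \<pi>_definable: "definable_map L M U Q \<pi>"
  proof -
    obtain p q \<Gamma> where \<Gamma>: "D \<subseteq> tup p" "h \<in> D \<rightarrow> tup q" "definable L M U \<Gamma>"
      "\<forall>d g. length d = p \<longrightarrow> (d @ g \<in> \<Gamma> \<longleftrightarrow> d \<in> D \<and> g = h d)"
      by (rule definable_mapE[OF definable_map_mono[OF A.params h]])
    have "as @ map id as \<in> D" using \<phi>h Gal_id by blast
    then have p: "p = m + m" using \<Gamma>(1) by (auto simp: tuples_def m_def)
    show ?thesis
    proof (rule definable_mapI[OF Q_sub])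
      show "\<pi> \<in> Q \<rightarrow> tup n" using \<pi>_closed G_tup by blast
      show "definable_pred U (m + n + n) (\<lambda>v. take (m + n) v \<in> Q \<and> (\<exists>u\<in>tup n.
          as @ take m (take (m + n) v) @ u \<in> \<Gamma> \<and> u @ drop m (take (m + n) v) @ drop (m + n) v \<in> \<mu>))"
        by (intro definable_intros coordinate_map_const \<Gamma>(3) \<mu>(4) as_U definable_mono[OF A.params Q_definable])
      fix w z assume "w \<in> tup (m + n)" "z \<in> tup n"
      have "(\<exists>u\<in>tup n. as @ take m w @ u \<in> \<Gamma> \<and> u @ drop m w @ z \<in> \<mu>) \<longleftrightarrow> z = \<pi> w" if w: "w \<in> Q"
      proof -
        obtain \<rho> g where \<rho>: "\<rho> \<in> Gal" and g: "g \<in> carrier G" and w: "w = map \<rho> as @ g"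
          using Q_cases[OF w] by blast
        have td: "take m w = map \<rho> as" "drop m w = g" using w by (simp_all add: m_def)
        have 1: "as @ map \<rho> as @ u \<in> \<Gamma> \<longleftrightarrow> u = \<phi> \<rho>" for u
          using \<Gamma>(4)[rule_format, of "as @ map \<rho> as" u] \<phi>h \<rho> p by (auto simp: m_def)
        have 2: "u @ g @ z \<in> \<mu> \<longleftrightarrow> u \<in> carrier G \<and> z = u \<otimes>\<^bsub>G\<^esub> g" if "u \<in> tup n" for u
          using \<mu>(5) n12 that g subsetD[OF G_tup g] by (auto simp: tuples_def)
        have \<phi>\<rho>: "\<phi> \<rho> \<in> tup n" using \<phi>_car[OF \<rho>] G_tup by blast
        have "(\<exists>u\<in>tup n. as @ map \<rho> as @ u \<in> \<Gamma> \<and> u @ g @ z \<in> \<mu>) \<longleftrightarrow> z = \<phi> \<rho> \<otimes>\<^bsub>G\<^esub> g"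
          by (simp add: 1 2[OF \<phi>\<rho>] \<phi>\<rho> \<phi>_car[OF \<rho>])
        then show ?thesis unfolding td using \<pi>[OF \<rho>] w by simp
      qed
      then show "w \<in> Q \<and> (\<exists>u\<in>tup n. as @ take m w @ u \<in> \<Gamma> \<and> u @ drop m w @ z \<in> \<mu>) \<longleftrightarrow> w \<in> Q \<and> z = \<pi> w"
        by blast
    qed
  qed
  define E where "E = {(v, w). v \<in> Q \<and> w \<in> Q \<and> \<pi> v = \<pi> w}"
  have E_equiv: "equiv Q E"
    by (intro equivI refl_onI symI transI) (auto simp: E_def)
  have E_definable: "definable L M A {v @ w |v w. (v, w) \<in> E}"
  proof (rule A.invariant_definable)
    obtain q n' \<Gamma> where \<Gamma>: "Q \<subseteq> tup q" "\<pi> \<in> Q \<rightarrow> tup n'" "definable L M U \<Gamma>"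
      "\<forall>w g. length w = q \<longrightarrow> (w @ g \<in> \<Gamma> \<longleftrightarrow> w \<in> Q \<and> g = \<pi> w)"
      using \<pi>_definable by (rule definable_mapE)
    have q: "q = m + n"
      using Q_append[OF as_P one_closed] \<Gamma>(1) by (auto simp: tuples_def m_def n_def)
    have \<Gamma>_iff: "w @ t \<in> \<Gamma> \<longleftrightarrow> w \<in> Q \<and> t = \<pi> w" if "w \<in> tup (m + n)" for w t
      using \<Gamma>(4) that q by (simp add: tuples_def)
    have "{v @ w |v w. (v, w) \<in> E} = {z \<in> tup ((m + n) + (m + n)).
        \<exists>t\<in>tup n. take (m + n) z @ t \<in> \<Gamma> \<and> drop (m + n) z @ t \<in> \<Gamma>}" (is "?l = ?r")
    proof (intro equalityI subsetI)
      fix z assume "z \<in> ?l"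
      then obtain v w where vw: "z = v @ w" "v \<in> Q" "w \<in> Q" "\<pi> v = \<pi> w" by (auto simp: E_def)
      then have tup: "v \<in> tup (m + n)" "w \<in> tup (m + n)" using Q_sub by blast+
      then have "length v = m + n" by (simp add: tuples_def)
      moreover have "v @ \<pi> v \<in> \<Gamma>" "w @ \<pi> v \<in> \<Gamma>" using \<Gamma>_iff tup vw by auto
      moreover have "\<pi> v \<in> tup n" using \<pi>_closed vw G_tup by blast
      ultimately show "z \<in> ?r" using tup vw(1) by auto
    next
      fix z assume z: "z \<in> ?r"
      then have "take (m + n) z \<in> tup (m + n)" "drop (m + n) z \<in> tup (m + n)"
        using tuples_take_drop[of z U "m + n" "m + n"] by auto
      then have "(take (m + n) z, drop (m + n) z) \<in> E" using z \<Gamma>_iff unfolding E_def by auto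
      then show "z \<in> ?l" using append_take_drop_id[of "m + n" z] by (metis (mono_tags, lifting) mem_Collect_eq)
    qed
    moreover have "definable L M U ?r" by (intro definableI definable_intros \<Gamma>(3))
    ultimately show "definable L M U ?l" by simp
    fix \<tau> z assume \<tau>: "\<tau> \<in> Auts A" and "z \<in> ?l"
    then obtain v w where vw: "z = v @ w" "v \<in> Q" "w \<in> Q" "\<pi> v = \<pi> w" by (auto simp: E_def)
    obtain \<sigma> where \<sigma>: "\<sigma> \<in> Gal" "\<forall>xs\<in>lists B. map \<tau> xs = map \<sigma> xs" by (rule Gal_restrict[OF \<tau>])
    have "(map \<tau> v, map \<tau> w) \<in> E"
      using \<pi>_Auts[OF vw(2) \<tau> \<sigma>] \<pi>_Auts[OF vw(3) \<tau> \<sigma>] vw(4) by (simp add: E_def)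
    then show "map \<tau> z \<in> ?l" using vw(1) by (metis (mono_tags, lifting) map_append mem_Collect_eq)
  qed
  obtain k F where F: "definable_map L M A Q F" "F \<in> Q \<rightarrow> tup k"
    "\<forall>v\<in>Q. \<forall>w\<in>Q. F v = F w \<longleftrightarrow> (v, w) \<in> E"
    by (rule definable_quotient[OF EI M A.params Q_definable Q_sub _ E_equiv E_definable])
      (use Q_append[OF as_P one_closed] in blast)
  have F_eq: "F v = F w \<longleftrightarrow> \<pi> v = \<pi> w" if "v \<in> Q" "w \<in> Q" for v w
    using F(3) that by (simp add: E_def)
  \<comment> \<open>Every class contains exactly one pair with first component \<open>as\<close>, since \<open>\<phi>\<close> is trivial at \<open>id\<close>.\<close>
  define e where "e = (\<lambda>g. F (as @ g))"
  have as_Q: "as @ g \<in> Q" and \<pi>_as: "\<pi> (as @ g) = g" if "g \<in> carrier G" for g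
    using Q_append[OF as_P that] \<pi>[OF Gal_id, of g] cocycle_id[OF \<phi>] that by simp_all
  have F_e: "F w = e (\<pi> w)" if "w \<in> Q" for w
    unfolding e_def using F_eq[OF that as_Q] \<pi>_as \<pi>_closed[OF that] by simp
  have inj: "inj_on e (carrier G)"
    unfolding inj_on_def e_def using F_eq as_Q \<pi>_as by metis
  define act where "act = (\<lambda>x h. e (inv_into (carrier G) e x \<otimes>\<^bsub>G\<^esub> h))"
  have "represents G (e ` carrier G, act) \<phi>"
  proof (rule twisted_form_represents[OF \<phi> _ inj])
    show e_tup: "e \<in> carrier G \<rightarrow> tup k" using F(2) as_Q by (auto simp: e_def)
    show "act (e g) h = e (g \<otimes>\<^bsub>G\<^esub> h)" if "g \<in> carrier G" "h \<in> carrier G" for g h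
      using inj that by (simp add: act_def)
    show "map \<tau> (e g) = e (\<phi> \<sigma> \<otimes>\<^bsub>G\<^esub> map \<tau> g)"
      if \<tau>: "\<tau> \<in> Auts A" "\<sigma> \<in> Gal" "\<forall>xs\<in>lists B. map \<tau> xs = map \<sigma> xs" and g: "g \<in> carrier G" for \<tau> \<sigma> g
    proof -
      have "map \<tau> (e g) = F (map \<tau> (as @ g))"
        unfolding e_def using definable_map_equivariant(2)[OF F(1) A.params \<tau>(1) as_Q[OF g]] .
      then show ?thesis using F_e \<pi>_Auts[OF as_Q[OF g] \<tau>] \<pi>_as[OF g] by simp
    qed
    obtain q k' \<Gamma> where \<Gamma>: "Q \<subseteq> tup q" "F \<in> Q \<rightarrow> tup k'" "definable L M U \<Gamma>"
      "\<forall>w x. length w = q \<longrightarrow> (w @ x \<in> \<Gamma> \<longleftrightarrow> w \<in> Q \<and> x = F w)"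
      by (rule definable_mapE[OF definable_map_mono[OF A.params F(1)]])
    have q: "q = m + n"
      using as_Q[OF one_closed] \<Gamma>(1) by (auto simp: tuples_def m_def n_def)
    show "definable_map L M U (carrier G) e"
    proof (rule definable_mapI[OF G_tup e_tup])
      show "definable_pred U (n + k) (\<lambda>v. take n v \<in> carrier G \<and> as @ take n v @ drop n v \<in> \<Gamma>)"
        by (intro definable_intros coordinate_map_const \<Gamma>(3) as_U definable_mono[OF A.params carrier_definable])
      fix g x assume "g \<in> tup n"
      then show "g \<in> carrier G \<and> as @ g @ x \<in> \<Gamma> \<longleftrightarrow> g \<in> carrier G \<and> x = e g"
        using \<Gamma>(4)[rule_format, of "as @ g" x] q as_Q[of g] by (auto simp: e_def m_def tuples_def)
    qed
  qed
  then show ?thesis by blast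
qed

end

section \<open>Functoriality\<close>

locale galois_group_hom = normal_ext L M A B +
  G: galois_group L M A B G + H: galois_group L M A B H
  for L :: "('f, 'r) language" and M :: "('f, 'r, 'a) struct" and A B :: "'a set"
    and G H :: "'a list monoid" +
  fixes f :: "'a list \<Rightarrow> 'a list"
  assumes f_definable_hom: "f \<in> definable_homs L M A G H"
begin

sublocale group_hom G H f
  using f_definable_hom by unfold_locales (simp add: definable_homs_def)

lemma f_definable: "definable_map L M A (carrier G) f"
  using f_definable_hom by (simp add: definable_homs_def)

lemma Auts_f: "\<tau> \<in> Auts A \<Longrightarrow> g \<in> carrier G \<Longrightarrow> map \<tau> (f g) = f (map \<tau> g)"
  using definable_map_equivariant(2)[OF f_definable A.params] .

lemma f_GB: "g \<in> G.GB \<Longrightarrow> f g \<in> H.GB"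
  using definable_map_in_B[OF f_definable] by auto

lemma Gal_f:
  assumes "\<sigma> \<in> Gal" "g \<in> G.GB"
  shows "map \<sigma> (f g) = f (map \<sigma> g)"
proof -
  obtain \<tau> where "\<tau> \<in> Auts A" "\<forall>xs\<in>lists B. map \<tau> xs = map \<sigma> xs" by (rule Gal_lift[OF assms(1)])
  then show ?thesis using Auts_f[of \<tau> g] assms(2) f_GB[OF assms(2)] by (metis IntD1 IntD2)
qed

definition push :: "(('a \<Rightarrow> 'a) \<Rightarrow> 'a list) \<Rightarrow> ('a \<Rightarrow> 'a) \<Rightarrow> 'a list" where
  "push \<phi> = (\<lambda>\<sigma>\<in>Gal. f (\<phi> \<sigma>))"

lemma push_cocycle:
  assumes \<phi>: "\<phi> \<in> G.cocycles"
  shows "push \<phi> \<in> H.cocycles"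
proof -
  obtain D h as where as: "as \<in> lists B" and h: "definable_map L M A D h"
    and \<phi>h: "\<forall>\<sigma>\<in>Gal. as @ map \<sigma> as \<in> D \<and> \<phi> \<sigma> = h (as @ map \<sigma> as)"
    using \<phi> unfolding definable_cocycles_def by blast
  have closed: "push \<phi> \<sigma> \<in> H.GB" if "\<sigma> \<in> Gal" for \<sigma>
    using f_GB[OF G.cocycle_GB[OF \<phi> that]] that by (simp add: push_def)
  have comp: "push \<phi> (\<sigma> \<circ> \<tau>) = push \<phi> \<sigma> \<otimes>\<^bsub>H\<^esub> map \<sigma> (push \<phi> \<tau>)" if "\<sigma> \<in> Gal" "\<tau> \<in> Gal" for \<sigma> \<tau>
    using G.cocycle_comp[OF \<phi> that] Gal_comp[OF that] that G.cocycle_GB[OF \<phi> that(1)]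
      G.cocycle_GB[OF \<phi> that(2)] G.Gal_GB(1)[OF that(1) G.cocycle_GB[OF \<phi> that(2)]]
      Gal_f[OF that(1) G.cocycle_GB[OF \<phi> that(2)]]
    by (simp add: push_def)
  \<comment> \<open>The function witnessing definability may leave the group on part of its domain.\<close>
  define D' where "D' = {d \<in> D. h d \<in> carrier G}"
  have "definable_map L M A D' (\<lambda>d. f (h d))"
  proof -
    obtain p q \<Gamma> where \<Gamma>: "D \<subseteq> tup p" "h \<in> D \<rightarrow> tup q" "definable L M A \<Gamma>"
      "\<forall>d g. length d = p \<longrightarrow> (d @ g \<in> \<Gamma> \<longleftrightarrow> d \<in> D \<and> g = h d)"
      using h by (rule definable_mapE)
    obtain n k \<Delta> where \<Delta>: "carrier G \<subseteq> tup n" "f \<in> carrier G \<rightarrow> tup k" "definable L M A \<Delta>"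
      "\<forall>g z. length g = n \<longrightarrow> (g @ z \<in> \<Delta> \<longleftrightarrow> g \<in> carrier G \<and> z = f g)"
      using f_definable by (rule definable_mapE)
    show ?thesis
    proof (rule definable_mapI)
      show "D' \<subseteq> tup p" using \<Gamma>(1) by (auto simp: D'_def)
      show "(\<lambda>d. f (h d)) \<in> D' \<rightarrow> tup k" using \<Delta>(2) by (auto simp: D'_def)
      show "definable_pred A (p + k) (\<lambda>w. \<exists>g\<in>tup n. take p w @ g \<in> \<Gamma> \<and> g @ drop p w \<in> \<Delta>)"
        by (intro definable_intros \<Gamma>(3) \<Delta>(3))
      fix d z assume d: "d \<in> tup p"
      have 1: "d @ g \<in> \<Gamma> \<longleftrightarrow> g = h d \<and> d \<in> D" for g
        using \<Gamma>(4) d by (auto simp: tuples_def)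
      have 2: "g @ z \<in> \<Delta> \<longleftrightarrow> g \<in> carrier G \<and> z = f g" if "g \<in> tup n" for g
        using \<Delta>(4) that by (auto simp: tuples_def)
      show "(\<exists>g\<in>tup n. d @ g \<in> \<Gamma> \<and> g @ z \<in> \<Delta>) \<longleftrightarrow> d \<in> D' \<and> z = f (h d)"
      proof
        assume "\<exists>g\<in>tup n. d @ g \<in> \<Gamma> \<and> g @ z \<in> \<Delta>"
        then show "d \<in> D' \<and> z = f (h d)" using 1 2 by (auto simp: D'_def)
      next
        assume *: "d \<in> D' \<and> z = f (h d)"
        then have "h d \<in> tup n" using \<Delta>(1) by (auto simp: D'_def)
        then show "\<exists>g\<in>tup n. d @ g \<in> \<Gamma> \<and> g @ z \<in> \<Delta>"
          using * 1[of "h d"] 2[of "h d"] by (intro bexI[where x = "h d"]) (auto simp: D'_def)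
      qed
    qed
  qed
  moreover have "\<forall>\<sigma>\<in>Gal. as @ map \<sigma> as \<in> D' \<and> push \<phi> \<sigma> = f (h (as @ map \<sigma> as))"
    using \<phi>h G.cocycle_GB[OF \<phi>] by (auto simp: D'_def push_def)
  moreover have "push \<phi> \<in> Gal \<rightarrow>\<^sub>E H.GB"
    using closed by (intro PiE_I) (simp_all add: push_def)
  ultimately show ?thesis
    unfolding definable_cocycles_def mem_Collect_eq using comp as
    by (intro conjI ballI exI bexI[where x = as]) (assumption | simp)+
qed

lemma push_cohomologous:
  assumes "(\<phi>, \<psi>) \<in> cohomologous L M B A G"
  shows "(push \<phi>, push \<psi>) \<in> cohomologous L M B A H"
proof -
  obtain b where coc: "\<phi> \<in> G.cocycles" "\<psi> \<in> G.cocycles" and b: "b \<in> G.GB"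
    and eq: "\<forall>\<sigma>\<in>Gal. b \<otimes>\<^bsub>G\<^esub> \<phi> \<sigma> = \<psi> \<sigma> \<otimes>\<^bsub>G\<^esub> map \<sigma> b"
    using assms unfolding G.cohomologous_iff by blast
  have "f b \<otimes>\<^bsub>H\<^esub> push \<phi> \<sigma> = push \<psi> \<sigma> \<otimes>\<^bsub>H\<^esub> map \<sigma> (f b)" if \<sigma>: "\<sigma> \<in> Gal" for \<sigma>
  proof -
    have "f (b \<otimes>\<^bsub>G\<^esub> \<phi> \<sigma>) = f (\<psi> \<sigma> \<otimes>\<^bsub>G\<^esub> map \<sigma> b)" using eq \<sigma> by simp
    then show ?thesis
      using b G.cocycle_GB[OF coc(1) \<sigma>] G.cocycle_GB[OF coc(2) \<sigma>] G.Gal_GB(1)[OF \<sigma> b] Gal_f[OF \<sigma> b] \<sigma>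
      by (simp add: push_def)
  qed
  then show ?thesis
    unfolding H.cohomologous_iff using push_cocycle coc f_GB[OF b] by blast
qed

text \<open>The map \<open>g' \<mapsto> q x g'\<close> is a bijection from the group \<open>H\<close> to the contracted product. Since
  \<open>q (x a) g' = q x (f(a) g')\<close>, the twist by \<open>\<phi>\<close> becomes the twist by \<open>f \<circ> \<phi>\<close>.\<close>

lemma contracted_product_represents:
  assumes \<phi>: "represents G S \<phi>" and S': "contracted_product L M A G H f S S'"
  shows "represents H S' (push \<phi>)"
proof -
  obtain X act Z act' where S: "S = (X, act)" "S' = (Z, act')" by (cases S, cases S')
  interpret X: torsor L M A B G X act
    using \<phi> S G.pointed_phs_torsor by (simp add: represents_def)
  have coc: "\<phi> \<in> G.cocycles" using \<phi> by (simp add: represents_def)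
  obtain x where x: "x \<in> X \<inter> lists B" "\<forall>\<sigma>\<in>Gal. act x (\<phi> \<sigma>) = map \<sigma> x"
    using \<phi> S by (auto simp: represents_def)
  obtain q where q: "definable_map2 L M A X (carrier H) q"
    and Z: "Z = {q x g' |x g'. x \<in> X \<and> g' \<in> carrier H}"
    and ker: "\<forall>x\<in>X. \<forall>y\<in>X. \<forall>g'\<in>carrier H. \<forall>h'\<in>carrier H.
        q x g' = q y h' \<longleftrightarrow> (\<exists>g\<in>carrier G. x = act y g \<and> h' = f g \<otimes>\<^bsub>H\<^esub> g')"
    and act': "\<forall>x\<in>X. \<forall>g'\<in>carrier H. \<forall>h'\<in>carrier H. act' (q x g') h' = q x (g' \<otimes>\<^bsub>H\<^esub> h')"
    using S' unfolding S contracted_product_def prod.case by blast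
  have xX: "x \<in> X" using x by blast
  have q_act: "q (act x a) g' = q x (f a \<otimes>\<^bsub>H\<^esub> g')" if "a \<in> carrier G" "g' \<in> carrier H" for a g'
  proof -
    have "\<exists>g\<in>carrier G. act x a = act x g \<and> f a \<otimes>\<^bsub>H\<^esub> g' = f g \<otimes>\<^bsub>H\<^esub> g'" using that(1) by blast
    then show ?thesis
      using ker[rule_format, of "act x a" x g' "f a \<otimes>\<^bsub>H\<^esub> g'"] that xX X.act_closed[OF xX that(1)]
      by simp
  qed
  obtain m n k \<Gamma> where \<Gamma>: "X \<subseteq> tup m" "carrier H \<subseteq> tup n" "q \<in> X \<rightarrow> carrier H \<rightarrow> tup k"
    "definable L M U \<Gamma>" "\<forall>x g z. length x = m \<longrightarrow> length g = n \<longrightarrow>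
      (x @ g @ z \<in> \<Gamma> \<longleftrightarrow> x \<in> X \<and> g \<in> carrier H \<and> z = q x g)"
    by (rule definable_map2E[OF definable_map2_mono[OF A.params q]])
  have "Z = q x ` carrier H"
  proof
    show "Z \<subseteq> q x ` carrier H"
    proof
      fix z assume "z \<in> Z"
      then obtain y g' where *: "y \<in> X" "g' \<in> carrier H" "z = q y g'" using Z by blast
      define a where "a = X.diff x y"
      have a: "a \<in> carrier G" "y = act x a"
        using X.diff_closed X.act_diff xX *(1) by (simp_all add: a_def)
      then have "z = q x (f a \<otimes>\<^bsub>H\<^esub> g')" using q_act[OF a(1) *(2)] *(3) by simp
      then show "z \<in> q x ` carrier H" using a(1) *(2) by simp
    qed
    show "q x ` carrier H \<subseteq> Z" using Z xX by blast
  qed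
  moreover have "represents H (q x ` carrier H, act') (push \<phi>)"
  proof (rule H.twisted_form_represents[OF push_cocycle[OF coc]])
    show e_tup: "q x \<in> carrier H \<rightarrow> tup k" using \<Gamma>(3) xX by blast
    show "inj_on (q x) (carrier H)"
    proof (rule inj_onI)
      fix g h assume gh: "g \<in> carrier H" "h \<in> carrier H" "q x g = q x h"
      then obtain a where a: "a \<in> carrier G" "x = act x a" "h = f a \<otimes>\<^bsub>H\<^esub> g"
        using ker xX by blast
      then have "a = \<one>\<^bsub>G\<^esub>" using X.act_cancel[OF xX a(1) G.one_closed] X.act_one[OF xX] by simp
      then show "g = h" using a(3) gh(1) by simp
    qed
    show "definable_map L M U (carrier H) (q x)"
    proof (rule definable_mapI[OF \<Gamma>(2) e_tup])
      show "definable_pred U (n + k) (\<lambda>w. x @ take n w @ drop n w \<in> \<Gamma>)"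
        by (intro definable_intros coordinate_map_const \<Gamma>(4)) (use X.X_lists[OF xX] in auto)
      fix g z assume "g \<in> tup n"
      then show "x @ g @ z \<in> \<Gamma> \<longleftrightarrow> g \<in> carrier H \<and> z = q x g"
        using \<Gamma>(1,5) xX by (auto simp: tuples_def)
    qed
    show "act' (q x g) h = q x (g \<otimes>\<^bsub>H\<^esub> h)" if "g \<in> carrier H" "h \<in> carrier H" for g h
      using act' xX that by blast
    fix \<tau> \<sigma> g assume \<tau>: "\<tau> \<in> Auts A" "\<sigma> \<in> Gal" "\<forall>xs\<in>lists B. map \<tau> xs = map \<sigma> xs" and g: "g \<in> carrier H"
    have "map \<tau> (q x g) = q (map \<tau> x) (map \<tau> g)"
      by (rule definable_map2_equivariant(3)[OF q A.params \<tau>(1) xX g])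
    also have "map \<tau> x = act x (\<phi> \<sigma>)" using \<tau> x by (metis IntD2)
    finally show "map \<tau> (q x g) = q x (push \<phi> \<sigma> \<otimes>\<^bsub>H\<^esub> map \<tau> g)"
      using q_act[of "\<phi> \<sigma>" "map \<tau> g"] G.cocycle_GB[OF coc \<tau>(2)] H.Auts_carrier[OF \<tau>(1)] g \<tau>(2)
      by (simp add: push_def)
  qed
  ultimately show ?thesis using S by simp
qed

text \<open>A torsor \<open>Z\<close> with a point \<open>z\<close> whose cocycle is \<open>f \<circ> \<phi>\<close> already exists, and the quotient map
  \<open>(x a, g') \<mapsto> z f(a) g'\<close> is invariant because the twists on both sides match.\<close>

lemma contracted_product_exists:
  assumes EI: "eliminates_imaginaries TYPE('a) L T" and M: "models L T M"
    and \<phi>: "represents G S \<phi>"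
  shows "\<exists>S'. contracted_product L M A G H f S S'"
proof -
  obtain X act where S: "S = (X, act)" by (cases S)
  interpret X: torsor L M A B G X act
    using \<phi> S G.pointed_phs_torsor by (simp add: represents_def)
  have coc: "\<phi> \<in> G.cocycles" using \<phi> by (simp add: represents_def)
  obtain x where x: "x \<in> X \<inter> lists B" "\<forall>\<sigma>\<in>Gal. act x (\<phi> \<sigma>) = map \<sigma> x"
    using \<phi> S by (auto simp: represents_def)
  obtain Z act' where Z: "represents H (Z, act') (push \<phi>)"
    using H.cocycle_represented[OF EI M push_cocycle[OF coc]] by (metis surj_pair)
  interpret Z: torsor L M A B H Z act'
    using Z H.pointed_phs_torsor by (simp add: represents_def)
  obtain z where z: "z \<in> Z \<inter> lists B" "\<forall>\<sigma>\<in>Gal. act' z (push \<phi> \<sigma>) = map \<sigma> z"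
    using Z by (auto simp: represents_def)
  have xX: "x \<in> X" and zZ: "z \<in> Z" using x z by auto
  define q where "q = (\<lambda>y g'. act' z (f (X.diff x y) \<otimes>\<^bsub>H\<^esub> g'))"
  have q: "q (act x a) g' = act' z (f a \<otimes>\<^bsub>H\<^esub> g')" if "a \<in> carrier G" for a g'
    using X.diff_act[OF xX that] by (simp add: q_def)
  have X_cases: "\<exists>a\<in>carrier G. y = act x a" if "y \<in> X" for y
    using X.diff_closed[OF xX that] X.act_diff[OF xX that] by metis
  have q_closed: "q y g' \<in> Z" if "y \<in> X" "g' \<in> carrier H" for y g'
    using X.diff_closed[OF xX that(1)] that(2) Z.act_closed[OF zZ] by (simp add: q_def)
  have "definable_map2 L M A X (carrier H) q"
  proof (rule A.invariant_definable_map2)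
    obtain m n k \<Gamma> where \<Gamma>: "X \<subseteq> tup m" "carrier G \<subseteq> tup n" "act \<in> X \<rightarrow> carrier G \<rightarrow> tup k"
      "definable L M U \<Gamma>" "\<forall>x g y. length x = m \<longrightarrow> length g = n \<longrightarrow>
        (x @ g @ y \<in> \<Gamma> \<longleftrightarrow> x \<in> X \<and> g \<in> carrier G \<and> y = act x g)"
      by (rule definable_map2E[OF definable_map2_mono[OF A.params X.act_definable]])
    obtain m' n' k' \<Gamma>' where \<Gamma>': "Z \<subseteq> tup m'" "carrier H \<subseteq> tup n'" "act' \<in> Z \<rightarrow> carrier H \<rightarrow> tup k'"
      "definable L M U \<Gamma>'" "\<forall>x g y. length x = m' \<longrightarrow> length g = n' \<longrightarrow>
        (x @ g @ y \<in> \<Gamma>' \<longleftrightarrow> x \<in> Z \<and> g \<in> carrier H \<and> y = act' x g)"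
      by (rule definable_map2E[OF definable_map2_mono[OF A.params Z.act_definable]])
    obtain n1 k1 \<Delta> where \<Delta>: "carrier G \<subseteq> tup n1" "f \<in> carrier G \<rightarrow> tup k1" "definable L M U \<Delta>"
      "\<forall>g u. length g = n1 \<longrightarrow> (g @ u \<in> \<Delta> \<longleftrightarrow> g \<in> carrier G \<and> u = f g)"
      by (rule definable_mapE[OF definable_map_mono[OF A.params f_definable]])
    obtain a1 a2 a3 \<mu> where \<mu>: "carrier H \<subseteq> tup a1" "carrier H \<subseteq> tup a2"
      "monoid.mult H \<in> carrier H \<rightarrow> carrier H \<rightarrow> tup a3" "definable L M U \<mu>"
      "\<forall>g h v. length g = a1 \<longrightarrow> length h = a2 \<longrightarrow>
        (g @ h @ v \<in> \<mu> \<longleftrightarrow> g \<in> carrier H \<and> h \<in> carrier H \<and> v = g \<otimes>\<^bsub>H\<^esub> h)"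
      by (rule definable_map2E[OF definable_map2_mono[OF A.params H.mult_definable]])
    have eqs: "n1 = n" "a1 = n'" "a2 = n'"
      using subsetD[OF \<Gamma>(2) G.one_closed] subsetD[OF \<Delta>(1) G.one_closed]
        subsetD[OF \<Gamma>'(2) H.one_closed] subsetD[OF \<mu>(1) H.one_closed] subsetD[OF \<mu>(2) H.one_closed]
      by (simp_all add: tuples_def)
    show "definable_map2 L M U X (carrier H) q"
    proof (rule definable_map2I[OF \<Gamma>(1) \<Gamma>'(2)])
      show "q \<in> X \<rightarrow> carrier H \<rightarrow> tup m'" using q_closed \<Gamma>'(1) by blast
      show "definable_pred U (m + (n' + m')) (\<lambda>w. \<exists>g\<in>tup n. \<exists>u\<in>tup n'. \<exists>v\<in>tup n'.
          x @ g @ take m w \<in> \<Gamma> \<and> g @ u \<in> \<Delta> \<and> u @ take n' (drop m w) @ v \<in> \<mu> \<and>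
          z @ v @ drop n' (drop m w) \<in> \<Gamma>')"
        by (intro definable_intros coordinate_map_const \<Gamma>(4) \<Gamma>'(4) \<Delta>(3) \<mu>(4))
          (use X.X_lists[OF xX] Z.X_lists[OF zZ] in auto)
      fix y h w assume h: "h \<in> tup n'"
      have len: "length x = m" "length z = m'"
        using subsetD[OF \<Gamma>(1) xX] subsetD[OF \<Gamma>'(1) zZ] by (simp_all add: tuples_def)
      have 1: "x @ g @ y \<in> \<Gamma> \<longleftrightarrow> g \<in> carrier G \<and> y = act x g" if "g \<in> tup n" for g
        using \<Gamma>(5) len that xX by (simp add: tuples_def)
      have 2: "g @ u \<in> \<Delta> \<longleftrightarrow> g \<in> carrier G \<and> u = f g" if "g \<in> tup n" for g u
        using \<Delta>(4) eqs that by (simp add: tuples_def)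
      have 3: "u @ h @ v \<in> \<mu> \<longleftrightarrow> u \<in> carrier H \<and> h \<in> carrier H \<and> v = u \<otimes>\<^bsub>H\<^esub> h" if "u \<in> tup n'" for u v
        using \<mu>(5) eqs that h by (simp add: tuples_def)
      have 4: "z @ v @ w \<in> \<Gamma>' \<longleftrightarrow> v \<in> carrier H \<and> w = act' z v" if "v \<in> tup n'" for v
        using \<Gamma>'(5) len that zZ by (simp add: tuples_def)
      show "(\<exists>g\<in>tup n. \<exists>u\<in>tup n'. \<exists>v\<in>tup n'. x @ g @ y \<in> \<Gamma> \<and> g @ u \<in> \<Delta> \<and> u @ h @ v \<in> \<mu> \<and>
          z @ v @ w \<in> \<Gamma>') \<longleftrightarrow> y \<in> X \<and> h \<in> carrier H \<and> w = q y h" (is "?l \<longleftrightarrow> ?r")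
      proof
        assume ?l
        then obtain g u v where "g \<in> tup n" "u \<in> tup n'" "v \<in> tup n'" "x @ g @ y \<in> \<Gamma>" "g @ u \<in> \<Delta>"
          "u @ h @ v \<in> \<mu>" "z @ v @ w \<in> \<Gamma>'" by blast
        then have "g \<in> carrier G" "y = act x g" "u = f g" "h \<in> carrier H" "v = u \<otimes>\<^bsub>H\<^esub> h" "w = act' z v"
          using 1[of g] 2[of g u] 3[of u v] 4[of v] by simp_all
        then show ?r using q X.act_closed[OF xX] by simp
      next
        assume r: ?r
        then obtain g where g: "g \<in> carrier G" "y = act x g" using X_cases by blast
        let ?u = "f g" and ?v = "f g \<otimes>\<^bsub>H\<^esub> h"
        have car: "?u \<in> carrier H" "?v \<in> carrier H" using g(1) r by simp_all
        then have tup: "g \<in> tup n" "?u \<in> tup n'" "?v \<in> tup n'" using \<Gamma>(2) \<Gamma>'(2) g(1) by blast+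
        have "w = act' z ?v" using r g q by simp
        then have "x @ g @ y \<in> \<Gamma> \<and> g @ ?u \<in> \<Delta> \<and> ?u @ h @ ?v \<in> \<mu> \<and> z @ ?v @ w \<in> \<Gamma>'"
          using 1[OF tup(1)] 2[OF tup(1)] 3[OF tup(2)] 4[OF tup(3)] g car r by simp
        then show ?l using tup by blast
      qed
    qed
    fix \<tau> y h assume \<tau>: "\<tau> \<in> Auts A" and y: "y \<in> X" and h: "h \<in> carrier H"
    obtain \<sigma> where \<sigma>: "\<sigma> \<in> Gal" "\<forall>xs\<in>lists B. map \<tau> xs = map \<sigma> xs" by (rule Gal_restrict[OF \<tau>])
    obtain a where a: "a \<in> carrier G" "y = act x a" using X_cases[OF y] by blast
    have car: "map \<tau> a \<in> carrier G" "map \<tau> h \<in> carrier H" "\<phi> \<sigma> \<in> carrier G"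
      using G.Auts_carrier[OF \<tau>] H.Auts_carrier[OF \<tau>] a h G.cocycle_GB[OF coc \<sigma>(1)] by auto
    have "map \<tau> (q y h) = act' z (push \<phi> \<sigma> \<otimes>\<^bsub>H\<^esub> map \<tau> (f a \<otimes>\<^bsub>H\<^esub> h))"
      using Z.Auts_act_point[OF z(1) push_cocycle[OF coc] z(2) \<tau> \<sigma>, of "f a \<otimes>\<^bsub>H\<^esub> h"] a q h by simp
    also have "\<dots> = act' z (f (\<phi> \<sigma> \<otimes>\<^bsub>G\<^esub> map \<tau> a) \<otimes>\<^bsub>H\<^esub> map \<tau> h)"
      using H.Auts_mult[OF \<tau>, of "f a" h] Auts_f[OF \<tau> a(1)] a h car \<sigma>(1)
      by (simp add: push_def H.m_assoc)
    also have "\<dots> = q (map \<tau> y) (map \<tau> h)"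
      using q[of "\<phi> \<sigma> \<otimes>\<^bsub>G\<^esub> map \<tau> a"] X.Auts_act_point[OF x(1) coc x(2) \<tau> \<sigma> a(1)] a car by simp
    finally show "map \<tau> y \<in> X \<and> map \<tau> h \<in> carrier H \<and> map \<tau> (q y h) = q (map \<tau> y) (map \<tau> h)"
      using X.Auts_X[OF \<tau>] y car by simp
  qed
  moreover have "Z = {q y g' |y g'. y \<in> X \<and> g' \<in> carrier H}"
  proof
    show "Z \<subseteq> {q y g' |y g'. y \<in> X \<and> g' \<in> carrier H}"
    proof
      fix w assume w: "w \<in> Z"
      have "q x (Z.diff z w) = w"
        using q[of "\<one>\<^bsub>G\<^esub>" "Z.diff z w"] X.act_one[OF xX] Z.diff_closed[OF zZ w] Z.act_diff[OF zZ w] by simp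
      then show "w \<in> {q y g' |y g'. y \<in> X \<and> g' \<in> carrier H}"
        unfolding mem_Collect_eq using xX Z.diff_closed[OF zZ w]
        by (intro exI[where x = x] exI[where x = "Z.diff z w"]) simp
    qed
    show "{q y g' |y g'. y \<in> X \<and> g' \<in> carrier H} \<subseteq> Z" using q_closed by blast
  qed
  moreover have "q v g' = q w h' \<longleftrightarrow> (\<exists>g\<in>carrier G. v = act w g \<and> h' = f g \<otimes>\<^bsub>H\<^esub> g')"
    if vw: "v \<in> X" "w \<in> X" and gh: "g' \<in> carrier H" "h' \<in> carrier H" for v w g' h'
  proof -
    obtain a b where a: "a \<in> carrier G" "v = act x a" and b: "b \<in> carrier G" "w = act x b"
      using X_cases vw by blast
    have fc: "f a \<in> carrier H" "f b \<in> carrier H" using a b by simp_all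
    have "q v g' = q w h' \<longleftrightarrow> f a \<otimes>\<^bsub>H\<^esub> g' = f b \<otimes>\<^bsub>H\<^esub> h'"
      using q a b Z.act_cancel[OF zZ, of "f a \<otimes>\<^bsub>H\<^esub> g'" "f b \<otimes>\<^bsub>H\<^esub> h'"] fc gh by auto
    also have "\<dots> \<longleftrightarrow> h' = f (inv\<^bsub>G\<^esub> b \<otimes>\<^bsub>G\<^esub> a) \<otimes>\<^bsub>H\<^esub> g'"
    proof -
      have "f (inv\<^bsub>G\<^esub> b \<otimes>\<^bsub>G\<^esub> a) \<otimes>\<^bsub>H\<^esub> g' = inv\<^bsub>H\<^esub> (f b) \<otimes>\<^bsub>H\<^esub> (f a \<otimes>\<^bsub>H\<^esub> g')"
        using a b fc gh by (simp add: H.m_assoc)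
      then show ?thesis using H.inv_solve_left[of h' "f b" "f a \<otimes>\<^bsub>H\<^esub> g'"] fc gh by simp
    qed
    also have "\<dots> \<longleftrightarrow> (\<exists>g\<in>carrier G. v = act w g \<and> h' = f g \<otimes>\<^bsub>H\<^esub> g')"
    proof -
      have "v = act w g \<longleftrightarrow> g = inv\<^bsub>G\<^esub> b \<otimes>\<^bsub>G\<^esub> a" if g: "g \<in> carrier G" for g
      proof -
        have "v = act w g \<longleftrightarrow> a = b \<otimes>\<^bsub>G\<^esub> g"
          using X.act_mult[OF xX b(1) g] X.act_cancel[OF xX a(1), of "b \<otimes>\<^bsub>G\<^esub> g"] a b g by auto
        then show ?thesis using G.inv_solve_left[of g b a] a b g by auto
      qed
      then show ?thesis using a(1) b(1) by auto
    qed
    finally show ?thesis .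
  qed
  moreover have "act' (q y g') h' = q y (g' \<otimes>\<^bsub>H\<^esub> h')"
    if y: "y \<in> X" and gh: "g' \<in> carrier H" "h' \<in> carrier H" for y g' h'
    using Z.act_mult[OF zZ, of "f (X.diff x y) \<otimes>\<^bsub>H\<^esub> g'" h'] X.diff_closed[OF xX y] gh
    by (simp add: q_def H.m_assoc)
  ultimately have "contracted_product L M A G H f (X, act) (Z, act')"
    unfolding contracted_product_def prod.case by blast
  then show ?thesis using S by blast
qed

end

section \<open>The correspondence of classes\<close>

text \<open>A relation that is total on both sides and matches two equivalence relations induces a bijection of
  the quotients. It is enough that one of the relations is known to be an equivalence, since the
  other one is its preimage.\<close>

locale class_correspondence =
  fixes X :: "'x set" and r :: "('x \<times> 'x) set" and Y :: "'y set" and s :: "('y \<times> 'y) set"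
    and R :: "'x \<Rightarrow> 'y \<Rightarrow> bool"
  assumes r_sub: "r \<subseteq> X \<times> X" and equiv_s: "equiv Y s"
    and dom: "R x y \<Longrightarrow> x \<in> X \<and> y \<in> Y"
    and total: "x \<in> X \<Longrightarrow> \<exists>y. R x y"
    and onto: "y \<in> Y \<Longrightarrow> \<exists>x. R x y"
    and respects: "R x y \<Longrightarrow> R x' y' \<Longrightarrow> (x, x') \<in> r \<longleftrightarrow> (y, y') \<in> s"
begin

definition class_map :: "'x set \<Rightarrow> 'y set" where
  "class_map p = {y. \<exists>x\<in>p. R x y}"

lemma equiv_r: "equiv X r"
proof (intro equivI refl_onI symI transI r_sub)
  show "(x, x) \<in> r" if "x \<in> X" for x
    using total[OF that] respects dom equiv_s by (meson equiv_def refl_onD)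
  show "(y, x) \<in> r" if xy: "(x, y) \<in> r" for x y
  proof -
    have "x \<in> X" "y \<in> X" using xy r_sub by auto
    then obtain x' y' where R: "R x x'" "R y y'" using total by meson
    then have "(y', x') \<in> s" using xy respects[OF R] equiv_s by (auto simp: equiv_def dest: symD)
    then show ?thesis using respects[OF R(2,1)] by blast
  qed
  show "(x, z) \<in> r" if xyz: "(x, y) \<in> r" "(y, z) \<in> r" for x y z
  proof -
    have "x \<in> X" "y \<in> X" "z \<in> X" using xyz r_sub by auto
    then obtain x' y' z' where R: "R x x'" "R y y'" "R z z'" using total by meson
    then have "(x', z') \<in> s"
      using xyz respects[OF R(1,2)] respects[OF R(2,3)] equiv_s by (auto simp: equiv_def dest: transD)
    then show ?thesis using respects[OF R(1,3)] by blast
  qed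
qed

lemma class_map_class:
  assumes "R x y"
  shows "class_map (r `` {x}) = s `` {y}"
proof (intro equalityI subsetI)
  fix y' assume "y' \<in> class_map (r `` {x})"
  then obtain x' where "(x, x') \<in> r" "R x' y'" by (auto simp: class_map_def)
  then show "y' \<in> s `` {y}" using respects assms by blast
next
  fix y' assume y': "y' \<in> s `` {y}"
  then have "y' \<in> Y" using equiv_s by (auto simp: equiv_def)
  then obtain x' where "R x' y'" using onto by blast
  then show "y' \<in> class_map (r `` {x})" using respects assms y' by (auto simp: class_map_def)
qed

lemma class_map_bij: "bij_betw class_map (X // r) (Y // s)"
  unfolding bij_betw_def
proof
  show "inj_on class_map (X // r)"
  proof (rule inj_onI)
    fix p p' assume p: "p \<in> X // r" "p' \<in> X // r" and eq: "class_map p = class_map p'"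
    obtain x x' where x: "x \<in> X" "p = r `` {x}" "x' \<in> X" "p' = r `` {x'}"
      using p by (auto elim!: quotientE)
    obtain y y' where y: "R x y" "R x' y'" using total x by blast
    then have "s `` {y} = s `` {y'}" using eq x class_map_class by metis
    then have "(y, y') \<in> s" using eq_equiv_class[OF _ equiv_s] dom[OF y(2)] by blast
    then have "(x, x') \<in> r" using respects y by blast
    then show "p = p'" using x equiv_class_eq[OF equiv_r] by blast
  qed
  show "class_map ` (X // r) = Y // s"
  proof
    show "class_map ` (X // r) \<subseteq> Y // s"
    proof
      fix c assume "c \<in> class_map ` (X // r)"
      then obtain x where x: "x \<in> X" "c = class_map (r `` {x})" by (auto elim!: quotientE)
      then obtain y where "R x y" using total by blast
      then show "c \<in> Y // s" using x class_map_class dom by (auto intro: quotientI)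
    qed
    show "Y // s \<subseteq> class_map ` (X // r)"
    proof
      fix c assume "c \<in> Y // s"
      then obtain y where y: "y \<in> Y" "c = s `` {y}" by (auto elim!: quotientE)
      then obtain x where "R x y" using onto by blast
      then show "c \<in> class_map ` (X // r)"
        using y class_map_class dom by (auto intro!: image_eqI[where x = "r `` {x}"] quotientI)
    qed
  qed
qed

end

lemma Image_within_class:
  assumes "equiv X r" "x \<in> Z" "Z \<subseteq> r `` {x}"
  shows "r `` Z = r `` {x}"
  using assms unfolding equiv_def trans_def sym_def by blast

context galois_group
begin

lemma represents_class_correspondence:
  assumes "eliminates_imaginaries TYPE('a) L T" "models L T M"
  shows "class_correspondence (pointed_phs L M B A G) (phs_rel L M B A G)
    cocycles (cohomologous L M B A G) (represents G)"
proof
  show "phs_rel L M B A G \<subseteq> pointed_phs L M B A G \<times> pointed_phs L M B A G"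
    by (auto simp: phs_rel_def)
  show "equiv cocycles (cohomologous L M B A G)" by (rule equiv_cohomologous)
  show "S \<in> pointed_phs L M B A G \<and> \<phi> \<in> cocycles" if "represents G S \<phi>" for S \<phi>
    using that by (simp add: represents_def)
  show "\<exists>\<phi>. represents G S \<phi>" if "S \<in> pointed_phs L M B A G" for S
    by (rule represents_total[OF that])
  show "\<exists>S. represents G S \<phi>" if "\<phi> \<in> cocycles" for \<phi>
    by (rule cocycle_represented[OF assms that])
  show "(S, S') \<in> phs_rel L M B A G \<longleftrightarrow> (\<phi>, \<psi>) \<in> cohomologous L M B A G"
    if "represents G S \<phi>" "represents G S' \<psi>" for S \<phi> S' \<psi>
    by (rule phs_rel_iff[OF that])
qed

text \<open>The unit is a \<open>B\<close>-point of \<open>G\<close> that no automorphism over \<open>A\<close> moves.\<close>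

lemma represents_trivial: "represents G (carrier G, monoid.mult G) (\<lambda>\<sigma>\<in>Gal. \<one>\<^bsub>G\<^esub>)"
proof -
  have "phs L M A G (carrier G, monoid.mult G)"
    unfolding phs_def prod.case
  proof (intro conjI ballI carrier_definable mult_definable)
    show "\<exists>!g. g \<in> carrier G \<and> x \<otimes>\<^bsub>G\<^esub> g = y" if "x \<in> carrier G" "y \<in> carrier G" for x y
      using that by (intro ex1I[where a = "inv\<^bsub>G\<^esub> x \<otimes>\<^bsub>G\<^esub> y"]) (auto simp: m_assoc[symmetric])
  qed (use one_closed in \<open>auto simp: m_assoc\<close>)
  then interpret torsor L M A B G "carrier G" "monoid.mult G" by unfold_locales
  have "diff \<one>\<^bsub>G\<^esub> (map \<sigma> \<one>\<^bsub>G\<^esub>) = \<one>\<^bsub>G\<^esub>" if "\<sigma> \<in> Gal" for \<sigma>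
    using Gal_GB(3)[OF that] diff_act[of "\<one>\<^bsub>G\<^esub>" "\<one>\<^bsub>G\<^esub>"] by simp
  then have "(\<lambda>\<sigma>\<in>Gal. diff \<one>\<^bsub>G\<^esub> (map \<sigma> \<one>\<^bsub>G\<^esub>)) = (\<lambda>\<sigma>\<in>Gal. \<one>\<^bsub>G\<^esub>)" by (rule restrict_ext)
  then show ?thesis using point_cocycle[OF one_GB] by simp
qed

end

theorem proposition3p7:
  fixes L :: "('f, 'r) language" and T :: "('f, 'r) fm set" and M :: "('f, 'r, 'a) struct"
    and A B :: "'a set"
  assumes "complete_theory TYPE('a) L T"
    and "eliminates_imaginaries TYPE('a) L T"
    and "models L T M"
    and "A \<subseteq> universe M"
    and "atomic_over L M A"
    and "strongly_omega_homogeneous_over L M A"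
    and "normal_extension L M A B"
    and "B = dcl L M B"
    and "\<forall>\<sigma>\<in>Aut L M B A. \<exists>\<tau>. automorphism L M \<tau> \<and> (\<forall>b\<in>B. \<tau> b = \<sigma> b)"
    and "atomic_over L M B"
    and "strongly_omega_homogeneous_over L M B"
  shows "\<exists>\<Phi> :: 'a list monoid \<Rightarrow> 'a gspace set \<Rightarrow> (('a \<Rightarrow> 'a) \<Rightarrow> 'a list) set.
    (\<forall>G. definable_group L M A G \<longrightarrow>
       pointed_iso (\<Phi> G) (P_def L M B A G) (P_base L M B A G) (H1_def L M B A G) (H1_base L M B A G)) \<and>
    (\<forall>G G'. definable_group L M A G \<longrightarrow> definable_group L M A G' \<longrightarrow>
       (\<forall>f\<in>definable_homs L M A G G'.
          P_map L M B A G G' f \<in> P_def L M B A G \<rightarrow> P_def L M B A G' \<and>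
          H1_map L M B A G' f \<in> H1_def L M B A G \<rightarrow> H1_def L M B A G' \<and>
          (\<forall>p\<in>P_def L M B A G.
             \<Phi> G' (P_map L M B A G G' f p) = H1_map L M B A G' f (\<Phi> G p))))"
proof -
  have "struct_of L M" using assms(3) by (simp add: models_def)
  moreover have "B \<subseteq> universe M" using assms(7) by (simp add: normal_extension_def)
  ultimately interpret normal_ext L M A B by unfold_locales (use assms in auto)
  define \<Phi> :: "'a list monoid \<Rightarrow> 'a gspace set \<Rightarrow> (('a \<Rightarrow> 'a) \<Rightarrow> 'a list) set"
    where "\<Phi> = (\<lambda>G p. {\<phi>. \<exists>S\<in>p. represents G S \<phi>})"
  have iso: "pointed_iso (\<Phi> G) (P_def L M B A G) (P_base L M B A G) (H1_def L M B A G) (H1_base L M B A G)"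
    if "definable_group L M A G" for G
  proof -
    interpret galois_group L M A B G using that by unfold_locales
    interpret class_correspondence "pointed_phs L M B A G" "phs_rel L M B A G"
      cocycles "cohomologous L M B A G" "represents G"
      by (rule represents_class_correspondence[OF assms(2,3)])
    have \<Phi>: "\<Phi> G = class_map" by (auto simp: \<Phi>_def class_map_def fun_eq_iff)
    show ?thesis
      unfolding pointed_iso_def \<Phi> P_def_def P_base_def H1_def_def H1_base_def
      using class_map_bij class_map_class[OF represents_trivial] dom[OF represents_trivial]
      by (auto intro: quotientI)
  qed
  have natural: "P_map L M B A G H f p \<in> P_def L M B A H \<and>
      \<Phi> H (P_map L M B A G H f p) = H1_map L M B A H f (\<Phi> G p)"
    and H1_map: "c \<in> H1_def L M B A G \<Longrightarrow> H1_map L M B A H f c \<in> H1_def L M B A H"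
    if "definable_group L M A G" "definable_group L M A H" "f \<in> definable_homs L M A G H"
      and p: "p \<in> P_def L M B A G" for G H f p c
  proof -
    interpret galois_group_hom L M A B G H f using that by unfold_locales
    interpret G: class_correspondence "pointed_phs L M B A G" "phs_rel L M B A G"
      G.cocycles "cohomologous L M B A G" "represents G"
      by (rule G.represents_class_correspondence[OF assms(2,3)])
    interpret H: class_correspondence "pointed_phs L M B A H" "phs_rel L M B A H"
      H.cocycles "cohomologous L M B A H" "represents H"
      by (rule H.represents_class_correspondence[OF assms(2,3)])
    have \<Phi>: "\<Phi> G = G.class_map" "\<Phi> H = H.class_map"
      by (auto simp: \<Phi>_def G.class_map_def H.class_map_def fun_eq_iff)
    have H1_map_class: "H1_map L M B A H f (cohomologous L M B A G `` {\<phi>}) = cohomologous L M B A H `` {push \<phi>}"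
      if "\<phi> \<in> G.cocycles" for \<phi>
      unfolding H1_map_def push_def[symmetric]
    proof (rule Image_within_class[OF H.equiv_s])
      show "push \<phi> \<in> {push \<psi> |\<psi>. \<psi> \<in> cohomologous L M B A G `` {\<phi>}}"
        using equiv_class_self[OF G.equiv_s that] by blast
      show "{push \<psi> |\<psi>. \<psi> \<in> cohomologous L M B A G `` {\<phi>}} \<subseteq> cohomologous L M B A H `` {push \<phi>}"
        using push_cohomologous by blast
    qed
    show "H1_map L M B A H f c \<in> H1_def L M B A H" if c: "c \<in> H1_def L M B A G"
    proof -
      obtain \<phi> where "\<phi> \<in> G.cocycles" "c = cohomologous L M B A G `` {\<phi>}"
        using c unfolding H1_def_def by (rule quotientE)
      then show ?thesis using H1_map_class push_cocycle by (simp add: H1_def_def quotientI)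
    qed
    obtain S where S: "S \<in> pointed_phs L M B A G" "p = phs_rel L M B A G `` {S}"
      using p unfolding P_def_def by (rule quotientE)
    obtain \<phi> where \<phi>: "represents G S \<phi>" using G.total[OF S(1)] by blast
    obtain S' where S': "contracted_product L M A G H f S S'"
      using contracted_product_exists[OF assms(2,3) \<phi>] by blast
    have R': "represents H S' (push \<phi>)" by (rule contracted_product_represents[OF \<phi> S'])
    \<comment> \<open>All contracted products of torsors in \<open>p\<close> are isomorphic, as their cocycles are cohomologous.\<close>
    have "P_map L M B A G H f p = phs_rel L M B A H `` {S'}"
      unfolding P_map_def
    proof (rule Image_within_class[OF H.equiv_r])
      show "S' \<in> {S'. \<exists>S\<in>p. contracted_product L M A G H f S S'}"
        using S' equiv_class_self[OF G.equiv_r S(1)] S(2) by blast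
      show "{S'. \<exists>S\<in>p. contracted_product L M A G H f S S'} \<subseteq> phs_rel L M B A H `` {S'}"
      proof
        fix S1' assume "S1' \<in> {S'. \<exists>S\<in>p. contracted_product L M A G H f S S'}"
        then obtain S1 where S1: "(S, S1) \<in> phs_rel L M B A G" "contracted_product L M A G H f S1 S1'"
          using S(2) by blast
        obtain \<phi>1 where \<phi>1: "represents G S1 \<phi>1" using G.total S1(1) G.r_sub by blast
        have "(push \<phi>, push \<phi>1) \<in> cohomologous L M B A H"
          using push_cohomologous G.respects[OF \<phi> \<phi>1] S1(1) by blast
        then show "S1' \<in> phs_rel L M B A H `` {S'}"
          using H.respects[OF R' contracted_product_represents[OF \<phi>1 S1(2)]] by blast
      qed
    qed
    moreover have "H1_map L M B A H f (\<Phi> G p) = cohomologous L M B A H `` {push \<phi>}"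
      using G.class_map_class[OF \<phi>] H1_map_class G.dom[OF \<phi>] \<Phi> S(2) by simp
    ultimately show "P_map L M B A G H f p \<in> P_def L M B A H \<and>
        \<Phi> H (P_map L M B A G H f p) = H1_map L M B A H f (\<Phi> G p)"
      using H.class_map_class[OF R'] H.dom[OF R'] \<Phi> by (simp add: P_def_def quotientI)
  qed
  have base: "P_base L M B A G \<in> P_def L M B A G" if "definable_group L M A G" for G
    using iso[OF that] by (simp add: pointed_iso_def)
  show ?thesis
  proof (intro exI[where x = \<Phi>] conjI allI impI ballI)
    fix G H f
    assume G: "definable_group L M A G" and H: "definable_group L M A H" and f: "f \<in> definable_homs L M A G H"
    show "P_map L M B A G H f \<in> P_def L M B A G \<rightarrow> P_def L M B A H"
      using natural[OF G H f] by blast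
    show "H1_map L M B A H f \<in> H1_def L M B A G \<rightarrow> H1_def L M B A H"
      using H1_map[OF G H f base[OF G]] by blast
    show "\<Phi> H (P_map L M B A G H f p) = H1_map L M B A H f (\<Phi> G p)" if "p \<in> P_def L M B A G" for p
      using natural[OF G H f that] by blast
  qed (rule iso)
qed

end
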